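(* Suppose $f\in\mathcal D_{\alpha,2}(L)$ (for some $L>0$) and Assumptions (A1)–(A5) of the context hold. Then: (a) $P(\hat I\neq I_0)\to 0$ as $n\to\infty$, for some given $\alpha\in(1/2,r)$, when $\hat I$ is the index set selected by the penalized least squares criterion over the collection $\{S_{I,K_{n,\alpha}}\}_{I\in\mathcal I}$, with $K_{n,\alpha}\asymp n^{1/(2\alpha+1)}$ and penalty $\mathrm{pen}(I,K_{n,\alpha})=2(|I|+1)\,rK_{n,\alpha}\,\frac{\log n}{n}$. (b) $P(\hat I\neq I_0)\to 0$ as $n\to\infty$, uniformly over $\alpha\in[1/2+a,r)$, for some $a>0$, arbitrarily small, when $\hat I$ is the index set selected by the penalized least squares criterion over the collection $\{S_{I,K_{n,a}}\}_{I\in\mathcal I}$, with $K_{n,a}\asymp n^{1/(2a+2)}$ and penalty $\mathrm{pen}(I,K_{n,a})=2(|I|+1)\,rK_{n,a}\,\frac{\log n}{n}$.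
   Context: Model. Let $q\ge 1$. One observes i.i.d. $((\underline X_i,T_i),Y_i)$, $i=1,\dots,n$, with $Y_i=\beta'\underline X_i+f(T_i)+W_i=s(\underline X_i,T_i)+W_i$, where $\beta\in\mathbb R^q$, $f:[0,1]\to\mathbb R$, $s(\underline x,t)=\beta'\underline x+f(t)$, and the $W_i$ are i.i.d., mean zero, independent of the $(\underline X_i,T_i)\in\mathbb R^q\times\mathbb R$. $\mu,\mu_X,\mu_T$ are the laws of $(\underline X,T)$, $\underline X=(X_1,\dots,X_q)'$ and $T$; $\lambda$ is Lebesgue measure. $I_0\subseteq\{1,\dots,q\}$ is the set of indices of the nonzero components of $\beta$. Smoothness classes. For $\alpha>0$, $\mathrm{Lip}^*(\alpha,L_2(\mu_T))$ is the generalized Lipschitz space of $g\in L_2([0,1],\mu_T)$ with finite seminorm $|g|_{\alpha,2}=\sup_{h>0}h^{-\alpha}\omega_{k}(g,h)_2$, where $k=[\alpha]+1$ and $\omega_k(\cdot,\cdot)_2$ is the $k$-th order modulus of smoothness in $L_2(\mu_T)$. For $A>0$, $\mathcal D_{\alpha,2}(A)=\{g\in \mathrm{Lip}^*(\alpha,L_2(\mu_T)):|g|_{\alpha,2}\le A\}$. Assumptions. Fix a constant $b\ge 3$ and put $r=[\frac{b-1}{2}]$ ($[\cdot]$ is integer part). (A1) The support of $\mu$ is $\mathcal K\times[0,1]$ for a compact set $\mathcal K\subset\mathbb R^q$ ($\underline X\in\mathcal K$, $T\in[0,1]$ almost surely), and there $\mu$ has a Lebesgue density bounded below by $h_0>0$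 and above by $h_1<\infty$. (A2) There exists $d>0$ such that $\tau_p=E|W_1|^p<\infty$ for $p>4+d$. (A3) For every $l\in\mathbb R^q\setminus\{0\}$, $\mathrm{Var}(l'\underline X\mid T=t)>0$ for all $t\in[0,1]$. (A4) $s\in L_2(\mathcal K\times[0,1],\lambda)$. (A5) For some $\gamma>b/4$ and $A>0$, $\theta_j(t)=E(X_j\mid T=t)$ belongs to $\mathcal D_{\gamma,2}(A)$ for all $j\in\{1,\dots,q\}$. Approximating spaces. $\mathcal I$ is the set of all subsets of $\{1,\dots,q\}$. For $K$ a power of $2$, $S_K$ is the space of piecewise polynomials $v(t)=\sum_{j=1}^K P_j(t)\mathbb 1(\frac{j-1}{K}\le t<\frac jK)$ with each $P_j$ of degree at most $r-1$ (dimension $rK$). $S_{I,K}$ is the linear span of the coordinate functions $x_i$, $i\in I$, together with $S_K$ (as functions of $t$). $u\asymp v$ means that $u$ is an integer power of $2$ that differs from $v$ by at most a factor of $2$. Selection. For $u\in S_{I,K}$ let $\gamma_n(u)=n^{-1}\sum_{i=1}^n[Y_i-u(\underline X_i,T_i)]^2$. Given a collection $\{S_{I,K}\}_{I\in\mathcal I}$ (with $K=K_{n,\alpha}$ or $K=K_{n,a}$) and a penalty $\mathrm{pen}(I,K)$, the selected index set $\hat I$ is a minimizer over $I\in\mathcal I$ of $\inf_{u\in S_{I,K}}\gamma_n(u)+\mathrm{pen}(I,K)$. *)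

theory Defs
  imports "HOL-Probability.Probability" "HOL-Computational_Algebra.Polynomial"
begin

text \<open>
  The covariate index set \<open>{1,\<dots>,q}\<close> is the finite type \<open>'q\<close>, and the observations
  are indexed from \<open>0\<close>: the sample of size \<open>n\<close> consists of the indices \<open>i < n\<close>.
  The regression function may vary over one fixed design and noise sequence, so the
  responses are not part of the locale. Independence of the triples
  \<open>(X\<^sub>i, T\<^sub>i, W\<^sub>i)\<close> over \<open>i\<close>, together with independence of \<open>W\<^sub>i\<close> from \<open>(X\<^sub>i, T\<^sub>i)\<close> for each
  \<open>i\<close>, makes the whole noise sequence independent of the whole design. The latter is
  spelled out with \<open>indep_set\<close> because \<open>indep_var\<close> wants both variables to have one type.
\<close>

locale regression_model = prob_space M
  for M :: "'w measure"
    and X :: "nat \<Rightarrow> 'w \<Rightarrow> real ^ 'q"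
    and T :: "nat \<Rightarrow> 'w \<Rightarrow> real"
    and W :: "nat \<Rightarrow> 'w \<Rightarrow> real" +
  assumes indep_over_sample:
      "indep_vars (\<lambda>_. borel) (\<lambda>i \<omega>. ((X i \<omega>, T i \<omega>), W i \<omega>)) UNIV"
    and identically_distributed:
      "distr M borel (\<lambda>\<omega>. ((X i \<omega>, T i \<omega>), W i \<omega>))
         = distr M borel (\<lambda>\<omega>. ((X 0 \<omega>, T 0 \<omega>), W 0 \<omega>))"
    and noise_indep_design:
      "indep_set {(\<lambda>\<omega>. (X i \<omega>, T i \<omega>)) -` A \<inter> space M | A. A \<in> sets borel}
                 {W i -` B \<inter> space M | B. B \<in> sets borel}"
    and noise_integrable: "integrable M (W i)"
    and noise_mean_zero: "expectation (W i) = 0"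

definition regression_fun :: "real ^ 'q \<Rightarrow> (real \<Rightarrow> real) \<Rightarrow> (real ^ 'q) \<times> real \<Rightarrow> real" where
  "regression_fun \<beta> f = (\<lambda>(x, t). \<beta> \<bullet> x + f t)"

definition response ::
  "(nat \<Rightarrow> 'w \<Rightarrow> real ^ 'q) \<Rightarrow> (nat \<Rightarrow> 'w \<Rightarrow> real) \<Rightarrow> (nat \<Rightarrow> 'w \<Rightarrow> real) \<Rightarrow>
   real ^ 'q \<Rightarrow> (real \<Rightarrow> real) \<Rightarrow> nat \<Rightarrow> 'w \<Rightarrow> real" where
  "response X T W \<beta> f i \<omega> = regression_fun \<beta> f (X i \<omega>, T i \<omega>) + W i \<omega>"

definition law_XT ::
  "'w measure \<Rightarrow> (nat \<Rightarrow> 'w \<Rightarrow> real ^ 'q) \<Rightarrow> (nat \<Rightarrow> 'w \<Rightarrow> real) \<Rightarrow> ((real ^ 'q) \<times> real) measure" where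
  "law_XT M X T = distr M borel (\<lambda>\<omega>. (X 0 \<omega>, T 0 \<omega>))"

definition law_T :: "'w measure \<Rightarrow> (nat \<Rightarrow> 'w \<Rightarrow> real) \<Rightarrow> real measure" where
  "law_T M T = distr M borel (T 0)"

definition active_set :: "real ^ 'q \<Rightarrow> 'q set" where
  "active_set \<beta> = {j. \<beta> $ j \<noteq> 0}"

definition square_integrable_on :: "'a measure \<Rightarrow> 'a set \<Rightarrow> ('a \<Rightarrow> real) \<Rightarrow> bool" where
  "square_integrable_on \<nu> A g \<longleftrightarrow>
     set_borel_measurable \<nu> A g \<and> set_integrable \<nu> A (\<lambda>z. (g z)\<^sup>2)"


text \<open>
  Finite differences, moduli of smoothness and generalized Lipschitz classes on \<open>[0,1]\<close>.
  As usual, the difference with step \<open>\<delta>\<close> is only taken at those \<open>t\<close> for which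
  \<open>t\<close> and \<open>t + k\<delta>\<close> both lie in \<open>[0,1]\<close>. Norms are extended reals, so that the
  suprema below are genuine ones.
\<close>

definition finite_difference :: "nat \<Rightarrow> real \<Rightarrow> (real \<Rightarrow> real) \<Rightarrow> real \<Rightarrow> real" where
  "finite_difference k \<delta> g t =
     (\<Sum>j\<le>k. (-1) ^ (k - j) * real (k choose j) * g (t + real j * \<delta>))"

definition L2_norm_on :: "real measure \<Rightarrow> real set \<Rightarrow> (real \<Rightarrow> real) \<Rightarrow> ereal" where
  "L2_norm_on \<nu> A g =
     (let s = (\<integral>\<^sup>+ t. ennreal ((g t)\<^sup>2) * indicator A t \<partial>\<nu>)
      in if s = \<infinity> then \<infinity> else ereal (sqrt (enn2real s)))"

definition modulus_of_smoothness :: "real measure \<Rightarrow> nat \<Rightarrow> (real \<Rightarrow> real) \<Rightarrow> real \<Rightarrow> ereal" where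
  "modulus_of_smoothness \<nu> k g h =
     (SUP \<delta>\<in>{0<..h}. L2_norm_on \<nu> {0..1 - real k * \<delta>} (finite_difference k \<delta> g))"

definition lip_seminorm :: "real measure \<Rightarrow> real \<Rightarrow> (real \<Rightarrow> real) \<Rightarrow> ereal" where
  "lip_seminorm \<nu> \<alpha> g =
     (SUP h\<in>{0<..}. ereal (h powr (- \<alpha>)) * modulus_of_smoothness \<nu> (nat \<lfloor>\<alpha>\<rfloor> + 1) g h)"

definition Lip_star :: "real measure \<Rightarrow> real \<Rightarrow> (real \<Rightarrow> real) set" where
  "Lip_star \<nu> \<alpha> = {g. square_integrable_on \<nu> {0..1} g \<and> lip_seminorm \<nu> \<alpha> g < \<infinity>}"

definition smoothness_ball :: "real measure \<Rightarrow> real \<Rightarrow> real \<Rightarrow> (real \<Rightarrow> real) set" where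
  "smoothness_ball \<nu> \<alpha> A = {g \<in> Lip_star \<nu> \<alpha>. lip_seminorm \<nu> \<alpha> g \<le> ereal A}"


definition measure_support :: "'a::topological_space measure \<Rightarrow> 'a set" where
  "measure_support \<nu> = {z. \<forall>U. open U \<and> z \<in> U \<longrightarrow> emeasure \<nu> U > 0}"

text \<open>
  \<open>cond_exp_version M Z T g\<close>: the function \<open>g\<close> is a version of \<open>t \<mapsto> E(Z | T = t)\<close>,
  i.e. \<open>E(Z | T) = g(T)\<close> almost surely.
\<close>

definition cond_exp_version ::
  "'w measure \<Rightarrow> ('w \<Rightarrow> real) \<Rightarrow> ('w \<Rightarrow> real) \<Rightarrow> (real \<Rightarrow> real) \<Rightarrow> bool" where
  "cond_exp_version M Z T g \<longleftrightarrow> g \<in> borel_measurable borel \<and>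
     (AE \<omega> in M. real_cond_exp M (vimage_algebra (space M) T borel) Z \<omega> = g (T \<omega>))"

definition cond_var_version ::
  "'w measure \<Rightarrow> ('w \<Rightarrow> real) \<Rightarrow> ('w \<Rightarrow> real) \<Rightarrow> (real \<Rightarrow> real) \<Rightarrow> bool" where
  "cond_var_version M Z T v \<longleftrightarrow>
     (\<exists>m. cond_exp_version M Z T m \<and> cond_exp_version M (\<lambda>\<omega>. (Z \<omega> - m (T \<omega>))\<^sup>2) T v)"

definition assumption_A1 ::
  "'w measure \<Rightarrow> (nat \<Rightarrow> 'w \<Rightarrow> real ^ 'q) \<Rightarrow> (nat \<Rightarrow> 'w \<Rightarrow> real) \<Rightarrow> (real ^ 'q) set \<Rightarrow> bool" where
  "assumption_A1 M X T \<K> \<longleftrightarrow>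
     compact \<K> \<and> measure_support (law_XT M X T) = \<K> \<times> {0..1} \<and>
     (\<exists>h0 h1 p. 0 < h0 \<and> p \<in> borel_measurable borel \<and>
        (\<forall>z\<in>\<K> \<times> {0..1}. h0 \<le> p z \<and> p z \<le> h1) \<and>
        law_XT M X T = density lborel (\<lambda>z. ennreal (p z) * indicator (\<K> \<times> {0..1}) z))"

definition assumption_A2 :: "'w measure \<Rightarrow> (nat \<Rightarrow> 'w \<Rightarrow> real) \<Rightarrow> bool" where
  "assumption_A2 M W \<longleftrightarrow> (\<exists>d>0. \<exists>p>4 + d. integrable M (\<lambda>\<omega>. \<bar>W 0 \<omega>\<bar> powr p))"

text \<open>
  A conditional variance given \<open>T = t\<close> is determined only up to a null set of values \<open>t\<close>;
  positivity at all \<open>t\<close> is required of some version.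
\<close>

definition assumption_A3 ::
  "'w measure \<Rightarrow> (nat \<Rightarrow> 'w \<Rightarrow> real ^ 'q) \<Rightarrow> (nat \<Rightarrow> 'w \<Rightarrow> real) \<Rightarrow> bool" where
  "assumption_A3 M X T \<longleftrightarrow>
     (\<forall>l. l \<noteq> 0 \<longrightarrow>
        (\<exists>v. cond_var_version M (\<lambda>\<omega>. l \<bullet> X 0 \<omega>) (T 0) v \<and> (\<forall>t\<in>{0..1}. v t > 0)))"

definition assumption_A4 :: "(real ^ 'q) set \<Rightarrow> real ^ 'q \<Rightarrow> (real \<Rightarrow> real) \<Rightarrow> bool" where
  "assumption_A4 \<K> \<beta> f \<longleftrightarrow> square_integrable_on lborel (\<K> \<times> {0..1}) (regression_fun \<beta> f)"

definition assumption_A5 ::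
  "'w measure \<Rightarrow> (nat \<Rightarrow> 'w \<Rightarrow> real ^ 'q) \<Rightarrow> (nat \<Rightarrow> 'w \<Rightarrow> real) \<Rightarrow> real \<Rightarrow> bool" where
  "assumption_A5 M X T b \<longleftrightarrow>
     (\<exists>\<gamma>>b / 4. \<exists>A>0. \<forall>j. \<exists>\<theta>. cond_exp_version M (\<lambda>\<omega>. X 0 \<omega> $ j) (T 0) \<theta> \<and>
        \<theta> \<in> smoothness_ball (law_T M T) \<gamma> A)"


definition piecewise_poly_space :: "nat \<Rightarrow> nat \<Rightarrow> (real \<Rightarrow> real) set" where
  "piecewise_poly_space r K =
     {v. \<exists>P :: nat \<Rightarrow> real poly. (\<forall>j\<in>{1..K}. degree (P j) \<le> r - 1) \<and>
        v = (\<lambda>t. \<Sum>j=1..K. poly (P j) t * indicator {(real j - 1) / real K ..< real j / real K} t)}"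

definition approx_space :: "nat \<Rightarrow> 'q set \<Rightarrow> nat \<Rightarrow> ((real ^ 'q) \<times> real \<Rightarrow> real) set" where
  "approx_space r I K =
     {u. \<exists>c. \<exists>v\<in>piecewise_poly_space r K. u = (\<lambda>(x, t). (\<Sum>i\<in>I. c i * x $ i) + v t)}"

definition dyadic_asymp :: "real \<Rightarrow> real \<Rightarrow> bool" where
  "dyadic_asymp u v \<longleftrightarrow> (\<exists>m::int. u = 2 powi m) \<and> v / 2 \<le> u \<and> u \<le> 2 * v"

definition ls_contrast ::
  "(nat \<Rightarrow> 'w \<Rightarrow> real ^ 'q) \<Rightarrow> (nat \<Rightarrow> 'w \<Rightarrow> real) \<Rightarrow> (nat \<Rightarrow> 'w \<Rightarrow> real) \<Rightarrow> nat \<Rightarrow> 'w \<Rightarrow>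
   ((real ^ 'q) \<times> real \<Rightarrow> real) \<Rightarrow> real" where
  "ls_contrast X T Y n \<omega> u = (1 / real n) * (\<Sum>i<n. (Y i \<omega> - u (X i \<omega>, T i \<omega>))\<^sup>2)"

definition pen :: "nat \<Rightarrow> nat \<Rightarrow> 'q set \<Rightarrow> nat \<Rightarrow> real" where
  "pen r n I K = 2 * (real (card I) + 1) * real r * real K * (ln (real n) / real n)"

definition penalized_criterion ::
  "(nat \<Rightarrow> 'w \<Rightarrow> real ^ 'q) \<Rightarrow> (nat \<Rightarrow> 'w \<Rightarrow> real) \<Rightarrow> (nat \<Rightarrow> 'w \<Rightarrow> real) \<Rightarrow> nat \<Rightarrow> nat \<Rightarrow> nat \<Rightarrow>
   'w \<Rightarrow> 'q set \<Rightarrow> real" where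
  "penalized_criterion X T Y r K n \<omega> I =
     (INF u\<in>approx_space r I K. ls_contrast X T Y n \<omega> u) + pen r n I K"

text \<open>
  A selector is any random index set that almost surely minimizes the criterion; no rule
  for breaking ties is imposed. Its measurability is part of the definition, since the
  probability of a non-measurable event would be \<open>0\<close> by convention.
\<close>

definition selected_index_set ::
  "'w measure \<Rightarrow> (nat \<Rightarrow> 'w \<Rightarrow> real ^ 'q) \<Rightarrow> (nat \<Rightarrow> 'w \<Rightarrow> real) \<Rightarrow> (nat \<Rightarrow> 'w \<Rightarrow> real) \<Rightarrow>
   nat \<Rightarrow> nat \<Rightarrow> nat \<Rightarrow> ('w \<Rightarrow> 'q set) \<Rightarrow> bool" where
  "selected_index_set M X T Y r K n Ihat \<longleftrightarrow>
     Ihat \<in> measurable M (count_space UNIV) \<and>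
     (AE \<omega> in M. is_arg_min (penalized_criterion X T Y r K n \<omega>) (\<lambda>I. I \<in> UNIV) (Ihat \<omega>))"

end

theory Submission
  imports Defs "HOL-Real_Asymp.Real_Asymp"
begin

text \<open>
  On the product domain the least squares problem is well conditioned: since the density of the
  design is bounded below, \<open>E(l \<bullet> X + v(T))\<^sup>2\<close> dominates a multiple of \<open>|l|\<^sup>2 + \<parallel>v\<parallel>\<^sup>2\<close>,
  uniformly over the splines \<open>v\<close>, and since \<open>K\<^sup>2 / n \<rightarrow> 0\<close> the empirical Gram matrix inherits
  this with probability tending to \<open>1\<close>. Whitney's inequality gives a spline within \<open>O(1 / K\<^sup>\<alpha>)\<close> of
  \<open>f\<close>, so that the squared bias, like the squared norm of the projected noise, is
  of order \<open>K / n\<close> in probability. Hence a superfluous covariate lowers the contrast only by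
  \<open>O(K / n)\<close>, less than its penalty of order \<open>K log n / n\<close>, whereas omitting an active
  covariate raises the contrast by a fixed amount, while the penalties vanish.
\<close>

section \<open>Whitney's inequality for piecewise polynomials\<close>

text \<open>Everything is uniform in a lower bound \<kappa> > 1/2 for the smoothness: part (a) is
  the case \<kappa> = \<alpha>, part (b) the case \<kappa> = 1/2 + a, for which 2 \<kappa> + 1 = 2 a
  + 2. Uniformity over f and \<alpha> holds because Whitney's constant depends only on the order of
  the difference, and only the orders 1, ..., r occur. The obstacle there is that the modulus of
  smoothness controls differences with equal steps, while the induction on the order generates
  unequal ones; Kemperman's identity bridges the gap. On the stochastic side second moments suffice.
  The Gram error is measured in the Frobenius norm, whose mean square is O(K^2 / n); the rate of K
  makes this vanish because \<kappa> > 1/2. Noise and bias are compared with thresholds of order K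
  log n / n, so that Markov's inequality leaves probabilities O(1 / log n); this is what the
  logarithm in the penalty buys.\<close>

abbreviation bin :: "nat \<Rightarrow> nat \<Rightarrow> real set" where
  "bin K j \<equiv> {real j / real K..<real (Suc j) / real K}"

abbreviation closed_bin :: "nat \<Rightarrow> nat \<Rightarrow> real set" where
  "closed_bin K j \<equiv> {real j / real K..real (Suc j) / real K}"

section \<open>Squared L2 norms over sets of reals\<close>

definition sq_on :: "real set \<Rightarrow> (real \<Rightarrow> real) \<Rightarrow> ennreal" where
  "sq_on E g = (\<integral>\<^sup>+ t. ennreal ((g t)\<^sup>2) * indicator E t \<partial>lborel)"

text \<open>Integrability over the whole line makes the class invariant under all translations, as
  moving averages require. The regression function enters as its extension by zero from
  \<open>{0..1}\<close>.\<close>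

definition L2_fun :: "(real \<Rightarrow> real) \<Rightarrow> bool" where
  "L2_fun f \<longleftrightarrow> f \<in> borel_measurable borel \<and> sq_on UNIV f < \<infinity>"

lemma ennreal_power2_add_le: "ennreal ((x + y)\<^sup>2) \<le> 2 * ennreal (x\<^sup>2) + 2 * ennreal (y\<^sup>2)"
proof -
  have "(x + y)\<^sup>2 \<le> 2 * x\<^sup>2 + 2 * y\<^sup>2"
    using sum_squares_bound[of x y] by (simp add: power2_sum)
  then have "ennreal ((x + y)\<^sup>2) \<le> ennreal (2 * x\<^sup>2 + 2 * y\<^sup>2)" by (rule ennreal_leI)
  then show ?thesis by (simp add: ennreal_mult)
qed

lemma sq_on_add_le:
  assumes [measurable]: "g \<in> borel_measurable borel" "h \<in> borel_measurable borel" "E \<in> sets borel"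
  shows "sq_on E (\<lambda>t. g t + h t) \<le> 2 * sq_on E g + 2 * sq_on E h"
proof -
  have "sq_on E (\<lambda>t. g t + h t)
      \<le> (\<integral>\<^sup>+ t. 2 * (ennreal ((g t)\<^sup>2) * indicator E t) + 2 * (ennreal ((h t)\<^sup>2) * indicator E t) \<partial>lborel)"
    unfolding sq_on_def
    by (intro nn_integral_mono) (use ennreal_power2_add_le in \<open>auto split: split_indicator\<close>)
  also have "\<dots> = 2 * sq_on E g + 2 * sq_on E h"
    unfolding sq_on_def by (subst nn_integral_add) (auto simp: nn_integral_cmult)
  finally show ?thesis .
qed

lemma sq_on_uminus: "sq_on E (\<lambda>t. - g t) = sq_on E g"
  by (simp add: sq_on_def)

lemma sq_on_diff_le:
  assumes [measurable]: "g \<in> borel_measurable borel" "h \<in> borel_measurable borel" "E \<in> sets borel"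
  shows "sq_on E (\<lambda>t. g t - h t) \<le> 2 * sq_on E g + 2 * sq_on E h"
  using sq_on_add_le[of g "\<lambda>t. - h t" E] by (simp add: sq_on_uminus)

lemma sq_on_mono:
  assumes "\<And>t. t \<in> E \<Longrightarrow> \<bar>g t\<bar> \<le> \<bar>h t\<bar>" "E \<subseteq> E'"
  shows "sq_on E g \<le> sq_on E' h"
  unfolding sq_on_def
proof (intro nn_integral_mono)
  fix t
  show "ennreal ((g t)\<^sup>2) * indicator E t \<le> ennreal ((h t)\<^sup>2) * indicator E' t"
    using assms(1)[of t] assms(2)
    by (auto split: split_indicator intro!: ennreal_leI simp: abs_le_square_iff)
qed

lemma sq_on_shift:
  assumes [measurable]: "g \<in> borel_measurable borel"
  shows "sq_on {a..b} (\<lambda>t. g (t + s)) = sq_on {a + s..b + s} g"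
proof -
  have "sq_on {a + s..b + s} g
      = (\<integral>\<^sup>+ t. ennreal ((g (s + 1 * t))\<^sup>2) * indicator {a + s..b + s} (s + 1 * t) \<partial>lborel)"
    unfolding sq_on_def by (subst nn_integral_real_affine[where c = 1 and t = s]) auto
  also have "\<dots> = sq_on {a..b} (\<lambda>t. g (t + s))"
    unfolding sq_on_def
    by (intro nn_integral_cong) (auto split: split_indicator simp: add.commute)
  finally show ?thesis ..
qed

lemma sq_on_shift_UNIV:
  assumes [measurable]: "g \<in> borel_measurable borel"
  shows "sq_on UNIV (\<lambda>t. g (t + s)) = sq_on UNIV g"
  using nn_integral_real_affine[of "\<lambda>t. ennreal ((g t)\<^sup>2)" 1 s]
  by (simp add: sq_on_def add.commute)

lemma L2_fun_measurable: "L2_fun f \<Longrightarrow> f \<in> borel_measurable borel"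
  by (simp add: L2_fun_def)

lemma L2_fun_shift: "L2_fun f \<Longrightarrow> L2_fun (\<lambda>t. f (t + s))"
  by (auto simp: L2_fun_def sq_on_shift_UNIV)

lemma L2_fun_diff:
  assumes "L2_fun f" "L2_fun g"
  shows "L2_fun (\<lambda>t. f t - g t)"
proof -
  have "sq_on UNIV (\<lambda>t. f t - g t) \<le> 2 * sq_on UNIV f + 2 * sq_on UNIV g"
    using assms by (intro sq_on_diff_le) (auto simp: L2_fun_def)
  also have "\<dots> < \<infinity>" using assms by (auto simp: L2_fun_def ennreal_mult_less_top)
  finally show ?thesis using assms by (auto simp: L2_fun_def)
qed

lemma L2_fun_set_integrable:
  assumes "L2_fun f"
  shows "set_integrable lborel {a..b} f"
proof -
  have [measurable]: "f \<in> borel_measurable borel" using assms by (rule L2_fun_measurable)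
  have "(\<integral>\<^sup>+ t. ennreal (norm (indicator {a..b} t *\<^sub>R f t)) \<partial>lborel)
      \<le> (\<integral>\<^sup>+ t. indicator {a..b} t + ennreal ((f t)\<^sup>2) \<partial>lborel)"
  proof (intro nn_integral_mono)
    fix t
    have "\<bar>f t\<bar> \<le> 1 + (f t)\<^sup>2"
      using zero_le_power2[of "\<bar>f t\<bar> - 1"] by (simp add: power2_diff)
    then have "ennreal \<bar>f t\<bar> \<le> ennreal (1 + (f t)\<^sup>2)" by (rule ennreal_leI)
    then show "ennreal (norm (indicator {a..b} t *\<^sub>R f t)) \<le> indicator {a..b} t + ennreal ((f t)\<^sup>2)"
      by (auto split: split_indicator)
  qed
  also have "\<dots> = emeasure lborel {a..b} + sq_on UNIV f"
    by (subst nn_integral_add) (auto simp: sq_on_def)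
  also have "\<dots> < \<infinity>" using assms by (auto simp: L2_fun_def emeasure_lborel_Icc_eq)
  finally show ?thesis
    unfolding set_integrable_def by (intro integrableI_bounded) auto
qed

text \<open>If \<open>\<psi>\<close> is not integrable, its Bochner integral is \<open>0\<close>.\<close>

lemma square_set_integral_le:
  fixes \<psi> :: "real \<Rightarrow> real"
  assumes [measurable]: "\<psi> \<in> borel_measurable borel" and "a \<le> b"
  shows "ennreal ((LINT s:{a..b}|lborel. \<psi> s)\<^sup>2) \<le> ennreal (b - a) * sq_on {a..b} \<psi>"
proof (cases "set_integrable lborel {a..b} \<psi> \<and> sq_on {a..b} \<psi> < \<infinity> \<and> a < b")
  case True
  then have i1: "set_integrable lborel {a..b} \<psi>" and "a < b" by auto
  have "(\<integral>\<^sup>+ t. ennreal (norm (indicator {a..b} t *\<^sub>R (\<psi> t)\<^sup>2)) \<partial>lborel) = sq_on {a..b} \<psi>"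
    unfolding sq_on_def by (intro nn_integral_cong) (auto split: split_indicator)
  then have i2: "set_integrable lborel {a..b} (\<lambda>s. (\<psi> s)\<^sup>2)"
    using True unfolding set_integrable_def by (intro integrableI_bounded) auto
  \<comment> \<open>Cauchy-Schwarz against the constant 1, in the form that the variance of
    \<open>\<psi>\<close> about its mean \<open>m\<close> is nonnegative.\<close>
  define m where "m = (LINT s:{a..b}|lborel. \<psi> s) / (b - a)"
  have ic: "set_integrable lborel {a..b} (\<lambda>s. c)" for c :: real
    unfolding set_integrable_def
    by (intro integrable_scaleR_left) (auto simp: emeasure_lborel_Icc_eq)
  have "0 \<le> (LINT s:{a..b}|lborel. (\<psi> s - m)\<^sup>2)"
    unfolding set_lebesgue_integral_def by (intro integral_nonneg_AE) auto
  also have "\<dots> = (LINT s:{a..b}|lborel. ((\<psi> s)\<^sup>2 + m\<^sup>2) - (2 * m) * \<psi> s)"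
    by (intro set_lebesgue_integral_cong) (auto simp: power2_diff)
  also have "\<dots> = (LINT s:{a..b}|lborel. (\<psi> s)\<^sup>2) + m\<^sup>2 * (b - a) - 2 * m * (LINT s:{a..b}|lborel. \<psi> s)"
    using i1 i2 ic \<open>a < b\<close> by (subst set_integral_diff; (subst set_integral_add)?) (auto simp: set_integral_const)
  finally have *: "0 \<le> (LINT s:{a..b}|lborel. (\<psi> s)\<^sup>2) + m\<^sup>2 * (b - a)
      - 2 * m * (LINT s:{a..b}|lborel. \<psi> s)" .
  have S: "(LINT s:{a..b}|lborel. \<psi> s) = m * (b - a)"
    using \<open>a < b\<close> by (simp add: m_def)
  have "0 \<le> (b - a) * ((LINT s:{a..b}|lborel. (\<psi> s)\<^sup>2) - m\<^sup>2 * (b - a))"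
    using * \<open>a < b\<close> unfolding S by (intro mult_nonneg_nonneg) (auto simp: power2_eq_square algebra_simps)
  then have "(LINT s:{a..b}|lborel. \<psi> s)\<^sup>2 \<le> (b - a) * (LINT s:{a..b}|lborel. (\<psi> s)\<^sup>2)"
    unfolding S by (simp add: power2_eq_square algebra_simps)
  then have "ennreal ((LINT s:{a..b}|lborel. \<psi> s)\<^sup>2)
      \<le> ennreal ((b - a) * (LINT s:{a..b}|lborel. (\<psi> s)\<^sup>2))" by (rule ennreal_leI)
  also have "\<dots> = ennreal (b - a) * ennreal (LINT s:{a..b}|lborel. (\<psi> s)\<^sup>2)"
    using \<open>a < b\<close> by (intro ennreal_mult) (auto simp: set_lebesgue_integral_def intro!: integral_nonneg_AE)
  also have "ennreal (LINT s:{a..b}|lborel. (\<psi> s)\<^sup>2) = sq_on {a..b} \<psi>"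
    unfolding sq_on_def set_lebesgue_integral_def
    using i2[unfolded set_integrable_def]
    by (subst nn_integral_eq_integral[symmetric])
       (auto intro!: nn_integral_cong split: split_indicator)
  finally show ?thesis .
next
  case False
  consider "\<not> set_integrable lborel {a..b} \<psi>" | "sq_on {a..b} \<psi> = \<infinity>" "a < b" | "a = b"
    using False \<open>a \<le> b\<close> by (cases "sq_on {a..b} \<psi>") (auto simp: less_le)
  then show ?thesis
  proof cases
    case 1
    then show ?thesis
      by (simp add: set_lebesgue_integral_def set_integrable_def not_integrable_integral_eq)
  next
    case 2
    then show ?thesis by (simp add: ennreal_mult_top)
  next
    case 3
    have "AE s in lborel. s \<noteq> a" by (rule AE_lborel_singleton)
    then have "(LINT s:{a..b}|lborel. \<psi> s) = 0"
      unfolding set_lebesgue_integral_def using 3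
      by (intro integral_eq_zero_AE, elim eventually_mono) (auto split: split_indicator)
    then show ?thesis by simp
  qed
qed


text \<open>Jensen's inequality for the average over the window, from Cauchy-Schwarz in
  \<open>s\<close> and Tonelli. The sum over \<open>j\<close> is carried along because the
  hypothesis bounds only the total over all intervals, for one common \<open>s\<close>.\<close>

lemma sq_on_average_le:
  fixes \<phi> :: "real \<Rightarrow> real \<Rightarrow> real"
  assumes m: "(\<lambda>(t, s). \<phi> t s) \<in> borel_measurable borel" and "0 < \<delta>" and "finite A"
    and E: "\<And>j. E j \<in> sets borel"
    and le: "\<And>s. s \<in> {0..\<delta>} \<Longrightarrow> (\<Sum>j\<in>A. sq_on (E j) (\<lambda>t. \<phi> t s)) \<le> B"
  shows "(\<Sum>j\<in>A. sq_on (E j) (\<lambda>t. (1 / \<delta>) * (LINT s:{0..\<delta>}|lborel. \<phi> t s))) \<le> B"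
proof -
  have [measurable]: "(\<lambda>(t, s). \<phi> t s) \<in> borel_measurable (borel \<Otimes>\<^sub>M borel)"
    using m by (simp add: borel_prod)
  have [measurable]: "(\<lambda>(t, s). \<phi> t s) \<in> borel_measurable (lborel \<Otimes>\<^sub>M lborel)"
    by measurable
  have [measurable]: "E j \<in> sets borel" for j by (rule E)
  have "sq_on (E j) (\<lambda>t. (1 / \<delta>) * (LINT s:{0..\<delta>}|lborel. \<phi> t s))
      \<le> ennreal (1 / \<delta>) * (\<integral>\<^sup>+ s. sq_on (E j) (\<lambda>t. \<phi> t s) * indicator {0..\<delta>} s \<partial>lborel)" for j
  proof -
    have "sq_on (E j) (\<lambda>t. (1 / \<delta>) * (LINT s:{0..\<delta>}|lborel. \<phi> t s))
      \<le> (\<integral>\<^sup>+ t. ennreal (1 / \<delta>) * (\<integral>\<^sup>+ s. ennreal ((\<phi> t s)\<^sup>2) * indicator {0..\<delta>} s * indicator (E j) t \<partial>lborel) \<partial>lborel)"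
      unfolding sq_on_def
    proof (intro nn_integral_mono)
      fix t :: real
      have "ennreal (((1 / \<delta>) * (LINT s:{0..\<delta>}|lborel. \<phi> t s))\<^sup>2)
          = ennreal ((1 / \<delta>)\<^sup>2) * ennreal ((LINT s:{0..\<delta>}|lborel. \<phi> t s)\<^sup>2)"
        by (subst ennreal_mult[symmetric]) (auto simp: power_mult_distrib power_divide)
      also have "\<dots> \<le> ennreal ((1 / \<delta>)\<^sup>2) * (ennreal (\<delta> - 0) * sq_on {0..\<delta>} (\<phi> t))"
        using \<open>0 < \<delta>\<close> by (intro mult_left_mono square_set_integral_le) auto
      also have "\<dots> = ennreal ((1 / \<delta>)\<^sup>2 * \<delta>) * sq_on {0..\<delta>} (\<phi> t)"
        using \<open>0 < \<delta>\<close> by (subst ennreal_mult) (auto simp: mult.assoc)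
      also have "(1 / \<delta>)\<^sup>2 * \<delta> = 1 / \<delta>"
        using \<open>0 < \<delta>\<close> by (simp add: power2_eq_square)
      finally show "ennreal (((1 / \<delta>) * (LINT s:{0..\<delta>}|lborel. \<phi> t s))\<^sup>2) * indicator (E j) t
          \<le> ennreal (1 / \<delta>) * (\<integral>\<^sup>+ s. ennreal ((\<phi> t s)\<^sup>2) * indicator {0..\<delta>} s * indicator (E j) t \<partial>lborel)"
        unfolding sq_on_def by (auto split: split_indicator)
    qed
    also have "\<dots> = ennreal (1 / \<delta>) * (\<integral>\<^sup>+ t. (\<integral>\<^sup>+ s. ennreal ((\<phi> t s)\<^sup>2) * indicator {0..\<delta>} s * indicator (E j) t \<partial>lborel) \<partial>lborel)"
      by (rule nn_integral_cmult) measurable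
    also have "(\<integral>\<^sup>+ t. (\<integral>\<^sup>+ s. ennreal ((\<phi> t s)\<^sup>2) * indicator {0..\<delta>} s * indicator (E j) t \<partial>lborel) \<partial>lborel)
        = (\<integral>\<^sup>+ s. (\<integral>\<^sup>+ t. ennreal ((\<phi> t s)\<^sup>2) * indicator {0..\<delta>} s * indicator (E j) t \<partial>lborel) \<partial>lborel)"
      by (rule lborel_pair.Fubini') measurable
    also have "\<dots> = (\<integral>\<^sup>+ s. sq_on (E j) (\<lambda>t. \<phi> t s) * indicator {0..\<delta>} s \<partial>lborel)"
      unfolding sq_on_def
      by (intro nn_integral_cong) (auto split: split_indicator)
    finally show ?thesis .
  qed
  then have "(\<Sum>j\<in>A. sq_on (E j) (\<lambda>t. (1 / \<delta>) * (LINT s:{0..\<delta>}|lborel. \<phi> t s)))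
      \<le> (\<Sum>j\<in>A. ennreal (1 / \<delta>) * (\<integral>\<^sup>+ s. sq_on (E j) (\<lambda>t. \<phi> t s) * indicator {0..\<delta>} s \<partial>lborel))"
    by (intro sum_mono)
  also have "\<dots> = ennreal (1 / \<delta>) * (\<integral>\<^sup>+ s. (\<Sum>j\<in>A. sq_on (E j) (\<lambda>t. \<phi> t s) * indicator {0..\<delta>} s) \<partial>lborel)"
    unfolding sq_on_def
    by (subst nn_integral_sum) (auto simp: sum_distrib_left)
  also have "\<dots> \<le> ennreal (1 / \<delta>) * (\<integral>\<^sup>+ s. B * indicator {0..\<delta>} s \<partial>lborel)"
    using le by (intro mult_left_mono nn_integral_mono) (auto split: split_indicator simp: sum_distrib_right[symmetric])
  also have "\<dots> = B"
    using \<open>0 < \<delta>\<close>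
    by (simp add: nn_integral_cmult_indicator mult.left_commute[of _ B] ennreal_mult[symmetric])
  finally show ?thesis .
qed

section \<open>Differences with varying steps\<close>

fun mixed_difference :: "nat \<Rightarrow> (nat \<Rightarrow> real) \<Rightarrow> (real \<Rightarrow> real) \<Rightarrow> real \<Rightarrow> real" where
  "mixed_difference 0 w g x = g x"
| "mixed_difference (Suc n) w g x = mixed_difference n w g (x + w n) - mixed_difference n w g x"

lemma mixed_difference_measurable [measurable]:
  assumes [measurable]: "g \<in> borel_measurable borel"
  shows "mixed_difference n w g \<in> borel_measurable borel"
  by (induction n) auto

lemma mixed_difference_measurable_param:
  assumes "(\<lambda>(t, s). \<phi> t s) \<in> borel_measurable borel"
  shows "(\<lambda>(x, s :: real). mixed_difference n w (\<lambda>t. \<phi> t s) x) \<in> borel_measurable borel"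
proof (induction n)
  case (Suc n)
  note [measurable] = Suc[unfolded borel_prod[symmetric]]
  show ?case unfolding borel_prod[symmetric] by simp
qed (use assms in simp)

lemma mixed_difference_shift:
  "mixed_difference n w (\<lambda>x. g (x + a)) x = mixed_difference n w g (x + a)"
  by (induction n arbitrary: x) (auto simp: add_ac)

lemma mixed_difference_diff:
  "mixed_difference n w (\<lambda>x. f x - g x) x = mixed_difference n w f x - mixed_difference n w g x"
  by (induction n arbitrary: x) auto

lemma mixed_difference_cmult:
  "mixed_difference n w (\<lambda>x. c * f x) x = c * mixed_difference n w f x"
  by (induction n arbitrary: x) (auto simp: algebra_simps)

lemma mixed_difference_cong:
  "(\<And>i. i < n \<Longrightarrow> w i = w' i) \<Longrightarrow> mixed_difference n w g x = mixed_difference n w' g x"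
  by (induction n arbitrary: x) auto

text \<open>Shifts commute, so a difference taken first may be counted as the last step. Position
  \<open>n\<close> of \<open>w\<close> is free for it, since order \<open>n\<close> uses only the
  steps below \<open>n\<close>.\<close>

lemma mixed_difference_of_difference:
  "mixed_difference n w (\<lambda>x. g (x + a) - g x) x = mixed_difference (Suc n) (w(n := a)) g x"
  using mixed_difference_cong[of n w "w(n := a)" g]
  by (simp add: mixed_difference_diff mixed_difference_shift)

lemma mixed_difference_integral:
  assumes "\<And>t. integrable N (\<lambda>s. \<phi> t s)"
  shows "integrable N (\<lambda>s. mixed_difference n w (\<lambda>t. \<phi> t s) x) \<and>
    mixed_difference n w (\<lambda>t. \<integral>s. \<phi> t s \<partial>N) x = (\<integral>s. mixed_difference n w (\<lambda>t. \<phi> t s) x \<partial>N)"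
  by (induction n arbitrary: x) (use assms in auto)

lemma poly_measurable [measurable]: "(\<lambda>t. poly p t) \<in> borel_measurable (borel :: real measure)"
  by (intro borel_measurable_continuous_onI continuous_intros)

text \<open>The last clause serves the induction on the order, where "zero or of degree less than k"
  must become "of degree at most k" also for k = 0.\<close>

lemma poly_antiderivative:
  fixes p :: "real poly"
  obtains Q where "pderiv Q = p" "degree Q \<le> degree p + 1" "p = 0 \<Longrightarrow> Q = 0"
proof -
  have "\<exists>Q. pderiv Q = p \<and> degree Q \<le> degree p + 1 \<and> (p = 0 \<longrightarrow> Q = 0)"
  proof (cases "p = 0")
    case False
    define Q where "Q = (\<Sum>i\<le>degree p. monom (coeff p i / real (Suc i)) (Suc i))"
    have "pderiv Q = (\<Sum>i\<le>degree p. monom (coeff p i) i)"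
      unfolding Q_def
      by (subst sum_comp_morphism[of pderiv, symmetric, unfolded comp_def])
         (auto simp: pderiv_add pderiv_monom simp del: of_nat_Suc)
    also have "\<dots> = p" by (rule poly_as_sum_of_monoms)
    finally have "pderiv Q = p" .
    moreover have "degree Q \<le> degree p + 1"
      unfolding Q_def
      by (intro degree_sum_le) (auto intro: order_trans[OF degree_monom_le])
    ultimately show ?thesis using False by blast
  qed (auto intro: exI[of _ 0])
  then show thesis using that by blast
qed


text \<open>A primitive that vanishes at the left end is controlled by its derivative:
  Cauchy-Schwarz at each point costs \<open>l / \<delta>\<^sup>2\<close>, integration over the
  interval another \<open>l\<close>.\<close>

lemma square_primitive_le:
  fixes g :: "real \<Rightarrow> real"
  assumes g: "L2_fun g" and "0 < \<delta>" "0 \<le> l"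
    and G: "\<And>t. t \<in> {x..x + l} \<Longrightarrow> G t = (1 / \<delta>) * (LINT s:{x..t}|lborel. g s - poly p s)"
  shows "sq_on {x..x + l} G \<le> ennreal ((l / \<delta>)\<^sup>2) * sq_on {x..x + l} (\<lambda>t. g t - poly p t)"
proof -
  have [measurable]: "g \<in> borel_measurable borel" using g by (rule L2_fun_measurable)
  have "sq_on {x..x + l} G
      \<le> (\<integral>\<^sup>+ t. (ennreal (l / \<delta>\<^sup>2) * sq_on {x..x + l} (\<lambda>t. g t - poly p t)) * indicator {x..x + l} t \<partial>lborel)"
    unfolding sq_on_def[of _ G]
  proof (intro nn_integral_mono)
    fix t
    have "ennreal ((G t)\<^sup>2) \<le> ennreal (l / \<delta>\<^sup>2) * sq_on {x..x + l} (\<lambda>t. g t - poly p t)"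
      if t: "t \<in> {x..x + l}"
    proof -
      have "ennreal ((G t)\<^sup>2) = ennreal ((1 / \<delta>)\<^sup>2) * ennreal ((LINT s:{x..t}|lborel. g s - poly p s)\<^sup>2)"
        unfolding G[OF t] by (subst ennreal_mult[symmetric]) (auto simp: power_mult_distrib power_divide)
      also have "\<dots> \<le> ennreal ((1 / \<delta>)\<^sup>2) * (ennreal (t - x) * sq_on {x..t} (\<lambda>t. g t - poly p t))"
        using t by (intro mult_left_mono square_set_integral_le) auto
      also have "\<dots> \<le> ennreal ((1 / \<delta>)\<^sup>2) * (ennreal l * sq_on {x..x + l} (\<lambda>t. g t - poly p t))"
        using t by (intro mult_left_mono mult_mono sq_on_mono ennreal_leI) auto
      also have "\<dots> = ennreal (l / \<delta>\<^sup>2) * sq_on {x..x + l} (\<lambda>t. g t - poly p t)"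
        using \<open>0 \<le> l\<close> by (subst mult.assoc[symmetric], subst ennreal_mult[symmetric]) (auto simp: power_divide)
      finally show ?thesis .
    qed
    then show "ennreal ((G t)\<^sup>2) * indicator {x..x + l} t
        \<le> (ennreal (l / \<delta>\<^sup>2) * sq_on {x..x + l} (\<lambda>t. g t - poly p t)) * indicator {x..x + l} t"
      by (auto split: split_indicator)
  qed
  also have "\<dots> = ennreal (l / \<delta>\<^sup>2) * sq_on {x..x + l} (\<lambda>t. g t - poly p t) * ennreal l"
    using \<open>0 \<le> l\<close> by (simp add: nn_integral_cmult_indicator)
  also have "\<dots> = ennreal (l / \<delta>\<^sup>2 * l) * sq_on {x..x + l} (\<lambda>t. g t - poly p t)"
    using \<open>0 \<le> l\<close> by (subst ennreal_mult) (auto simp: mult_ac)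
  also have "l / \<delta>\<^sup>2 * l = (l / \<delta>)\<^sup>2" by (simp add: power2_eq_square)
  finally show ?thesis .
qed

text \<open>Replaces differentiation of the moving average, which an L2 function allows only almost
  everywhere. Both sides equal the integral over \<open>{t..t + \<delta>}\<close> minus that over
  \<open>{x..x + \<delta>}\<close>, once the integral over \<open>{x..t + \<delta>}\<close> is split
  in two ways.\<close>

lemma average_diff_eq:
  assumes f: "L2_fun f" and "0 < \<delta>" "x \<le> t"
  shows "(LINT s:{0..\<delta>}|lborel. f (t + s)) - (LINT s:{0..\<delta>}|lborel. f (x + s))
    = (LINT s:{x..t}|lborel. f (s + \<delta>) - f s)"
proof -
  have i: "f integrable_on {a..b}" and I: "(LINT s:{a..b}|lborel. f s) = integral {a..b} f" for a b
    using set_borel_integral_eq_integral[OF L2_fun_set_integrable[OF f]] by auto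
  have sh: "(LINT s:{a..b}|lborel. f (c + s)) = integral {a + c..b + c} f" for a b c
  proof -
    have "(LINT s:{a + c..b + c}|lborel. f s)
        = (LINT s|lborel. indicator {a + c..b + c} (c + 1 * s) *\<^sub>R f (c + 1 * s))"
      unfolding set_lebesgue_integral_def
      by (subst lborel_integral_real_affine[where c = 1 and t = c]) auto
    also have "\<dots> = (LINT s:{a..b}|lborel. f (c + s))"
      unfolding set_lebesgue_integral_def
      by (intro Bochner_Integration.integral_cong) (auto split: split_indicator)
    finally show ?thesis by (simp add: I)
  qed
  have "(LINT s:{x..t}|lborel. f (s + \<delta>) - f s) = integral {x + \<delta>..t + \<delta>} f - integral {x..t} f"
    using L2_fun_set_integrable[OF f] L2_fun_set_integrable[OF L2_fun_shift[OF f, of \<delta>]] sh[of x t \<delta>]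
    by (subst set_integral_diff(2)) (auto simp: I add.commute[of \<delta>])
  moreover have "integral {x..t} f + integral {t..t + \<delta>} f = integral {x..t + \<delta>} f"
    by (rule Henstock_Kurzweil_Integration.integral_combine) (use assms i in auto)
  moreover have "integral {x..x + \<delta>} f + integral {x + \<delta>..t + \<delta>} f = integral {x..t + \<delta>} f"
    by (rule Henstock_Kurzweil_Integration.integral_combine) (use assms i in auto)
  ultimately show ?thesis using sh[of 0 \<delta> t] sh[of 0 \<delta> x] by (simp add: add.commute)
qed

text \<open>
  Induction on the order. The average \<open>F\<close> of \<open>f\<close> over a window of length \<open>\<delta>\<close> has derivative
  \<open>(f(t + \<delta>) - f(t)) / \<delta>\<close>, and \<open>F - f\<close> is an average of first differences of \<open>f\<close>; both of these
  have mixed differences of order \<open>k\<close> that are mixed differences of \<open>f\<close> of order \<open>k + 1\<close>.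
\<close>

lemma whitney_mixed:
  assumes "L2_fun f" and d: "0 < \<delta>" and l: "0 \<le> l" and fin: "finite A"
    and B: "\<And>w. (\<And>i. w i \<in> {0..\<delta>}) \<Longrightarrow> (\<Sum>j\<in>A. sq_on {x j..x j + l} (mixed_difference k w f)) \<le> B"
  shows "\<exists>p. (\<forall>j. p j = 0 \<or> degree (p j) < k) \<and>
    (\<Sum>j\<in>A. sq_on {x j..x j + l} (\<lambda>t. f t - poly (p j) t)) \<le> ennreal ((2 + 2 * (l / \<delta>)\<^sup>2) ^ k) * B"
  using assms(1) B
proof (induction k arbitrary: f B)
  case 0
  \<comment> \<open>Order 0: the difference is \<open>f\<close> itself, and only the zero polynomial
    is allowed; zero steps are an admissible choice of \<open>w\<close>.\<close>
  show ?case
    by (rule exI[of _ "\<lambda>_. 0"]) (use 0(2)[of "\<lambda>_. 0"] d in \<open>simp add: mixed_difference.simps[abs_def]\<close>)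
next
  case (Suc k)
  note f = Suc.prems(1)
  have [measurable]: "f \<in> borel_measurable borel" using f by (rule L2_fun_measurable)
  define g where "g = (\<lambda>t. f (t + \<delta>) - f t)"
  define h where "h = (\<lambda>t. (1 / \<delta>) * (LINT s:{0..\<delta>}|lborel. f (t + s) - f t))"
  define F where "F = (\<lambda>t. (1 / \<delta>) * (LINT s:{0..\<delta>}|lborel. f (t + s)))"
  have g: "L2_fun g" unfolding g_def using f by (intro L2_fun_diff L2_fun_shift)
  have [measurable]: "g \<in> borel_measurable borel" using g by (rule L2_fun_measurable)
  have [measurable]: "h \<in> borel_measurable borel" unfolding h_def set_lebesgue_integral_def by measurable
  have [measurable]: "F \<in> borel_measurable borel" unfolding F_def set_lebesgue_integral_def by measurable
  have m2: "(\<lambda>(t, s). f (t + s) - f t) \<in> borel_measurable borel"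
    unfolding borel_prod[symmetric] by measurable
  have si: "set_integrable lborel {0..\<delta>} (\<lambda>s. f (t + s))" for t
    using L2_fun_set_integrable[OF L2_fun_shift[OF f, of t]] by (simp add: add.commute)
  have sc: "set_integrable lborel {0..\<delta>} (\<lambda>s. c)" for c :: real
    unfolding set_integrable_def
    by (intro integrable_scaleR_left) (auto simp: emeasure_lborel_Icc_eq)
  \<comment> \<open>The averaging bound with a single index and the whole line as its set shows that
    \<open>h\<close> is again square integrable.\<close>
  have "sq_on UNIV h \<le> 4 * sq_on UNIV f"
  proof -
    have "sq_on UNIV (\<lambda>t. f (t + s) - f t) \<le> 4 * sq_on UNIV f" for s
    proof -
      have "sq_on UNIV (\<lambda>t. f (t + s) - f t) \<le> 2 * sq_on UNIV (\<lambda>t. f (t + s)) + 2 * sq_on UNIV f"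
        by (intro sq_on_diff_le) auto
      also have "\<dots> = 4 * sq_on UNIV f"
        by (simp add: sq_on_shift_UNIV distrib_right[symmetric])
      finally show ?thesis .
    qed
    then show ?thesis
      using sq_on_average_le[OF m2 d, of "{()}" "\<lambda>_. UNIV"] by (simp add: h_def)
  qed
  then have h: "L2_fun h"
    using f by (auto simp: L2_fun_def ennreal_mult_less_top intro: le_less_trans)
  \<comment> \<open>The extra step is \<open>\<delta>\<close> for \<open>g\<close> and the
    integration variable \<open>s\<close> for \<open>h\<close>; both lie in
    \<open>{0..\<delta>}\<close>, so the hypothesis of order \<open>k + 1\<close> applies.\<close>
  have Bg: "(\<Sum>j\<in>A. sq_on {x j..x j + l} (mixed_difference k w g)) \<le> B" if "\<And>i. w i \<in> {0..\<delta>}" for w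
    unfolding g_def mixed_difference_of_difference[abs_def]
    using that d by (intro Suc.prems(2)) auto
  have Bh: "(\<Sum>j\<in>A. sq_on {x j..x j + l} (mixed_difference k w h)) \<le> B" if w: "\<And>i. w i \<in> {0..\<delta>}" for w
  proof -
    have "mixed_difference k w h t
        = (1 / \<delta>) * (LINT s:{0..\<delta>}|lborel. mixed_difference k w (\<lambda>t. f (t + s) - f t) t)" for t
    proof -
      have "integrable lborel (\<lambda>s. indicator {0..\<delta>} s *\<^sub>R (f (t + s) - f t))" for t
        using set_integral_diff(1)[OF si sc] by (simp add: set_integrable_def)
      note * = conjunct2[OF mixed_difference_integral[OF this, where n = k and w = w and x = t]]
      show ?thesis
        unfolding h_def mixed_difference_cmult set_lebesgue_integral_def *
        by (simp add: mixed_difference_cmult)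
    qed
    then have "mixed_difference k w h
        = (\<lambda>t. (1 / \<delta>) * (LINT s:{0..\<delta>}|lborel. mixed_difference k w (\<lambda>t. f (t + s) - f t) t))"
      by blast
    moreover have "(\<Sum>j\<in>A. sq_on {x j..x j + l} (mixed_difference k w (\<lambda>t. f (t + s) - f t))) \<le> B"
      if "s \<in> {0..\<delta>}" for s
      unfolding mixed_difference_of_difference[abs_def]
      using that w by (intro Suc.prems(2)) auto
    ultimately show ?thesis
      using sq_on_average_le[OF mixed_difference_measurable_param[OF m2] d fin] by simp
  qed
  \<comment> \<open>One 2 for each part of \<open>f = F - h\<close>; the part \<open>F\<close> also
    pays \<open>(l / \<delta>)\<^sup>2\<close> for passing to a primitive.\<close>
  let ?c = "2 + 2 * (l / \<delta>)\<^sup>2"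
  obtain p where p: "\<And>j. p j = 0 \<or> degree (p j) < k"
    and pB: "(\<Sum>j\<in>A. sq_on {x j..x j + l} (\<lambda>t. g t - poly (p j) t)) \<le> ennreal (?c ^ k) * B"
    using Suc.IH[OF g Bg] by blast
  obtain q where q: "\<And>j. q j = 0 \<or> degree (q j) < k"
    and qB: "(\<Sum>j\<in>A. sq_on {x j..x j + l} (\<lambda>t. h t - poly (q j) t)) \<le> ennreal (?c ^ k) * B"
    using Suc.IH[OF h Bh] by blast
  have "\<exists>Q. pderiv Q = p j \<and> degree Q \<le> degree (p j) + 1 \<and> (p j = 0 \<longrightarrow> Q = 0)" for j
    using poly_antiderivative[of "p j"] by metis
  then obtain Q where Q: "\<And>j. pderiv (Q j) = p j" "\<And>j. degree (Q j) \<le> degree (p j) + 1"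
    "\<And>j. p j = 0 \<Longrightarrow> Q j = 0" by metis
  \<comment> \<open>The integration constant makes \<open>F - P j\<close> vanish at
    \<open>x j\<close>, as the bound for primitives requires.\<close>
  define P where "P j = [:F (x j) - poly (Q j) (x j) / \<delta>:] + smult (1 / \<delta>) (Q j)" for j
  have FP: "sq_on {x j..x j + l} (\<lambda>t. F t - poly (P j) t)
      \<le> ennreal ((l / \<delta>)\<^sup>2) * sq_on {x j..x j + l} (\<lambda>t. g t - poly (p j) t)" for j
  proof (rule square_primitive_le[OF g d l])
    fix t assume t: "t \<in> {x j..x j + l}"
    have ip: "set_integrable lborel {x j..t} (\<lambda>s. poly (p j) s)"
      by (intro borel_integrable_atLeastAtMost' continuous_intros)
    have "((\<lambda>s. poly (p j) s) has_integral poly (Q j) t - poly (Q j) (x j)) {x j..t}"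
      using t poly_DERIV[of "Q j"] unfolding Q(1)
      by (intro fundamental_theorem_of_calculus)
         (auto simp: has_real_derivative_iff_has_vector_derivative[symmetric] intro: DERIV_subset)
    then have "(LINT s:{x j..t}|lborel. poly (p j) s) = poly (Q j) t - poly (Q j) (x j)"
      using set_borel_integral_eq_integral(2)[OF ip] by (simp add: integral_unique)
    then have "(LINT s:{x j..t}|lborel. g s - poly (p j) s)
        = (LINT s:{x j..t}|lborel. g s) - (poly (Q j) t - poly (Q j) (x j))"
      using L2_fun_set_integrable[OF g] ip by (subst set_integral_diff(2)) auto
    also have "(LINT s:{x j..t}|lborel. g s) = \<delta> * F t - \<delta> * F (x j)"
      using average_diff_eq[OF f d, of "x j" t] t d by (simp add: F_def g_def)
    finally show "F t - poly (P j) t = (1 / \<delta>) * (LINT s:{x j..t}|lborel. g s - poly (p j) s)"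
      using d by (simp add: P_def field_simps)
  qed
  have fh: "f t - poly (P j - q j) t = (F t - poly (P j) t) - (h t - poly (q j) t)" for t j
  proof -
    have "h t = F t - f t"
      unfolding h_def F_def set_integral_diff(2)[OF si sc]
      using d by (simp add: set_integral_const right_diff_distrib)
    then show ?thesis by simp
  qed
  have "(\<Sum>j\<in>A. sq_on {x j..x j + l} (\<lambda>t. f t - poly (P j - q j) t))
      \<le> (\<Sum>j\<in>A. 2 * (ennreal ((l / \<delta>)\<^sup>2) * sq_on {x j..x j + l} (\<lambda>t. g t - poly (p j) t))
          + 2 * sq_on {x j..x j + l} (\<lambda>t. h t - poly (q j) t))"
    unfolding fh
    by (intro sum_mono order_trans[OF sq_on_diff_le] add_mono mult_left_mono FP order_refl) auto
  also have "\<dots> = 2 * (ennreal ((l / \<delta>)\<^sup>2) * (\<Sum>j\<in>A. sq_on {x j..x j + l} (\<lambda>t. g t - poly (p j) t)))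
      + 2 * (\<Sum>j\<in>A. sq_on {x j..x j + l} (\<lambda>t. h t - poly (q j) t))"
    by (simp add: sum.distrib sum_distrib_left)
  also have "\<dots> \<le> 2 * (ennreal ((l / \<delta>)\<^sup>2) * (ennreal (?c ^ k) * B)) + 2 * (ennreal (?c ^ k) * B)"
    by (intro add_mono mult_left_mono pB qB) auto
  also have "\<dots> = (2 * ennreal ((l / \<delta>)\<^sup>2) + 2) * (ennreal (?c ^ k) * B)"
    by (simp add: distrib_right mult.assoc)
  also have "2 * ennreal ((l / \<delta>)\<^sup>2) + 2 = ennreal ?c"
    by (subst ennreal_plus) (auto simp: ennreal_mult add.commute)
  also have "ennreal ?c * (ennreal (?c ^ k) * B) = ennreal (?c ^ Suc k) * B"
    by (simp add: ennreal_mult mult.assoc)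
  finally have "(\<Sum>j\<in>A. sq_on {x j..x j + l} (\<lambda>t. f t - poly (P j - q j) t)) \<le> ennreal (?c ^ Suc k) * B" .
  moreover have "P j - q j = 0 \<or> degree (P j - q j) < Suc k" for j
  proof -
    have "degree (Q j) \<le> k"
      using p[of j] Q(2)[of j] Q(3)[of j] by auto
    then have "degree (P j) \<le> k"
      unfolding P_def by (intro degree_add_le) (auto intro: order_trans[OF degree_smult_le])
    moreover have "degree (q j) \<le> k" using q[of j] by auto
    ultimately have "degree (P j - q j) \<le> k" by (intro degree_diff_le)
    then show ?thesis by simp
  qed
  ultimately show ?case by (intro exI[of _ "\<lambda>j. P j - q j"]) blast
qed

section \<open>Reduction of mixed differences to differences with equal steps\<close>

lemma finite_difference_measurable [measurable]:
  assumes [measurable]: "g \<in> borel_measurable borel"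
  shows "finite_difference k u g \<in> borel_measurable borel"
  unfolding finite_difference_def by measurable

lemma mixed_difference_eq_0:
  "i < n \<Longrightarrow> w i = 0 \<Longrightarrow> mixed_difference n w g x = 0"
  by (induction n arbitrary: x) (auto simp: less_Suc_eq)

text \<open>
  Kemperman's identity: mixed differences are combinations of pure ones. Only the summand \<open>i = 0\<close> survives, because
  for \<open>i > 0\<close> the step number \<open>i - 1\<close> is \<open>0\<close>.
\<close>

lemma mixed_difference_kemperman:
  "mixed_difference k w f x = (\<Sum>i\<le>k. (-1) ^ i * real (k choose i) *
     mixed_difference k (\<lambda>j. w j * (1 - real i / real (Suc j))) f x)"
proof -
  have "mixed_difference k (\<lambda>j. w j * (1 - real i / real (Suc j))) f x = 0" if "i \<in> {..k} - {0}" for i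
    using that by (intro mixed_difference_eq_0[of "i - 1"]) auto
  then have "(\<Sum>i\<in>{..k} - {0}. (-1) ^ i * real (k choose i) *
     mixed_difference k (\<lambda>j. w j * (1 - real i / real (Suc j))) f x) = 0"
    by (intro sum.neutral) simp
  then show ?thesis by (simp add: sum.remove[of "{..k}" 0])
qed

text \<open>In Kemperman's identity the steps are affine in the summation index \<open>i\<close>, so
  every point of the stencil of the \<open>i\<close>-th summand has the form
  \<open>t + a - i b\<close>. Once it is fixed which steps are taken, the alternating sum over
  \<open>i\<close> is a difference of order \<open>k\<close> with equal steps \<open>b\<close>.
  Unfolding the \<open>k\<close> factors one by one costs 4 each time, by
  \<open>(x - y)\<^sup>2 \<le> 2 x\<^sup>2 + 2 y\<^sup>2\<close>.\<close>

lemma sum_sq_on_mixed_difference_le: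
  fixes f :: "real \<Rightarrow> real"
  assumes [measurable]: "f \<in> borel_measurable borel"
    and w: "\<And>j. w j \<in> {0..\<delta>}"
    and B: "\<And>a b. a \<in> {0..real k * \<delta>} \<Longrightarrow> b \<in> {0..real k * \<delta>} \<Longrightarrow>
      (\<Sum>j\<in>A. sq_on {x j..x j + l} (\<lambda>t. \<Sum>i\<le>k. (-1) ^ i * real (k choose i) * f (t + a - real i * b))) \<le> B"
  shows "(\<Sum>j\<in>A. sq_on {x j..x j + l} (mixed_difference k w f)) \<le> 4 ^ k * B"
proof -
  \<comment> \<open>The alternating sum after all but the first \<open>n\<close> factors have been
    unfolded; \<open>a\<close> collects the steps taken, \<open>b\<close> their parts proportional
    to \<open>i\<close>.\<close>
  define V where "V n a b t = (\<Sum>i\<le>k. (-1) ^ i * real (k choose i) *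
     mixed_difference n (\<lambda>j. w j * (1 - real i / real (Suc j))) f (t + a - real i * b))" for n a b t
  have [measurable]: "V n a b \<in> borel_measurable borel" for n a b
    unfolding V_def by measurable
  have V_Suc: "V (Suc n) a b t = V n (a + w n) (b + w n / real (Suc n)) t - V n a b t" for n a b t
  proof -
    have *: "t + a - real i * b + w n * (1 - real i / real (Suc n))
        = t + (a + w n) - real i * (b + w n / real (Suc n))" for i
      by (simp add: algebra_simps)
    show ?thesis
      unfolding V_def mixed_difference.simps * sum_subtractf[symmetric]
      by (intro sum.cong refl right_diff_distrib)
  qed
  \<comment> \<open>Each of the \<open>n\<close> factors still to be unfolded adds at most
    \<open>\<delta>\<close> to \<open>a\<close> and to \<open>b\<close>, so both end within
    \<open>{0..k \<delta>}\<close>.\<close>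
  have "(\<Sum>j\<in>A. sq_on {x j..x j + l} (V n a b)) \<le> 4 ^ n * B"
    if "0 \<le> a" "a + real n * \<delta> \<le> real k * \<delta>" "0 \<le> b" "b + real n * \<delta> \<le> real k * \<delta>" for n a b
    using that
  proof (induction n arbitrary: a b)
    case 0
    then show ?case using B[of a b] by (simp add: V_def)
  next
    case (Suc n)
    have wn: "0 \<le> w n" "w n \<le> \<delta>" using w[of n] by auto
    have wn': "0 \<le> w n / real (Suc n)" "w n / real (Suc n) \<le> w n"
      using wn by (auto simp: field_simps mult_left_le_one_le)
    have le1: "(\<Sum>j\<in>A. sq_on {x j..x j + l} (V n (a + w n) (b + w n / real (Suc n)))) \<le> 4 ^ n * B"
      using Suc.prems wn wn' by (intro Suc.IH) (auto simp: algebra_simps simp del: of_nat_Suc simp: of_nat_Suc[of n])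
    have le2: "(\<Sum>j\<in>A. sq_on {x j..x j + l} (V n a b)) \<le> 4 ^ n * B"
      using Suc.prems wn by (intro Suc.IH) (auto simp: algebra_simps)
    have "(\<Sum>j\<in>A. sq_on {x j..x j + l} (V (Suc n) a b))
        \<le> (\<Sum>j\<in>A. 2 * sq_on {x j..x j + l} (V n (a + w n) (b + w n / real (Suc n))) + 2 * sq_on {x j..x j + l} (V n a b))"
      unfolding V_Suc[abs_def] by (intro sum_mono sq_on_diff_le) auto
    also have "\<dots> = 2 * (\<Sum>j\<in>A. sq_on {x j..x j + l} (V n (a + w n) (b + w n / real (Suc n))))
        + 2 * (\<Sum>j\<in>A. sq_on {x j..x j + l} (V n a b))"
      by (simp add: sum.distrib sum_distrib_left)
    also have "\<dots> \<le> 2 * (4 ^ n * B) + 2 * (4 ^ n * B)"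
      by (intro add_mono mult_left_mono le1 le2) auto
    also have "\<dots> = 4 ^ Suc n * B" by (simp add: distrib_right[symmetric] mult.assoc[symmetric])
    finally show ?case .
  qed
  from this[of 0 k 0] have "(\<Sum>j\<in>A. sq_on {x j..x j + l} (V k 0 0)) \<le> 4 ^ k * B" by simp
  moreover have "V k 0 0 = mixed_difference k w f"
    unfolding V_def mixed_difference_kemperman[of k w f, abs_def] by simp
  ultimately show ?thesis by simp
qed

text \<open>For \<open>b \<ge> 0\<close> the base point on the right is the leftmost point of the
  stencil; this is the forward form in which the modulus of smoothness is stated.\<close>

lemma finite_difference_reverse:
  "(\<Sum>i\<le>k. (-1) ^ i * real (k choose i) * f (t + a - real i * b))
    = finite_difference k b f (t + (a - real k * b))"
proof -
  have "(\<Sum>i\<le>k. (-1) ^ i * real (k choose i) * f (t + a - real i * b))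
      = (\<Sum>i\<le>k. (-1) ^ (k - i) * real (k choose (k - i)) * f (t + a - real (k - i) * b))"
    by (subst sum.nat_diff_reindex[symmetric, of _ "Suc k", unfolded lessThan_Suc_atMost])
       (auto intro!: sum.cong)
  also have "\<dots> = finite_difference k b f (t + (a - real k * b))"
    unfolding finite_difference_def
    by (intro sum.cong refl arg_cong2[of _ _ _ _ "(*)"] arg_cong[of _ _ f])
       (auto simp: binomial_symmetric[symmetric] of_nat_diff algebra_simps)
  finally show ?thesis .
qed

text \<open>Pascal's rule, applied after the term \<open>j = 0\<close> has been split off.\<close>

lemma finite_difference_Suc:
  "finite_difference (Suc k) u g t = finite_difference k u g (t + u) - finite_difference k u g t"
proof -
  define a where "a j = g (t + real j * u)" for j
  have *: "(\<Sum>j\<le>k. (-1) ^ (k - j) * real (k choose j) * a j)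
      = (-1) ^ k * a 0 + (\<Sum>j<k. (-1) ^ (k - Suc j) * real (k choose Suc j) * a (Suc j))"
    by (subst lessThan_Suc_atMost[symmetric], subst sum.lessThan_Suc_shift) simp
  \<comment> \<open>The summand \<open>j = k\<close> vanishes because \<open>k choose Suc k\<close>
    is 0, and lowering the exponent by one flips the sign.\<close>
  have **: "(\<Sum>j\<le>k. (-1) ^ (k - j) * real (k choose Suc j) * a (Suc j))
      = - (\<Sum>j<k. (-1) ^ (k - Suc j) * real (k choose Suc j) * a (Suc j))"
  proof -
    have "(-1 :: real) ^ (k - j) = - ((-1) ^ (k - Suc j))" if "j < k" for j
    proof -
      have "k - j = Suc (k - Suc j)" using that by simp
      then show ?thesis by simp
    qed
    then show ?thesis
      by (simp add: lessThan_Suc_atMost[symmetric] sum_negf[symmetric])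
  qed
  have "finite_difference (Suc k) u g t = (\<Sum>j\<le>Suc k. (-1) ^ (Suc k - j) * real (Suc k choose j) * a j)"
    by (simp add: finite_difference_def a_def)
  also have "\<dots> = (-1) ^ Suc k * a 0 + (\<Sum>j\<le>k. (-1) ^ (k - j) * real (Suc k choose Suc j) * a (Suc j))"
    by (subst sum.atMost_Suc_shift) simp
  also have "\<dots> = (-1) ^ Suc k * a 0 + (\<Sum>j\<le>k. (-1) ^ (k - j) * real (k choose j) * a (Suc j))
      + (\<Sum>j\<le>k. (-1) ^ (k - j) * real (k choose Suc j) * a (Suc j))"
    by (simp add: sum.distrib[symmetric] algebra_simps)
  also have "\<dots> = (\<Sum>j\<le>k. (-1) ^ (k - j) * real (k choose j) * a (Suc j))
      - (\<Sum>j\<le>k. (-1) ^ (k - j) * real (k choose j) * a j)"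
    unfolding * ** by simp
  also have "\<dots> = finite_difference k u g (t + u) - finite_difference k u g t"
    by (simp add: finite_difference_def a_def algebra_simps)
  finally show ?thesis .
qed

section \<open>Polynomials under differences, and extension of bounds to the ends of an
  interval\<close>

lemma finite_difference_diff:
  "finite_difference k u (\<lambda>x. f x - g x) t = finite_difference k u f t - finite_difference k u g t"
  by (simp add: finite_difference_def sum_subtractf right_diff_distrib)

lemma finite_difference_shift:
  "finite_difference k u (\<lambda>x. g (x + a)) t = finite_difference k u g (t + a)"
  by (simp add: finite_difference_def algebra_simps)

lemma finite_difference_poly_eq_0:
  "p = 0 \<or> degree p < k \<Longrightarrow> finite_difference k u (poly p) t = 0"
proof (induction k arbitrary: p t)
  case (Suc k)
  \<comment> \<open>A translate of \<open>p\<close> has the same leading coefficient, so the degree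
    drops.\<close>
  define q where "q = pcompose p [:u, 1:] - p"
  have "q = 0 \<or> degree q < k"
  proof (cases "degree p = 0")
    case True
    then obtain c where "p = [:c:]" by (metis degree_eq_zeroE)
    then show ?thesis by (simp add: q_def)
  next
    case False
    have "coeff q (degree p) = 0"
      using lead_coeff_comp[of "[:u, 1:]" p] by (simp add: q_def degree_pcompose)
    moreover have "degree q \<le> degree p"
      unfolding q_def by (intro degree_diff_le) (auto simp: degree_pcompose)
    ultimately have "degree q < degree p \<or> q = 0"
      by (metis le_neq_implies_less leading_coeff_0_iff)
    then show ?thesis using Suc.prems by auto
  qed
  from Suc.IH[OF this] have "finite_difference k u (poly q) t = 0" .
  moreover have "poly q = (\<lambda>x. poly p (x + u) - poly p x)"
    by (auto simp: q_def poly_pcompose add.commute)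
  ultimately show ?case
    by (simp add: finite_difference_Suc finite_difference_diff finite_difference_shift)
qed (simp add: finite_difference_def)

text \<open>Carries a bound for \<open>g\<close> from \<open>S\<close> to an interval all of whose
  translates by \<open>s j\<close> lie in \<open>S\<close>. Cauchy-Schwarz over \<open>J\<close>
  contributes \<open>card J\<close>, the sum over \<open>J\<close> another \<open>card J\<close>,
  and the coefficients \<open>m\<^sup>2\<close>.\<close>

lemma sq_on_extend:
  fixes g :: "real \<Rightarrow> real"
  assumes [measurable]: "g \<in> borel_measurable borel" "D \<in> borel_measurable borel"
    and eq: "\<And>x. \<bar>g x\<bar> \<le> \<bar>D x\<bar> + \<bar>\<Sum>j\<in>J. c j * g (x + s j)\<bar>"
    and J: "finite J" "\<And>j. j \<in> J \<Longrightarrow> \<bar>c j\<bar> \<le> m" "\<And>j. j \<in> J \<Longrightarrow> {a + s j..b + s j} \<subseteq> S"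
  shows "sq_on {a..b} g \<le> 2 * sq_on {a..b} D + ennreal (2 * (real (card J) * m)\<^sup>2) * sq_on S g"
proof -
  have "sq_on {a..b} (\<lambda>x. \<Sum>j\<in>J. c j * g (x + s j))
      \<le> (\<integral>\<^sup>+ x. (\<Sum>j\<in>J. ennreal (real (card J) * m\<^sup>2) * (ennreal ((g (x + s j))\<^sup>2) * indicator {a..b} x)) \<partial>lborel)"
    unfolding sq_on_def
  proof (intro nn_integral_mono)
    fix x
    have "(\<Sum>j\<in>J. c j * g (x + s j))\<^sup>2 \<le> real (card J) * (\<Sum>j\<in>J. (c j * g (x + s j))\<^sup>2)"
      using sum_squared_le_sum_of_squares[of "\<lambda>j. c j * g (x + s j)" J] by (simp add: mult.commute)
    also have "\<dots> \<le> real (card J) * (\<Sum>j\<in>J. m\<^sup>2 * (g (x + s j))\<^sup>2)"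
      using J(2) by (intro mult_left_mono sum_mono) (auto simp: power_mult_distrib intro!: mult_right_mono abs_le_square_iff[THEN iffD1] order_trans[OF _ abs_ge_self])
    finally have "ennreal ((\<Sum>j\<in>J. c j * g (x + s j))\<^sup>2)
        \<le> ennreal (\<Sum>j\<in>J. real (card J) * m\<^sup>2 * (g (x + s j))\<^sup>2)"
      by (intro ennreal_leI) (simp add: sum_distrib_left mult.assoc)
    also have "\<dots> = (\<Sum>j\<in>J. ennreal (real (card J) * m\<^sup>2) * ennreal ((g (x + s j))\<^sup>2))"
      by (subst sum_ennreal[symmetric]) (auto simp: ennreal_mult)
    finally show "ennreal ((\<Sum>j\<in>J. c j * g (x + s j))\<^sup>2) * indicator {a..b} x
        \<le> (\<Sum>j\<in>J. ennreal (real (card J) * m\<^sup>2) * (ennreal ((g (x + s j))\<^sup>2) * indicator {a..b} x))"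
      by (auto split: split_indicator)
  qed
  also have "\<dots> = (\<Sum>j\<in>J. ennreal (real (card J) * m\<^sup>2) * sq_on {a..b} (\<lambda>x. g (x + s j)))"
    unfolding sq_on_def by (subst nn_integral_sum) (auto simp: nn_integral_cmult)
  also have "\<dots> \<le> (\<Sum>j\<in>J. ennreal (real (card J) * m\<^sup>2) * sq_on S g)"
    using J(3) by (intro sum_mono mult_left_mono) (auto simp: sq_on_shift intro!: sq_on_mono)
  also have "\<dots> = ennreal ((real (card J) * m)\<^sup>2) * sq_on S g"
    by (simp add: power_mult_distrib power2_eq_square[of "real _"] ennreal_mult mult.assoc ennreal_of_nat_eq_real_of_nat)
  finally have *: "sq_on {a..b} (\<lambda>x. \<Sum>j\<in>J. c j * g (x + s j)) \<le> ennreal ((real (card J) * m)\<^sup>2) * sq_on S g" .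
  have "sq_on {a..b} g \<le> sq_on {a..b} (\<lambda>x. \<bar>D x\<bar> + \<bar>\<Sum>j\<in>J. c j * g (x + s j)\<bar>)"
    using eq by (intro sq_on_mono) auto
  also have "\<dots> \<le> 2 * sq_on {a..b} (\<lambda>x. \<bar>D x\<bar>) + 2 * sq_on {a..b} (\<lambda>x. \<bar>\<Sum>j\<in>J. c j * g (x + s j)\<bar>)"
    by (intro sq_on_add_le) auto
  also have "\<dots> \<le> 2 * sq_on {a..b} D + 2 * (ennreal ((real (card J) * m)\<^sup>2) * sq_on S g)"
    using * by (intro add_mono mult_left_mono) (auto simp: sq_on_def)
  also have "\<dots> = 2 * sq_on {a..b} D + ennreal (2 * (real (card J) * m)\<^sup>2) * sq_on S g"
    by (simp add: ennreal_mult mult.assoc)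
  finally show ?thesis .
qed


text \<open>Differences of order \<open>k\<close> annihilate \<open>p\<close>, so those of
  \<open>f\<close> and of \<open>f - p\<close> agree. Solving for the outermost value at either end
  leaves \<open>k\<close> values inside \<open>{a..b}\<close>, with coefficients at most
  \<open>2 ^ k\<close>. Each end adds \<open>2 (k 2^k)\<^sup>2\<close> to the first constant and 2
  to the second.\<close>

lemma sq_on_widen_step:
  fixes f :: "real \<Rightarrow> real"
  assumes [measurable]: "f \<in> borel_measurable borel" and p: "p = 0 \<or> degree p < k"
    and u: "0 < u" and ab: "a + real k * u \<le> b"
  shows "sq_on {a - u..b + u} (\<lambda>t. f t - poly p t)
    \<le> ennreal (1 + 4 * (real k * 2 ^ k)\<^sup>2) * sq_on {a..b} (\<lambda>t. f t - poly p t)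
      + 4 * sq_on {a - u..b + u - real k * u} (finite_difference k u f)"
proof -
  define g where "g = (\<lambda>t. f t - poly p t)"
  have [measurable]: "g \<in> borel_measurable borel" unfolding g_def by measurable
  have fd: "finite_difference k u f x = finite_difference k u g x" for x
    unfolding g_def by (simp add: finite_difference_diff finite_difference_poly_eq_0[OF p])
  let ?S = "sq_on {a..b} g" and ?R = "sq_on {a - u..b + u - real k * u} (finite_difference k u f)"
  let ?m = "2 * (real k * 2 ^ k)\<^sup>2"
  have ch: "real (k choose j) \<le> 2 ^ k" for j
    using binomial_le_pow2[of k j] by (metis of_nat_le_iff of_nat_numeral of_nat_power)
  have left: "sq_on {a - u..a} g \<le> 2 * ?R + ennreal ?m * ?S"
  proof -
    have eq: "\<bar>g x\<bar> \<le> \<bar>finite_difference k u f x\<bar>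
      + \<bar>\<Sum>j\<in>{1..k}. ((-1) ^ (k - j) * real (k choose j)) * g (x + real j * u)\<bar>" for x
    proof -
      have "{..k} = insert 0 {1..k}" by auto
      then have "finite_difference k u f x = (-1) ^ k * g x
        + (\<Sum>j\<in>{1..k}. ((-1) ^ (k - j) * real (k choose j)) * g (x + real j * u))"
        unfolding fd unfolding finite_difference_def by simp
      then have "\<bar>(-1) ^ k * g x\<bar> = \<bar>finite_difference k u f x
        - (\<Sum>j\<in>{1..k}. ((-1) ^ (k - j) * real (k choose j)) * g (x + real j * u))\<bar>" by simp
      then show ?thesis by (simp add: abs_mult power_abs)
    qed
    have "sq_on {a - u..a} g \<le> 2 * sq_on {a - u..a} (finite_difference k u f)
        + ennreal (2 * (real (card {1..k}) * 2 ^ k)\<^sup>2) * ?S"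
    proof (rule sq_on_extend[OF _ _ eq])
      fix j assume "j \<in> {1..k}"
      then have "1 * u \<le> real j * u" "real j * u \<le> real k * u"
        using u by (auto intro!: mult_right_mono)
      then have "a \<le> a - u + real j * u" "a + real j * u \<le> b" using ab by linarith+
      then show "{a - u + real j * u..a + real j * u} \<subseteq> {a..b}" by auto
    qed (use ch in \<open>auto simp: abs_mult\<close>)
    also have "\<dots> \<le> 2 * ?R + ennreal ?m * ?S"
      using ab u by (intro add_mono mult_left_mono sq_on_mono) auto
    finally show ?thesis .
  qed
  have right: "sq_on {b..b + u} g \<le> 2 * ?R + ennreal ?m * ?S"
  proof -
    have eq: "\<bar>g x\<bar> \<le> \<bar>finite_difference k u f (x + (- (real k * u)))\<bar>
      + \<bar>\<Sum>j\<in>{..<k}. ((-1) ^ (k - j) * real (k choose j)) * g (x + (real j * u - real k * u))\<bar>" for x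
    proof -
      have "finite_difference k u f (x + (- (real k * u))) = g x
        + (\<Sum>j\<in>{..<k}. ((-1) ^ (k - j) * real (k choose j)) * g (x + (real j * u - real k * u)))"
        unfolding fd unfolding finite_difference_def
        by (simp add: lessThan_Suc_atMost[symmetric] algebra_simps)
      then show ?thesis by simp
    qed
    have "sq_on {b..b + u} g \<le> 2 * sq_on {b..b + u} (\<lambda>x. finite_difference k u f (x + (- (real k * u))))
        + ennreal (2 * (real (card {..<k}) * 2 ^ k)\<^sup>2) * ?S"
    proof (rule sq_on_extend[OF _ _ eq])
      fix j assume "j \<in> {..<k}"
      then have "real (Suc j) \<le> real k" by (intro of_nat_mono) auto
      then have "(real j + 1) * u \<le> real k * u" "0 \<le> real j * u"
        using u by (auto intro!: mult_right_mono)
      then have "a \<le> b + (real j * u - real k * u)" "b + u + (real j * u - real k * u) \<le> b"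
        using ab u unfolding distrib_right by linarith+
      then show "{b + (real j * u - real k * u)..b + u + (real j * u - real k * u)} \<subseteq> {a..b}"
        by auto
    qed (use ch in \<open>auto simp: abs_mult\<close>)
    also have "sq_on {b..b + u} (\<lambda>x. finite_difference k u f (x + (- (real k * u))))
        = sq_on {b + (- (real k * u))..b + u + (- (real k * u))} (finite_difference k u f)"
      by (rule sq_on_shift) measurable
    also have "2 * \<dots> + ennreal (2 * (real (card {..<k}) * 2 ^ k)\<^sup>2) * ?S \<le> 2 * ?R + ennreal ?m * ?S"
      using ab u by (intro add_mono mult_left_mono sq_on_mono) auto
    finally show ?thesis .
  qed
  have "sq_on {a - u..b + u} g \<le> (\<integral>\<^sup>+ t. ennreal ((g t)\<^sup>2) * indicator {a - u..a} t
      + (ennreal ((g t)\<^sup>2) * indicator {a..b} t + ennreal ((g t)\<^sup>2) * indicator {b..b + u} t) \<partial>lborel)"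
    unfolding sq_on_def by (intro nn_integral_mono) (auto split: split_indicator)
  also have "\<dots> = sq_on {a - u..a} g + (?S + sq_on {b..b + u} g)"
    unfolding sq_on_def by (subst nn_integral_add; (subst nn_integral_add)?) auto
  also have "\<dots> \<le> (2 * ?R + ennreal ?m * ?S) + (?S + (2 * ?R + ennreal ?m * ?S))"
    by (intro add_mono left right order_refl)
  also have "\<dots> = (1 + ennreal ?m + ennreal ?m) * ?S + (2 + 2) * ?R"
    by (simp only: distrib_right mult_1 add.assoc add.commute add.left_commute)
  also have "1 + ennreal ?m + ennreal ?m = ennreal (1 + 4 * (real k * 2 ^ k)\<^sup>2)"
    by (subst ennreal_1[symmetric], subst ennreal_plus[symmetric], simp, simp, subst ennreal_plus[symmetric]) auto
  finally show ?thesis by (simp add: g_def)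
qed

text \<open>Each of the \<open>m\<close> steps contributes 4 copies of the difference, taken over
  the final and largest interval. They may share the factor of the main term because that factor is
  at least 1.\<close>

lemma sq_on_widen:
  fixes f :: "real \<Rightarrow> real"
  assumes [measurable]: "f \<in> borel_measurable borel" and p: "p = 0 \<or> degree p < k"
    and u: "0 < u" and ab: "a + real k * u \<le> b"
  shows "sq_on {a - real m * u..b + real m * u} (\<lambda>t. f t - poly p t)
    \<le> ennreal ((1 + 4 * (real k * 2 ^ k)\<^sup>2) ^ m) * (sq_on {a..b} (\<lambda>t. f t - poly p t)
      + of_nat (4 * m) * sq_on {a - real m * u..b + real m * u - real k * u} (finite_difference k u f))"
proof (induction m)
  case (Suc m)
  let ?c = "1 + 4 * (real k * 2 ^ k)\<^sup>2"
  let ?g = "\<lambda>t. f t - poly p t"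
  let ?R = "\<lambda>m. sq_on {a - real m * u..b + real m * u - real k * u} (finite_difference k u f)"
  have ab': "a - real m * u + real k * u \<le> b + real m * u"
    using ab mult_nonneg_nonneg[of "real m" u] u by linarith
  have RS: "?R m \<le> ?R (Suc m)" using u by (intro sq_on_mono) (auto simp: algebra_simps)
  have c1: "1 \<le> ?c ^ Suc m" by (intro one_le_power) simp
  have "sq_on {a - real m * u - u..b + real m * u + u} ?g
      \<le> ennreal ?c * sq_on {a - real m * u..b + real m * u} ?g
        + 4 * sq_on {a - real m * u - u..b + real m * u + u - real k * u} (finite_difference k u f)"
    by (intro sq_on_widen_step p u ab') simp
  also have "sq_on {a - real m * u - u..b + real m * u + u - real k * u} (finite_difference k u f) = ?R (Suc m)"
    by (simp add: algebra_simps)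
  also have "ennreal ?c * sq_on {a - real m * u..b + real m * u} ?g + 4 * ?R (Suc m)
      \<le> ennreal ?c * (ennreal (?c ^ m) * (sq_on {a..b} ?g + of_nat (4 * m) * ?R (Suc m)))
        + ennreal (?c ^ Suc m) * (4 * ?R (Suc m))"
  proof (intro add_mono mult_left_mono order_trans[OF Suc.IH] mult_left_mono add_mono RS order_refl)
    have "1 \<le> ennreal (?c ^ Suc m)" using c1 by (metis ennreal_1 ennreal_leI)
    from mult_right_mono[OF this, of "4 * ?R (Suc m)"]
    show "4 * ?R (Suc m) \<le> ennreal (?c ^ Suc m) * (4 * ?R (Suc m))" by simp
  qed auto
  also have "ennreal ?c * (ennreal (?c ^ m) * (sq_on {a..b} ?g + of_nat (4 * m) * ?R (Suc m)))
      = ennreal (?c ^ Suc m) * (sq_on {a..b} ?g + of_nat (4 * m) * ?R (Suc m))"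
    by (simp add: ennreal_mult mult.assoc)
  also have "\<dots> + ennreal (?c ^ Suc m) * (4 * ?R (Suc m))
      = ennreal (?c ^ Suc m) * (sq_on {a..b} ?g + of_nat (4 * Suc m) * ?R (Suc m))"
    by (simp add: distrib_left distrib_right ac_simps)
  finally show ?case by (simp add: algebra_simps)
qed simp

text \<open>With \<open>c = k b\<close> these are the base points whose whole stencil stays in the
  bin. Positivity of \<open>c\<close> separates the closed intervals, which otherwise share end
  points.\<close>

lemma sum_sq_on_bins_le:
  assumes [measurable]: "g \<in> borel_measurable borel" and K: "0 < K" and c: "0 < c"
  shows "(\<Sum>j<K. sq_on {real j / real K..real (Suc j) / real K - c} g) \<le> sq_on {0..1 - c} g"
proof -
  let ?E = "\<lambda>j. {real j / real K..real (Suc j) / real K - c}"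
  have "disjoint_family_on ?E {..<K}"
  proof -
    have "?E i \<inter> ?E j = {}" if "i < j" for i j
    proof -
      have "real (Suc i) / real K \<le> real j / real K"
        using that by (intro divide_right_mono of_nat_mono) auto
      then show ?thesis using c by auto
    qed
    then show ?thesis
      unfolding disjoint_family_on_def by (metis Int_commute linorder_neqE_nat)
  qed
  then have ind: "(\<Sum>j<K. indicator (?E j) t) = (indicator (\<Union>j<K. ?E j) t :: ennreal)" for t
    by (intro indicator_UN_disjoint[symmetric]) auto
  have sub: "(\<Union>j<K. ?E j) \<subseteq> {0..1 - c}"
  proof
    fix t assume "t \<in> (\<Union>j<K. ?E j)"
    then obtain j where j: "j < K" "t \<in> ?E j" by auto
    then have "real (Suc j) / real K \<le> 1" by (simp add: field_simps)
    moreover have "0 \<le> real j / real K" by simp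
    ultimately show "t \<in> {0..1 - c}" using j(2) unfolding atLeastAtMost_iff by linarith
  qed
  have "(\<Sum>j<K. sq_on (?E j) g) = (\<integral>\<^sup>+ t. ennreal ((g t)\<^sup>2) * indicator (\<Union>j<K. ?E j) t \<partial>lborel)"
    unfolding sq_on_def by (subst nn_integral_sum[symmetric]) (auto simp: sum_distrib_left[symmetric] ind simp del: of_nat_Suc)
  also have "\<dots> \<le> sq_on {0..1 - c} g"
    unfolding sq_on_def using subsetD[OF sub]
    by (intro nn_integral_mono mult_left_mono) (simp_all add: indicator_def del: UN_iff of_nat_Suc)
  finally show ?thesis .
qed

text \<open>
  Whitney's inequality on all bins at once. On the middle half of each bin it follows from the
  version for mixed differences, where the two-sided points of Kemperman's identity stay inside
  the bin; a pure difference then expresses \<open>f - p\<close> nearer to the ends through its values further inside.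
\<close>

lemma whitney_bins:
  assumes k: "0 < k"
  obtains C :: real where "0 \<le> C"
    "\<And>f K B. L2_fun f \<Longrightarrow> 0 < K \<Longrightarrow>
      (\<And>b. 0 < b \<Longrightarrow> b \<le> 1 / real K \<Longrightarrow> sq_on {0..1 - real k * b} (finite_difference k b f) \<le> B) \<Longrightarrow>
      \<exists>p. (\<forall>j. p j = 0 \<or> degree (p j) < k) \<and>
        (\<Sum>j<K. sq_on (closed_bin K j) (\<lambda>t. f t - poly (p j) t)) \<le> ennreal C * B"
proof
  \<comment> \<open>\<open>c1\<close> is the constant of \<open>whitney_mixed\<close> for
    \<open>l / \<delta> = 2 k\<^sup>2\<close>, times the \<open>4 ^ k\<close> of Kemperman's
    reduction; \<open>c2\<close> is the cost of \<open>k\<close> widening steps.\<close>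
  define c1 where "c1 = (2 + 2 * (2 * real k ^ 2)\<^sup>2) ^ k * 4 ^ k"
  define c2 where "c2 = (1 + 4 * (real k * 2 ^ k)\<^sup>2) ^ k"
  show "0 \<le> c2 * (c1 + real (4 * k))" by (auto simp: c1_def c2_def)
  have c0: "0 \<le> c1" "0 \<le> c2" by (auto simp: c1_def c2_def)
  fix f :: "real \<Rightarrow> real" and K :: nat and B
  assume f: "L2_fun f" and K: "0 < K"
    and B: "\<And>b. 0 < b \<Longrightarrow> b \<le> 1 / real K \<Longrightarrow> sq_on {0..1 - real k * b} (finite_difference k b f) \<le> B"
  have [measurable]: "f \<in> borel_measurable borel" using f by (rule L2_fun_measurable)
  define H where "H = 1 / real K"
  have H: "0 < H" using K by (simp add: H_def)
  \<comment> \<open>The stencil in Kemperman's identity reaches at most \<open>k \<delta>\<close> to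
    the right and \<open>k (k \<delta>) = H / 4\<close> to the left, so from the middle half it
    stays in the bin.\<close>
  define \<delta> where "\<delta> = H / (4 * real k ^ 2)"
  have d: "0 < \<delta>" using H k by (simp add: \<delta>_def)
  have k1: "1 \<le> real k" using k by simp
  have kd: "real k * (real k * \<delta>) = H / 4" "real k * \<delta> \<le> H / 4"
  proof -
    show eq: "real k * (real k * \<delta>) = H / 4" using k by (simp add: \<delta>_def power2_eq_square)
    have "1 * (real k * \<delta>) \<le> real k * (real k * \<delta>)"
      using k1 d by (intro mult_right_mono) auto
    then show "real k * \<delta> \<le> H / 4" using eq by simp
  qed
  have jH: "real j / real K = real j * H" "real (Suc j) / real K = real j * H + H" for j
    by (auto simp: H_def add_divide_distrib)
  define x where "x j = real j * H + H / 4" for j :: nat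
  have pure: "(\<Sum>j<K. sq_on {x j..x j + H / 2} (\<lambda>t. \<Sum>i\<le>k. (-1) ^ i * real (k choose i) * f (t + a - real i * b))) \<le> B"
    if a: "a \<in> {0..real k * \<delta>}" and b: "b \<in> {0..real k * \<delta>}" for a b
  proof (cases "b = 0")
    \<comment> \<open>The step 0 lies outside the range of the modulus; the alternating binomial sum
      vanishes because \<open>0 < k\<close>.\<close>
    case True
    have "(\<Sum>i\<le>k. (-1) ^ i * real (k choose i) * f (t + a - real i * b)) = 0" for t
      using choose_alternating_sum[OF k, where 'a = real] True
      by (simp add: sum_distrib_right[symmetric])
    then show ?thesis by (simp add: sq_on_def)
  next
    case False
    then have b0: "0 < b" using b by auto
    have kb: "real k * b \<le> H / 4"
      using b k1 mult_left_mono[of b "real k * \<delta>" "real k"] kd(1) by simp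
    have "(\<Sum>j<K. sq_on {x j..x j + H / 2} (\<lambda>t. \<Sum>i\<le>k. (-1) ^ i * real (k choose i) * f (t + a - real i * b)))
        = (\<Sum>j<K. sq_on {x j + (a - real k * b)..x j + H / 2 + (a - real k * b)} (finite_difference k b f))"
      unfolding finite_difference_reverse by (intro sum.cong refl sq_on_shift) measurable
    also have "\<dots> \<le> (\<Sum>j<K. sq_on {real j / real K..real (Suc j) / real K - real k * b} (finite_difference k b f))"
      using a kd(2) kb unfolding jH x_def by (intro sum_mono sq_on_mono) (auto simp: distrib_right)
    also have "\<dots> \<le> sq_on {0..1 - real k * b} (finite_difference k b f)"
      using b0 k K by (intro sum_sq_on_bins_le) auto
    also have "\<dots> \<le> B"
      using b kd(2) H by (intro B b0) (auto simp: H_def[symmetric])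
    finally show ?thesis .
  qed
  have "(\<Sum>j<K. sq_on {x j..x j + H / 2} (mixed_difference k w f)) \<le> 4 ^ k * B"
    if "\<And>i. w i \<in> {0..\<delta>}" for w
    by (rule sum_sq_on_mixed_difference_le[where \<delta> = \<delta>]) (use that pure in auto)
  from whitney_mixed[OF f d _ _ this] H
  obtain p where p: "\<And>j. p j = 0 \<or> degree (p j) < k"
    and pB: "(\<Sum>j<K. sq_on {x j..x j + H / 2} (\<lambda>t. f t - poly (p j) t))
      \<le> ennreal ((2 + 2 * ((H / 2) / \<delta>)\<^sup>2) ^ k) * (4 ^ k * B)"
    by auto
  have "(H / 2) / \<delta> = 2 * real k ^ 2" using H k by (simp add: \<delta>_def)
  then have pB': "(\<Sum>j<K. sq_on {x j..x j + H / 2} (\<lambda>t. f t - poly (p j) t)) \<le> ennreal c1 * B"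
    using pB by (simp add: c1_def ennreal_mult ennreal_power[symmetric] mult.assoc)
  \<comment> \<open>\<open>k\<close> widening steps by \<open>u\<close> add \<open>H / 4\<close> on
    either side and so turn the middle half into the closed bin.\<close>
  define u where "u = H / (4 * real k)"
  have u: "0 < u" "real k * u = H / 4" using H k by (auto simp: u_def)
  have uH: "u \<le> H" using mult_right_mono[OF k1, of u] u H by simp
  have bin: "{x j - real k * u..x j + H / 2 + real k * u} = closed_bin K j" for j
    unfolding u x_def jH by (simp add: distrib_right)
  have bin': "{x j - real k * u..x j + H / 2 + real k * u - real k * u}
      = {real j / real K..real (Suc j) / real K - real k * u}" for j
    unfolding u x_def jH by (simp add: distrib_right)
  have "(\<Sum>j<K. sq_on (closed_bin K j) (\<lambda>t. f t - poly (p j) t))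
      \<le> (\<Sum>j<K. ennreal c2 * (sq_on {x j..x j + H / 2} (\<lambda>t. f t - poly (p j) t)
        + of_nat (4 * k) * sq_on {real j / real K..real (Suc j) / real K - real k * u} (finite_difference k u f)))"
  proof (intro sum_mono)
    fix j
    show "sq_on (closed_bin K j) (\<lambda>t. f t - poly (p j) t)
      \<le> ennreal c2 * (sq_on {x j..x j + H / 2} (\<lambda>t. f t - poly (p j) t)
        + of_nat (4 * k) * sq_on {real j / real K..real (Suc j) / real K - real k * u} (finite_difference k u f))"
      unfolding bin[symmetric] bin'[symmetric] c2_def
      using u H by (intro sq_on_widen p) auto
  qed
  also have "\<dots> = ennreal c2 * ((\<Sum>j<K. sq_on {x j..x j + H / 2} (\<lambda>t. f t - poly (p j) t))
        + of_nat (4 * k) * (\<Sum>j<K. sq_on {real j / real K..real (Suc j) / real K - real k * u} (finite_difference k u f)))"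
    by (simp add: sum_distrib_left sum.distrib distrib_left)
  also have "\<dots> \<le> ennreal c2 * (ennreal c1 * B + of_nat (4 * k) * B)"
  proof (intro mult_left_mono add_mono pB')
    have "(\<Sum>j<K. sq_on {real j / real K..real (Suc j) / real K - real k * u} (finite_difference k u f))
        \<le> sq_on {0..1 - real k * u} (finite_difference k u f)"
      using u k K by (intro sum_sq_on_bins_le) auto
    also have "\<dots> \<le> B" using u uH by (intro B) (auto simp: H_def)
    finally show "(\<Sum>j<K. sq_on {real j / real K..real (Suc j) / real K - real k * u} (finite_difference k u f)) \<le> B" .
  qed auto
  also have "\<dots> = ennreal c2 * (ennreal c1 + of_nat (4 * k)) * B"
    by (simp only: distrib_right mult.assoc)
  also have "ennreal c2 * (ennreal c1 + of_nat (4 * k)) = ennreal (c2 * (c1 + real (4 * k)))"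
    unfolding ennreal_of_nat_eq_real_of_nat
    by (subst ennreal_plus[symmetric, OF c0(1) of_nat_0_le_iff], subst ennreal_mult) (use c0 in auto)
  finally show "\<exists>p. (\<forall>j. p j = 0 \<or> degree (p j) < k) \<and>
        (\<Sum>j<K. sq_on (closed_bin K j) (\<lambda>t. f t - poly (p j) t))
          \<le> ennreal (c2 * (c1 + real (4 * k))) * B"
    using p by blast
qed

section \<open>Splines assembled from polynomials on the bins\<close>

lemma bin_of:
  fixes t :: real
  assumes "0 < K" "0 \<le> t" "t < 1"
  obtains j where "j < K" "t \<in> bin K j"
proof
  define j where "j = nat \<lfloor>real K * t\<rfloor>"
  have j: "real j \<le> real K * t" "real K * t < real (Suc j)"
    using assms by (auto simp: j_def) linarith+
  show "t \<in> bin K j"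
    using j assms by (auto simp: field_simps)
  have "real K * t < real K" using assms by simp
  then have "real j < real K" using j(1) by linarith
  then show "j < K" by simp
qed

lemma bins_disjoint:
  fixes t :: real
  assumes "0 < K" "t \<in> bin K i" "t \<in> bin K j"
  shows "i = j"
proof -
  have "real i \<le> real K * t" "real K * t < real (Suc i)" "real j \<le> real K * t" "real K * t < real (Suc j)"
    using assms by (auto simp: field_simps)
  then have "real i < real (Suc j)" "real j < real (Suc i)" by linarith+
  then show ?thesis by simp
qed

text \<open>The spline space numbers its pieces from 1, \<open>bin\<close> from 0; hence
  \<open>Suc j\<close>.\<close>

lemma sum_bins_eval:
  fixes t :: real
  assumes K: "0 < K" and j: "j < K" and t: "t \<in> bin K j"
  shows "(\<Sum>i=1..K. g i * indicator {(real i - 1) / real K..<real i / real K} t) = (g (Suc j) :: real)"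
proof -
  have "(\<Sum>i=1..K. g i * indicator {(real i - 1) / real K..<real i / real K} t)
      = (\<Sum>i\<in>{Suc j}. g i * indicator {(real i - 1) / real K..<real i / real K} t)"
  proof (intro sum.mono_neutral_right ballI)
    fix i assume i: "i \<in> {1..K} - {Suc j}"
    then obtain m where m: "i = Suc m" by (cases i) auto
    have "t \<notin> bin K m"
      using bins_disjoint[OF K _ t, of m] i m by auto
    then show "g i * indicator {(real i - 1) / real K..<real i / real K} t = 0"
      by (simp add: m)
  qed (use j in auto)
  also have "\<dots> = g (Suc j)" using t by simp
  finally show ?thesis .
qed

lemma piecewise_poly_measurable:
  assumes "v \<in> piecewise_poly_space r K"
  shows "v \<in> borel_measurable borel"
proof -
  obtain P where "v = (\<lambda>t. \<Sum>j=1..K. poly (P j) t * indicator {(real j - 1) / real K ..< real j / real K} t)"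
    using assms unfolding piecewise_poly_space_def by blast
  then show ?thesis by (simp only:) measurable
qed

lemma piecewise_poly_approx:
  fixes f0 :: "real \<Rightarrow> real"
  assumes [measurable]: "f0 \<in> borel_measurable borel" and K: "0 < K"
    and p: "\<And>j. degree (p j) \<le> r - 1"
    and le: "(\<Sum>j<K. sq_on (closed_bin K j) (\<lambda>t. f0 t - poly (p j) t)) \<le> B"
  obtains v where "v \<in> piecewise_poly_space r K" "sq_on {0..1} (\<lambda>t. f0 t - v t) \<le> B"
proof
  define v where "v = (\<lambda>t. \<Sum>j=1..K. poly (p (j - 1)) t * indicator {(real j - 1) / real K..<real j / real K} t)"
  show "v \<in> piecewise_poly_space r K"
    unfolding piecewise_poly_space_def v_def using p
    by (intro CollectI exI[of _ "\<lambda>j. p (j - 1)"]) auto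
  \<comment> \<open>At \<open>t = 1\<close> the spline is 0, since its last piece lives on a
    half-open bin; a single point is negligible.\<close>
  have "AE t in lborel. t \<noteq> (1::real)" by (rule AE_lborel_singleton)
  then have "sq_on {0..1} (\<lambda>t. f0 t - v t)
      \<le> (\<integral>\<^sup>+ t. (\<Sum>j<K. ennreal ((f0 t - poly (p j) t)\<^sup>2) * indicator (closed_bin K j) t) \<partial>lborel)"
    unfolding sq_on_def
  proof (intro nn_integral_mono_AE, elim eventually_mono)
    fix t :: real assume "t \<noteq> 1"
    show "ennreal ((f0 t - v t)\<^sup>2) * indicator {0..1} t
        \<le> (\<Sum>j<K. ennreal ((f0 t - poly (p j) t)\<^sup>2) * indicator (closed_bin K j) t)"
    proof (cases "t \<in> {0..1}")
      case True
      then obtain j where j: "j < K" "t \<in> bin K j"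
        using bin_of[OF K, of t] \<open>t \<noteq> 1\<close> by auto
      have "v t = poly (p j) t"
        using sum_bins_eval[OF K j, of "\<lambda>i. poly (p (i - 1)) t"] by (simp add: v_def)
      then have "ennreal ((f0 t - v t)\<^sup>2) * indicator {0..1} t
          = ennreal ((f0 t - poly (p j) t)\<^sup>2) * indicator (closed_bin K j) t"
        using True j(2) by (simp add: indicator_def del: of_nat_Suc)
      also have "\<dots> \<le> (\<Sum>j<K. ennreal ((f0 t - poly (p j) t)\<^sup>2) * indicator (closed_bin K j) t)"
        using j(1) by (intro member_le_sum) auto
      finally show ?thesis .
    qed simp
  qed
  also have "\<dots> = (\<Sum>j<K. sq_on (closed_bin K j) (\<lambda>t. f0 t - poly (p j) t))"
    unfolding sq_on_def by (rule nn_integral_sum) measurable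
  also have "\<dots> \<le> B" by (rule le)
  finally show "sq_on {0..1} (\<lambda>t. f0 t - v t) \<le> B" .
qed

section \<open>Spline approximation in the smoothness classes\<close>

lemma finite_difference_cong:
  assumes "\<And>x. x \<in> {0..1} \<Longrightarrow> f x = g x" "0 \<le> b" "t \<in> {0..1 - real k * b}"
  shows "finite_difference k b f t = finite_difference k b g t"
proof -
  have "t + real j * b \<in> {0..1}" if "j \<le> k" for j
    using assms that mult_right_mono[of "real j" "real k" b] by auto
  then show ?thesis
    unfolding finite_difference_def using assms(1) by (intro sum.cong) auto
qed

text \<open>The outer supremum at \<open>h = b\<close> and the inner one at the step
  \<open>b\<close>. An infinite integral would make the seminorm infinite, so
  \<open>enn2real\<close> loses nothing.\<close>

lemma smoothness_ball_difference_le: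
  assumes f: "f \<in> smoothness_ball \<nu> \<alpha> L" and b: "0 < b"
  shows "(\<integral>\<^sup>+ t. ennreal ((finite_difference (nat \<lfloor>\<alpha>\<rfloor> + 1) b f t)\<^sup>2)
      * indicator {0..1 - real (nat \<lfloor>\<alpha>\<rfloor> + 1) * b} t \<partial>\<nu>) \<le> ennreal (L\<^sup>2 * b powr (2 * \<alpha>))"
    (is "?s \<le> _")
proof -
  let ?k = "nat \<lfloor>\<alpha>\<rfloor> + 1"
  let ?N = "L2_norm_on \<nu> {0..1 - real ?k * b} (finite_difference ?k b f)"
  have "ereal (b powr (- \<alpha>)) * ?N \<le> ereal (b powr (- \<alpha>)) * modulus_of_smoothness \<nu> ?k f b"
    unfolding modulus_of_smoothness_def using b
    by (intro ereal_mult_left_mono SUP_upper) auto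
  also have "\<dots> \<le> lip_seminorm \<nu> \<alpha> f"
    unfolding lip_seminorm_def using b by (intro SUP_upper) auto
  also have "\<dots> \<le> ereal L" using f by (simp add: smoothness_ball_def)
  finally have le: "ereal (b powr (- \<alpha>)) * ?N \<le> ereal L" .
  have fin: "?s \<noteq> \<infinity>"
  proof
    assume "?s = \<infinity>"
    then have "?N = \<infinity>" by (simp add: L2_norm_on_def Let_def)
    then show False using le b by simp
  qed
  then have "?N = ereal (sqrt (enn2real ?s))" by (simp add: L2_norm_on_def Let_def)
  then have "b powr (- \<alpha>) * sqrt (enn2real ?s) \<le> L" using le by simp
  then have "sqrt (enn2real ?s) \<le> L * b powr \<alpha>"
    using b by (simp add: powr_minus field_simps)
  then have "(sqrt (enn2real ?s))\<^sup>2 \<le> (L * b powr \<alpha>)\<^sup>2"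
    by (intro power_mono) auto
  then have "enn2real ?s \<le> L\<^sup>2 * b powr (2 * \<alpha>)"
    using b by (simp add: power_mult_distrib powr_power mult.commute)
  then have "ennreal (enn2real ?s) \<le> ennreal (L\<^sup>2 * b powr (2 * \<alpha>))" by (rule ennreal_leI)
  moreover have "ennreal (enn2real ?s) = ?s" using fin by (intro ennreal_enn2real) (simp add: less_top)
  ultimately show ?thesis by (simp only:)
qed

text \<open>\<open>C\<close> must not depend on \<open>\<alpha>\<close>. The order, floor of
  \<open>\<alpha>\<close> plus 1, takes only the values 1, ..., \<open>r\<close>, so the sum of
  Whitney's constants over these orders serves them all, and \<open>K \<ge> 1\<close> allows
  \<open>\<alpha>\<close> to be lowered to \<open>\<kappa>\<close> in the rate. The bound
  \<open>\<alpha> < r\<close> also keeps the degrees below \<open>r\<close>.\<close>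

lemma smoothness_ball_approx:
  fixes \<nu> :: "real measure"
  assumes sets: "sets \<nu> = sets borel" and c0: "0 < c0"
    and lower: "\<And>g. g \<in> borel_measurable borel \<Longrightarrow>
      ennreal c0 * (\<integral>\<^sup>+ t. g t * indicator {0..1} t \<partial>lborel) \<le> (\<integral>\<^sup>+ t. g t * indicator {0..1} t \<partial>\<nu>)"
  obtains C :: real where "0 \<le> C"
    "\<And>\<alpha> f K. \<kappa> \<le> \<alpha> \<Longrightarrow> 0 < \<alpha> \<Longrightarrow> \<alpha> < real r \<Longrightarrow> f \<in> smoothness_ball \<nu> \<alpha> L \<Longrightarrow> 0 < K \<Longrightarrow>
      \<exists>v\<in>piecewise_poly_space r K.
        sq_on {0..1} (\<lambda>t. indicator {0..1} t * f t - v t) \<le> ennreal (C * real K powr (- 2 * \<kappa>))"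
proof -
  \<comment> \<open>Names Whitney's inequality of order \<open>k\<close> with constant
    \<open>C\<close>, so that one constant can be chosen for every order at once.\<close>
  define W where "W k C \<longleftrightarrow> 0 \<le> C \<and> (\<forall>f K B. L2_fun f \<longrightarrow> 0 < K \<longrightarrow>
      (\<forall>b. 0 < b \<longrightarrow> b \<le> 1 / real K \<longrightarrow> sq_on {0..1 - real k * b} (finite_difference k b f) \<le> B) \<longrightarrow>
      (\<exists>p. (\<forall>j. p j = 0 \<or> degree (p j) < k) \<and>
        (\<Sum>j<K. sq_on (closed_bin K j) (\<lambda>t. f t - poly (p j) t)) \<le> ennreal C * B))"
    for k C
  have "\<exists>C. W k C" if "0 < k" for k
    by (rule whitney_bins[OF that]) (unfold W_def, blast)
  then obtain c where c: "\<And>k. 0 < k \<Longrightarrow> W k (c k)" by metis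
  define C where "C = (\<Sum>k=1..r. c k)"
  have c_nonneg: "0 \<le> c k" if "0 < k" for k using c[OF that] by (simp add: W_def)
  have C: "c k \<le> C" if "k \<in> {1..r}" for k
    unfolding C_def using that c_nonneg by (intro member_le_sum) auto
  have C0: "0 \<le> C" unfolding C_def using c_nonneg by (intro sum_nonneg) auto
  have "\<exists>v\<in>piecewise_poly_space r K.
        sq_on {0..1} (\<lambda>t. indicator {0..1} t * f t - v t) \<le> ennreal (C * L\<^sup>2 / c0 * real K powr (- 2 * \<kappa>))"
    if \<alpha>: "\<kappa> \<le> \<alpha>" "0 < \<alpha>" "\<alpha> < real r" and f: "f \<in> smoothness_ball \<nu> \<alpha> L" and K: "0 < K" for \<alpha> f K
  proof -
    let ?k = "nat \<lfloor>\<alpha>\<rfloor> + 1"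
    have "\<lfloor>\<alpha>\<rfloor> < int r" using \<alpha> by (simp add: floor_less_iff)
    then have k: "?k \<in> {1..r}" using \<alpha> by auto
    \<comment> \<open>Membership in the class says nothing about \<open>f\<close> outside
      \<open>{0..1}\<close>. The differences that occur use only points of \<open>{0..1}\<close>,
      where \<open>f0\<close> equals \<open>f\<close>.\<close>
    define f0 where "f0 = (\<lambda>t. indicator {0..1} t * f t)"
    have sqi: "square_integrable_on \<nu> {0..1} f"
      using f by (simp add: smoothness_ball_def Lip_star_def)
    have fm [measurable]: "f0 \<in> borel_measurable borel"
      using sqi unfolding square_integrable_on_def set_borel_measurable_def f0_def
      by (simp add: measurable_cong_sets[OF sets refl])
    have "ennreal c0 * sq_on UNIV f0 = ennreal c0 * (\<integral>\<^sup>+ t. ennreal ((f0 t)\<^sup>2) * indicator {0..1} t \<partial>lborel)"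
      unfolding sq_on_def f0_def by (intro arg_cong[of _ _ "\<lambda>z. ennreal c0 * z"] nn_integral_cong) (auto split: split_indicator)
    also have "\<dots> \<le> (\<integral>\<^sup>+ t. ennreal ((f0 t)\<^sup>2) * indicator {0..1} t \<partial>\<nu>)"
      by (rule lower) measurable
    also have "\<dots> = (\<integral>\<^sup>+ t. ennreal (norm (indicator {0..1} t *\<^sub>R (f t)\<^sup>2)) \<partial>\<nu>)"
      by (intro nn_integral_cong) (auto simp: f0_def split: split_indicator)
    also have "\<dots> < \<infinity>"
      using sqi by (auto simp: square_integrable_on_def set_integrable_def integrable_iff_bounded)
    finally have "sq_on UNIV f0 < \<infinity>" using c0 by (auto simp: ennreal_mult_less_top)
    then have L2: "L2_fun f0" using fm by (simp add: L2_fun_def)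
    have eq0: "f0 x = f x" if "x \<in> {0..1}" for x using that by (simp add: f0_def)
    let ?B = "ennreal (L\<^sup>2 / c0 * real K powr (- 2 * \<kappa>))"
    have B: "sq_on {0..1 - real ?k * b} (finite_difference ?k b f0) \<le> ?B"
      if b: "0 < b" "b \<le> 1 / real K" for b
    proof -
      have kb: "0 \<le> real ?k * b" using b(1) by simp
      have bK: "b powr (2 * \<alpha>) \<le> real K powr (- 2 * \<kappa>)"
      proof -
        have "b powr (2 * \<alpha>) \<le> (1 / real K) powr (2 * \<alpha>)"
          using b \<alpha> by (intro powr_mono2) auto
        also have "\<dots> = real K powr (- (2 * \<alpha>))"
          using K by (simp add: powr_divide powr_minus inverse_eq_divide)
        also have "\<dots> \<le> real K powr (- 2 * \<kappa>)"
          using K \<alpha> by (intro powr_mono) auto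
        finally show ?thesis .
      qed
      have "ennreal c0 * sq_on {0..1 - real ?k * b} (finite_difference ?k b f0)
          = ennreal c0 * (\<integral>\<^sup>+ t. (ennreal ((finite_difference ?k b f0 t)\<^sup>2) * indicator {0..1 - real ?k * b} t) * indicator {0..1} t \<partial>lborel)"
        unfolding sq_on_def using kb
        by (intro arg_cong[of _ _ "\<lambda>z. ennreal c0 * z"] nn_integral_cong) (auto split: split_indicator)
      also have "\<dots> \<le> (\<integral>\<^sup>+ t. (ennreal ((finite_difference ?k b f0 t)\<^sup>2) * indicator {0..1 - real ?k * b} t) * indicator {0..1} t \<partial>\<nu>)"
        by (rule lower) measurable
      also have "\<dots> = (\<integral>\<^sup>+ t. ennreal ((finite_difference ?k b f t)\<^sup>2) * indicator {0..1 - real ?k * b} t \<partial>\<nu>)"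
      proof (intro nn_integral_cong)
        fix t
        have "finite_difference ?k b f0 t = finite_difference ?k b f t" if "t \<in> {0..1 - real ?k * b}"
          using finite_difference_cong[OF eq0 _ that] b(1) by simp
        moreover have "t \<in> {0..1}" if "t \<in> {0..1 - real ?k * b}" using that kb by auto
        ultimately show "(ennreal ((finite_difference ?k b f0 t)\<^sup>2) * indicator {0..1 - real ?k * b} t) * indicator {0..1} t
            = ennreal ((finite_difference ?k b f t)\<^sup>2) * indicator {0..1 - real ?k * b} t"
          by (cases "t \<in> {0..1 - real ?k * b}") simp_all
      qed
      also have "\<dots> \<le> ennreal (L\<^sup>2 * b powr (2 * \<alpha>))"
        by (rule smoothness_ball_difference_le[OF f b(1)])
      also have "\<dots> \<le> ennreal (L\<^sup>2 * real K powr (- 2 * \<kappa>))"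
        using bK by (intro ennreal_leI mult_left_mono) auto
      also have "\<dots> = ennreal c0 * ?B"
        using c0 by (subst ennreal_mult[symmetric]) auto
      finally show ?thesis
        using c0 by (simp add: ennreal_mult_le_mult_iff)
    qed
    have "W ?k (c ?k)" by (rule c) simp
    from conjunct2[OF this[unfolded W_def], rule_format, OF L2 K B]
    obtain p where p: "\<And>j. p j = 0 \<or> degree (p j) < ?k"
      and pB: "(\<Sum>j<K. sq_on (closed_bin K j) (\<lambda>t. f0 t - poly (p j) t)) \<le> ennreal (c ?k) * ?B"
      by blast
    have "degree (p j) \<le> r - 1" for j using p[of j] k by auto
    from piecewise_poly_approx[OF fm K this pB]
    obtain v where v: "v \<in> piecewise_poly_space r K"
      and vB: "sq_on {0..1} (\<lambda>t. f0 t - v t) \<le> ennreal (c ?k) * ?B" .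
    note vB
    also have "ennreal (c ?k) * ?B \<le> ennreal C * ?B"
      using C[OF k] by (intro mult_right_mono ennreal_leI) auto
    also have "\<dots> = ennreal (C * L\<^sup>2 / c0 * real K powr (- 2 * \<kappa>))"
      using C0 c0 by (subst ennreal_mult[symmetric]) auto
    finally show ?thesis using v unfolding f0_def by blast
  qed
  moreover have "0 \<le> C * L\<^sup>2 / c0" using C0 c0 by simp
  ultimately show ?thesis using that by blast
qed

section \<open>Coercivity of the least squares form\<close>

text \<open>The minimum over the compact unit sphere is positive, and homogeneity extends the bound
  to all \<open>b\<close>.\<close>

lemma quadratic_form_coercive:
  fixes G :: "'k \<Rightarrow> 'k \<Rightarrow> real"
  assumes D: "finite D"
    and pos: "\<And>b. \<exists>k\<in>D. b k \<noteq> 0 \<Longrightarrow> 0 < (\<Sum>k\<in>D. \<Sum>l\<in>D. b k * b l * G k l)"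
  obtains c where "0 < c" "\<And>b. c * (\<Sum>k\<in>D. (b k)\<^sup>2) \<le> (\<Sum>k\<in>D. \<Sum>l\<in>D. b k * b l * G k l)"
proof (cases "D = {}")
  case True
  then show thesis using that[of 1] by simp
next
  case False
  define Q where "Q b = (\<Sum>k\<in>D. \<Sum>l\<in>D. b k * b l * G k l)" for b :: "'k \<Rightarrow> real"
  \<comment> \<open>Coordinates outside \<open>D\<close> are fixed at 0, so that by Tychonoff's
    theorem the cube is compact in the space of functions on the whole index type; the unit sphere
    is a closed subset of it.\<close>
  define P where "P = (PiE UNIV (\<lambda>k. if k \<in> D then {-1..1::real} else {0}))"
  have "compactin (product_topology (\<lambda>_. euclidean) UNIV) P"
    unfolding P_def compactin_PiE by auto
  then have cP: "compact P" by (simp add: euclidean_product_topology)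
  have cont: "continuous_on UNIV (\<lambda>b :: 'k \<Rightarrow> real. b k)" for k by simp
  have "closed {b :: 'k \<Rightarrow> real. (\<Sum>k\<in>D. (b k)\<^sup>2) = 1}"
    by (intro closed_Collect_eq continuous_intros) auto
  then have cS: "compact (P \<inter> {b. (\<Sum>k\<in>D. (b k)\<^sup>2) = 1})" (is "compact ?S")
    using cP by (intro compact_Int_closed)
  define nb where "nb b k = (if k \<in> D then b k / sqrt (\<Sum>k\<in>D. (b k)\<^sup>2) else 0)" for b :: "'k \<Rightarrow> real" and k
  have nb: "nb b \<in> ?S" if "(\<Sum>k\<in>D. (b k)\<^sup>2) \<noteq> 0" for b
  proof -
    let ?s = "\<Sum>k\<in>D. (b k)\<^sup>2"
    have s: "0 < ?s" using that sum_nonneg[of D "\<lambda>k. (b k)\<^sup>2"] by (simp add: less_le)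
    have "(\<Sum>k\<in>D. (nb b k)\<^sup>2) = (\<Sum>k\<in>D. (b k)\<^sup>2 / ?s)"
      using s by (intro sum.cong refl) (simp add: nb_def power_divide)
    also have "\<dots> = 1" using s by (simp add: sum_divide_distrib[symmetric])
    finally have 1: "(\<Sum>k\<in>D. (nb b k)\<^sup>2) = 1" .
    have "nb b k \<in> {-1..1}" if "k \<in> D" for k
    proof -
      have "(nb b k)\<^sup>2 \<le> (\<Sum>k\<in>D. (nb b k)\<^sup>2)" using that D by (intro member_le_sum) auto
      then have "\<bar>nb b k\<bar> \<le> 1" using 1 by (simp add: abs_square_le_1)
      then show ?thesis by (auto simp: abs_le_iff)
    qed
    moreover have "nb b k = 0" if "k \<notin> D" for k using that by (simp add: nb_def)
    ultimately show ?thesis using 1 by (simp add: P_def PiE_UNIV_domain)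
  qed
  obtain k0 where "k0 \<in> D" using False by blast
  then have "(\<Sum>k\<in>D. ((\<lambda>_. 1 :: real) k)\<^sup>2) \<noteq> 0" using D False by (simp add: card_eq_0_iff)
  from nb[OF this] have ne: "?S \<noteq> {}" by blast
  have "continuous_on ?S Q"
    unfolding Q_def by (intro continuous_intros continuous_on_subset[OF cont]) auto
  from continuous_attains_inf[OF cS ne this]
  obtain b0 where b0: "b0 \<in> ?S" and min: "\<And>b. b \<in> ?S \<Longrightarrow> Q b0 \<le> Q b" by blast
  have "\<exists>k\<in>D. b0 k \<noteq> 0"
  proof (rule ccontr)
    assume "\<not> ?thesis"
    then have "(\<Sum>k\<in>D. (b0 k)\<^sup>2) = 0" by simp
    then show False using b0 by simp
  qed
  then have c: "0 < Q b0" unfolding Q_def by (rule pos)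
  have "Q b0 * (\<Sum>k\<in>D. (b k)\<^sup>2) \<le> Q b" for b
  proof (cases "(\<Sum>k\<in>D. (b k)\<^sup>2) = 0")
    case True
    then have "\<And>k. k \<in> D \<Longrightarrow> b k = 0" using D by (simp add: sum_nonneg_eq_0_iff)
    then have "Q b = 0" by (simp add: Q_def)
    then show ?thesis using True by simp
  next
    case False
    let ?s = "\<Sum>k\<in>D. (b k)\<^sup>2"
    have s: "0 < ?s" using False sum_nonneg[of D "\<lambda>k. (b k)\<^sup>2"] by (simp add: less_le)
    have "Q (nb b) = (\<Sum>k\<in>D. \<Sum>l\<in>D. b k * b l * G k l / ?s)"
      unfolding Q_def using s by (intro sum.cong refl) (simp add: nb_def)
    also have "\<dots> = Q b / ?s" by (simp add: Q_def sum_divide_distrib)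
    finally have "Q b0 \<le> Q b / ?s" using min[OF nb[OF False]] by simp
    then show ?thesis using s by (simp add: field_simps)
  qed
  then show thesis using that[OF c] unfolding Q_def by blast
qed

section \<open>One bin rescaled to the unit interval: coordinates of \<open>x\<close> and monomials
  in \<open>t\<close>\<close>

abbreviation unit_index :: "nat \<Rightarrow> ('q::finite + nat) set" where
  "unit_index r \<equiv> range Inl \<union> Inr ` {..<r}"

fun unit_basis :: "'q::finite + nat \<Rightarrow> (real ^ 'q) \<times> real \<Rightarrow> real" where
  "unit_basis (Inl i) z = fst z $ i"
| "unit_basis (Inr m) z = snd z ^ m"

lemma continuous_on_unit_basis: "continuous_on A (unit_basis k)"
  by (cases k) (auto simp: unit_basis.simps[abs_def] intro!: continuous_intros)

lemma unit_basis_measurable [measurable]: "unit_basis k \<in> borel_measurable borel"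
  by (intro borel_measurable_continuous_onI continuous_on_unit_basis)

text \<open>A polynomial in \<open>s\<close> that is constant for a.e. \<open>s\<close> is constant, and hyperplanes are null sets.\<close>

lemma unit_basis_independent:
  fixes S :: "(real ^ 'q::finite) set"
  assumes S: "S \<in> sets lborel" "emeasure lborel S \<noteq> 0"
    and ae: "AE z in lborel. z \<in> S \<times> {0..1} \<longrightarrow> (\<Sum>k\<in>unit_index r. b k * unit_basis k z) = 0"
    and k: "k \<in> unit_index r"
  shows "b k = 0"
proof -
  define l where "l = (\<chi> i. b (Inl i))"
  define p where "p = (\<Sum>m<r. monom (b (Inr m)) m)"
  have split: "(\<Sum>k\<in>unit_index r. b k * unit_basis k z) = l \<bullet> fst z + poly p (snd z)" for z
    by (subst sum.union_disjoint)
       (auto simp: sum.reindex inj_on_def l_def p_def inner_vec_def poly_sum poly_monom)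
  have cp: "coeff p m = b (Inr m)" if "m < r" for m
    using that by (simp add: p_def coeff_sum)
  have "AE z in lborel \<Otimes>\<^sub>M lborel. z \<in> S \<times> {0..1} \<longrightarrow> l \<bullet> fst z + poly p (snd z) = 0"
    using ae unfolding split lborel_prod .
  then have "AE x in lborel. AE s in lborel. (x, s) \<in> S \<times> {0..1} \<longrightarrow> l \<bullet> fst (x, s) + poly p (snd (x, s)) = 0"
    by (rule lborel_pair.AE_pair)
  then have const: "AE x in lborel. x \<in> S \<longrightarrow> p = [:- (l \<bullet> x):]"
  proof (elim eventually_mono, intro impI)
    fix x assume x: "AE s in lborel. (x, s) \<in> S \<times> {0..1} \<longrightarrow> l \<bullet> fst (x, s) + poly p (snd (x, s)) = 0" and "x \<in> S"
    then have a: "AE s in lborel. s \<in> {0..1} \<longrightarrow> poly ([:l \<bullet> x:] + p) s = 0" by simp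
    have "[:l \<bullet> x:] + p = 0"
    proof (rule ccontr)
      assume "[:l \<bullet> x:] + p \<noteq> 0"
      then have "countable {s. poly ([:l \<bullet> x:] + p) s = 0}"
        by (intro countable_finite poly_roots_finite)
      then have "{s. poly ([:l \<bullet> x:] + p) s = 0} \<in> null_sets lborel"
        by (rule countable_imp_null_set_lborel)
      then have "AE s in lborel. s \<notin> {s. poly ([:l \<bullet> x:] + p) s = 0}" by (rule AE_not_in)
      with a have "AE s in lborel. s \<notin> {0..1::real}" by eventually_elim auto
      then have "emeasure lborel {0..1::real} = 0"
        by (subst (asm) AE_iff_measurable[of "{0..1}"]) auto
      then show False by simp
    qed
    then show "p = [:- (l \<bullet> x):]"
      by (metis add_eq_0_iff minus_pCons neg_equal_iff_equal minus_zero)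
  qed
  have notnull: "\<not> (AE x in lborel. x \<notin> S)"
    using S by (subst AE_iff_measurable[of S]) (auto simp: sets.sets_into_space)
  have l0: "l = 0"
  proof (rule ccontr)
    assume "l \<noteq> 0"
    then have "negligible {x. l \<bullet> x = - coeff p 0}" by (intro negligible_hyperplane) simp
    then have "{x. l \<bullet> x = - coeff p 0} \<in> null_sets lebesgue" by (simp add: negligible_iff_null_sets)
    moreover have "{x. l \<bullet> x = - coeff p 0} \<in> sets lborel" by measurable
    ultimately have "{x. l \<bullet> x = - coeff p 0} \<in> null_sets lborel"
      by (simp add: null_sets_completion_iff)
    from AE_not_in[OF this] const have "AE x in lborel. x \<notin> S"
      by eventually_elim auto
    then show False using notnull by simp
  qed
  have "p = 0"
  proof (rule ccontr)
    assume "p \<noteq> 0"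
    then have "AE x in lborel. x \<notin> S" using const l0 by (auto elim!: eventually_mono)
    then show False using notnull by simp
  qed
  then show ?thesis using k cp l0 by (auto simp: l_def vec_eq_iff)
qed

text \<open>Half-open in \<open>s\<close>, as the rescaled bins are.\<close>

abbreviation unit_energy :: "(real ^ 'q::finite) set \<Rightarrow> nat \<Rightarrow> ('q + nat \<Rightarrow> real) \<Rightarrow> ennreal" where
  "unit_energy S r b \<equiv> \<integral>\<^sup>+ x. \<integral>\<^sup>+ s. ennreal ((\<Sum>k\<in>unit_index r. b k * unit_basis k (x, s))\<^sup>2)
        * indicator {0..<1} s * indicator S x \<partial>lborel \<partial>lborel"

text \<open>Linear independence makes the Gram matrix of the basis over
  \<open>S \<times> {0..1}\<close> positive definite, so its least eigenvalue can serve as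
  \<open>c\<close>.\<close>

lemma unit_basis_coercive:
  fixes S :: "(real ^ 'q::finite) set"
  assumes S: "compact S" "emeasure lborel S \<noteq> 0"
  obtains c where "0 < c" "\<And>b. ennreal (c * (\<Sum>k\<in>unit_index r. (b k)\<^sup>2))
    \<le> unit_energy S r b"
proof -
  let ?D = "unit_index r :: ('q + nat) set"
  let ?E = "S \<times> {0..1} :: ((real ^ 'q) \<times> real) set"
  have E: "compact ?E" using S(1) by (intro compact_Times) auto
  have Sm: "S \<in> sets borel" using S(1) by (simp add: borel_compact)
  have Em [measurable]: "?E \<in> sets borel" using E by (simp add: borel_compact)
  have [measurable]: "S \<in> sets borel" by (rule Sm)
  have int: "integrable lborel (\<lambda>z. indicator ?E z *\<^sub>R f z)" if "continuous_on ?E f" for f :: "_ \<Rightarrow> real"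
    by (rule borel_integrable_compact[OF E that])
  define G where "G k l = (LINT z|lborel. indicator ?E z *\<^sub>R (unit_basis k z * unit_basis l z))" for k l :: "'q + nat"
  have iG: "integrable lborel (\<lambda>z. indicator ?E z *\<^sub>R (unit_basis k z * unit_basis l z))" for k l :: "'q + nat"
    by (intro int continuous_intros continuous_on_unit_basis)
  have expand: "(\<Sum>k\<in>?D. b k * unit_basis k z)\<^sup>2
      = (\<Sum>k\<in>?D. \<Sum>l\<in>?D. b k * b l * (unit_basis k z * unit_basis l z))" for b z
    unfolding power2_eq_square sum_product by (intro sum.cong refl) (simp add: ac_simps)
  have iQ: "integrable lborel (\<lambda>z. indicator ?E z *\<^sub>R (\<Sum>k\<in>?D. b k * unit_basis k z)\<^sup>2)" for b
    by (intro int continuous_intros continuous_on_unit_basis)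
  have Q: "(\<Sum>k\<in>?D. \<Sum>l\<in>?D. b k * b l * G k l)
      = (LINT z|lborel. indicator ?E z *\<^sub>R (\<Sum>k\<in>?D. b k * unit_basis k z)\<^sup>2)" for b
  proof -
    have "(LINT z|lborel. indicator ?E z *\<^sub>R (\<Sum>k\<in>?D. b k * unit_basis k z)\<^sup>2)
        = (LINT z|lborel. (\<Sum>k\<in>?D. \<Sum>l\<in>?D. b k * b l * (indicator ?E z *\<^sub>R (unit_basis k z * unit_basis l z))))"
      unfolding expand scaleR_sum_right by (intro Bochner_Integration.integral_cong refl sum.cong) simp
    also have "\<dots> = (\<Sum>k\<in>?D. \<Sum>l\<in>?D. b k * b l * G k l)"
      unfolding G_def
      by (subst Bochner_Integration.integral_sum, intro Bochner_Integration.integrable_sum integrable_mult_right iG,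
          subst Bochner_Integration.integral_sum, intro integrable_mult_right iG, subst integral_mult_right_zero, rule refl)
    finally show ?thesis ..
  qed
  have pos: "0 < (\<Sum>k\<in>?D. \<Sum>l\<in>?D. b k * b l * G k l)" if nz: "\<exists>k\<in>?D. b k \<noteq> 0" for b
  proof (rule ccontr)
    assume "\<not> ?thesis"
    moreover have "0 \<le> (LINT z|lborel. indicator ?E z *\<^sub>R (\<Sum>k\<in>?D. b k * unit_basis k z)\<^sup>2)"
      by (intro Bochner_Integration.integral_nonneg) auto
    ultimately have "(LINT z|lborel. indicator ?E z *\<^sub>R (\<Sum>k\<in>?D. b k * unit_basis k z)\<^sup>2) = 0"
      unfolding Q by linarith
    then have "AE z in lborel. indicator ?E z *\<^sub>R (\<Sum>k\<in>?D. b k * unit_basis k z)\<^sup>2 = 0"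
      by (subst (asm) integral_nonneg_eq_0_iff_AE[OF iQ]) auto
    then have "AE z in lborel. z \<in> ?E \<longrightarrow> (\<Sum>k\<in>?D. b k * unit_basis k z) = 0"
      by eventually_elim (auto simp: indicator_def)
    then have "\<forall>k\<in>?D. b k = 0" using unit_basis_independent[where S = S and r = r and b = b] Sm S(2) by auto
    then show False using nz by blast
  qed
  obtain c where c: "0 < c" and le: "\<And>b. c * (\<Sum>k\<in>?D. (b k)\<^sup>2) \<le> (\<Sum>k\<in>?D. \<Sum>l\<in>?D. b k * b l * G k l)"
    using quadratic_form_coercive[of ?D G] pos by auto
  have "ennreal (c * (\<Sum>k\<in>?D. (b k)\<^sup>2))
    \<le> unit_energy S r b" for b
  proof -
    have "ennreal (c * (\<Sum>k\<in>?D. (b k)\<^sup>2))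
        \<le> ennreal (LINT z|lborel. indicator ?E z *\<^sub>R (\<Sum>k\<in>?D. b k * unit_basis k z)\<^sup>2)"
      using le[of b] unfolding Q by (rule ennreal_leI)
    also have "\<dots> = (\<integral>\<^sup>+ z. ennreal (indicator ?E z *\<^sub>R (\<Sum>k\<in>?D. b k * unit_basis k z)\<^sup>2) \<partial>lborel)"
      by (rule nn_integral_eq_integral[symmetric]) (use iQ in auto)
    also have "\<dots> = (\<integral>\<^sup>+ z. ennreal (indicator ?E z *\<^sub>R (\<Sum>k\<in>?D. b k * unit_basis k z)\<^sup>2) \<partial>(lborel \<Otimes>\<^sub>M lborel))"
      by (simp add: lborel_prod)
    also have "\<dots> = (\<integral>\<^sup>+ x. \<integral>\<^sup>+ s. ennreal (indicator ?E (x, s) *\<^sub>R (\<Sum>k\<in>?D. b k * unit_basis k (x, s))\<^sup>2) \<partial>lborel \<partial>lborel)"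
      by (rule lborel.nn_integral_fst[symmetric]) (simp add: lborel_prod)
    also have "\<dots> = unit_energy S r b"
    proof (rule nn_integral_cong)
      fix x
      have "AE s in lborel. s \<noteq> (1 :: real)" by (rule AE_lborel_singleton)
      then show "(\<integral>\<^sup>+ s. ennreal (indicator ?E (x, s) *\<^sub>R (\<Sum>k\<in>?D. b k * unit_basis k (x, s))\<^sup>2) \<partial>lborel)
          = (\<integral>\<^sup>+ s. ennreal ((\<Sum>k\<in>?D. b k * unit_basis k (x, s))\<^sup>2) * indicator {0..<1} s * indicator S x \<partial>lborel)"
        by (intro nn_integral_cong_AE, eventually_elim) (auto simp: indicator_def)
    qed
    finally show ?thesis .
  qed
  then show thesis using that[OF c] by blast
qed

section \<open>Splines on all bins, with constants independent of the number of bins\<close>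

abbreviation slab_integral :: "(real ^ 'q::finite) set \<Rightarrow> ((real ^ 'q) \<times> real \<Rightarrow> ennreal) \<Rightarrow> ennreal" where
  "slab_integral S g \<equiv> \<integral>\<^sup>+ x. \<integral>\<^sup>+ t. g (x, t) * indicator {0..1} t * indicator S x \<partial>lborel \<partial>lborel"

text \<open>The factor \<open>sqrt K\<close> makes the \<open>L\<^sup>2\<close> norms of the basis functions independent of \<open>K\<close>.\<close>

fun spline_basis :: "nat \<Rightarrow> 'q::finite + nat \<times> nat \<Rightarrow> (real ^ 'q) \<times> real \<Rightarrow> real" where
  "spline_basis K (Inl i) z = fst z $ i"
| "spline_basis K (Inr (j, m)) z = sqrt (real K) * (real K * snd z - real j) ^ m
     * indicator (bin K j) (snd z)"

definition basis_index :: "nat \<Rightarrow> nat \<Rightarrow> ('q::finite + nat \<times> nat) set" where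
  "basis_index r K = range Inl \<union> Inr ` ({..<K} \<times> {..<r})"

lemma finite_basis_index [simp]: "finite (basis_index r K)"
  by (simp add: basis_index_def)

lemma sum_basis_index:
  fixes g :: "'q::finite + nat \<times> nat \<Rightarrow> real"
  shows "(\<Sum>k\<in>basis_index r K. g k) = (\<Sum>i\<in>UNIV. g (Inl i)) + (\<Sum>j<K. \<Sum>m<r. g (Inr (j, m)))"
proof -
  have "range Inl \<inter> Inr ` A = {}" for A :: "(nat \<times> nat) set" by auto
  then show ?thesis
    unfolding basis_index_def
    by (subst sum.union_disjoint) (simp_all add: sum.reindex inj_on_def sum.cartesian_product)
qed

lemma sum_unit_index:
  fixes g :: "'q::finite + nat \<Rightarrow> real"
  shows "(\<Sum>k\<in>unit_index r. g k) = (\<Sum>i\<in>UNIV. g (Inl i)) + (\<Sum>m<r. g (Inr m))"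
  by (subst sum.union_disjoint) (auto simp: sum.reindex inj_on_def)

lemma spline_basis_measurable [measurable]: "spline_basis K k \<in> borel_measurable borel"
proof (cases k)
  case (Inr p)
  then show ?thesis
    by (cases p) (simp add: spline_basis.simps[abs_def] borel_prod[symmetric] del: of_nat_Suc)
qed (auto simp: spline_basis.simps[abs_def] intro!: borel_measurable_continuous_onI continuous_intros)

lemma spline_basis_measurable_pair [measurable]:
  "spline_basis K k \<in> borel_measurable (borel \<Otimes>\<^sub>M borel)"
  by (simp add: borel_prod)

lemma spline_basis_fst_measurable:
  "(\<lambda>z :: ((real ^ 'q::finite) \<times> real) \<times> real. spline_basis K k (fst z)) \<in> borel_measurable borel"
  by (rule measurable_compose[OF borel_measurable_continuous_onI[OF continuous_on_fst[OF continuous_on_id]] spline_basis_measurable])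

lemma sum_bins_single:
  fixes h :: "nat \<Rightarrow> real"
  assumes "0 < K" "j < K" "t \<in> bin K j"
  shows "(\<Sum>i<K. h i * indicator (bin K i) t) = h j"
proof -
  define f where "f i = h i * indicator (bin K i) t" for i
  have "f i = 0" if "i \<noteq> j" for i
  proof -
    have "t \<notin> bin K i"
      using bins_disjoint[OF assms(1) _ assms(3), of i] that by blast
    then show ?thesis by (simp add: f_def indicator_def del: of_nat_Suc atLeastLessThan_iff)
  qed
  then have "(\<Sum>i\<in>{..<K} - {j}. f i) = 0" by (intro sum.neutral) auto
  then have "(\<Sum>i<K. f i) = f j" using assms(2) by (simp add: sum.remove[of _ j])
  also have "f j = h j" using assms(3) by (simp add: f_def indicator_def del: of_nat_Suc)
  finally show ?thesis by (simp only: f_def)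
qed

text \<open>On bin \<open>j\<close> only that bin's monomials survive. In the local coordinate
  \<open>K t - j\<close> the combination is one over the unit basis, with the factor
  \<open>sqrt K\<close> moved to the coefficients.\<close>

lemma sum_spline_basis_eq_unit:
  assumes K: "0 < K" and j: "j < K" and t: "t \<in> bin K j"
  shows "(\<Sum>k\<in>basis_index r K. b k * spline_basis K k (x, t))
    = (\<Sum>k\<in>unit_index r.
        (case k of Inl i \<Rightarrow> b (Inl i) | Inr m \<Rightarrow> sqrt (real K) * b (Inr (j, m))) * unit_basis k (x, real K * t - real j))"
proof -
  have "(\<Sum>i<K. \<Sum>m<r. b (Inr (i, m)) * spline_basis K (Inr (i, m)) (x, t))
      = (\<Sum>i<K. (\<Sum>m<r. sqrt (real K) * b (Inr (i, m)) * (real K * t - real i) ^ m)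
          * indicator (bin K i) t)"
    unfolding sum_distrib_right by (intro sum.cong refl) simp
  also have "\<dots> = (\<Sum>m<r. sqrt (real K) * b (Inr (j, m)) * (real K * t - real j) ^ m)"
    by (rule sum_bins_single[OF K j t])
  finally show ?thesis
    unfolding sum_basis_index sum_unit_index by simp
qed

text \<open>The same \<open>c\<close> serves all \<open>K\<close>: substituting the local coordinate
  costs \<open>1 / K\<close> on each bin. The spline coefficients of a bin regain this from their
  squared factor \<open>sqrt K\<close>, while the coefficients of \<open>x\<close> occur in all
  \<open>K\<close> bins.\<close>

lemma spline_basis_coercive:
  fixes S :: "(real ^ 'q::finite) set"
  assumes S: "compact S" "emeasure lborel S \<noteq> 0"
  obtains c where "0 < c" "\<And>K b. 0 < K \<Longrightarrow> ennreal (c * (\<Sum>k\<in>basis_index r K. (b k)\<^sup>2))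
    \<le> (\<integral>\<^sup>+ x. \<integral>\<^sup>+ t. ennreal ((\<Sum>k\<in>basis_index r K. b k * spline_basis K k (x, t))\<^sup>2)
        * indicator {0..1} t * indicator S x \<partial>lborel \<partial>lborel)"
proof -
  obtain c where c: "0 < c" and le: "\<And>b. ennreal (c * (\<Sum>k\<in>unit_index r. (b k)\<^sup>2))
    \<le> unit_energy S r b"
    by (rule unit_basis_coercive[OF S, where r = r], blast)
  have [measurable]: "S \<in> sets borel" using S(1) by (simp add: borel_compact)
  have "ennreal (c * (\<Sum>k\<in>basis_index r K. (b k)\<^sup>2))
    \<le> (\<integral>\<^sup>+ x. \<integral>\<^sup>+ t. ennreal ((\<Sum>k\<in>basis_index r K. b k * spline_basis K k (x, t))\<^sup>2)
        * indicator {0..1} t * indicator S x \<partial>lborel \<partial>lborel)" if K: "0 < K" for K b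
  proof -
    let ?g = "\<lambda>x t. ennreal ((\<Sum>k\<in>basis_index r K. b k * spline_basis K k (x, t))\<^sup>2)"
    let ?bin = "bin K"
    define b' where "b' j k = (case k of Inl i \<Rightarrow> b (Inl i) | Inr m \<Rightarrow> sqrt (real K) * b (Inr (j, m)))"
      for j :: nat and k :: "'q + nat"
    have bin: "ennreal (c / real K * ((\<Sum>i\<in>UNIV. (b (Inl i))\<^sup>2) + real K * (\<Sum>m<r. (b (Inr (j, m)))\<^sup>2)))
        \<le> (\<integral>\<^sup>+ x. \<integral>\<^sup>+ t. ?g x t * indicator (?bin j) t * indicator S x \<partial>lborel \<partial>lborel)" if j: "j < K" for j
    proof -
      have sub: "(\<integral>\<^sup>+ t. ?g x t * indicator (?bin j) t * indicator S x \<partial>lborel)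
          = ennreal (1 / real K) * (\<integral>\<^sup>+ s. ennreal ((\<Sum>k\<in>unit_index r. b' j k * unit_basis k (x, s))\<^sup>2)
              * indicator {0..<1} s * indicator S x \<partial>lborel)" for x
      proof -
        have "(\<integral>\<^sup>+ t. ?g x t * indicator (?bin j) t * indicator S x \<partial>lborel)
            = ennreal \<bar>1 / real K\<bar> * (\<integral>\<^sup>+ s. ?g x (real j / real K + 1 / real K * s)
                * indicator (?bin j) (real j / real K + 1 / real K * s) * indicator S x \<partial>lborel)"
          using K by (intro nn_integral_real_affine) auto
        also have "(\<integral>\<^sup>+ s. ?g x (real j / real K + 1 / real K * s)
                * indicator (?bin j) (real j / real K + 1 / real K * s) * indicator S x \<partial>lborel)
          = (\<integral>\<^sup>+ s. ennreal ((\<Sum>k\<in>unit_index r. b' j k * unit_basis k (x, s))\<^sup>2)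
              * indicator {0..<1} s * indicator S x \<partial>lborel)"
        proof (intro nn_integral_cong)
          fix s :: real
          let ?t = "real j / real K + 1 / real K * s"
          have mem: "?t \<in> ?bin j \<longleftrightarrow> s \<in> {0..<1}"
            using K by (auto simp: field_simps)
          have "real K * ?t - real j = s" using K by (simp add: field_simps)
          then have "?g x ?t = ennreal ((\<Sum>k\<in>unit_index r. b' j k * unit_basis k (x, s))\<^sup>2)"
            if "s \<in> {0..<1}"
            using sum_spline_basis_eq_unit[OF K j, where t = ?t and b = b and r = r and x = x] mem that by (simp add: b'_def)
          then show "?g x ?t * indicator (?bin j) ?t * indicator S x
              = ennreal ((\<Sum>k\<in>unit_index r. b' j k * unit_basis k (x, s))\<^sup>2)
                * indicator {0..<1} s * indicator S x"
            using mem by (cases "s \<in> {0..<1}") (simp_all del: atLeastLessThan_iff of_nat_Suc)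
        qed
        finally show ?thesis by simp
      qed
      have "ennreal (c / real K * ((\<Sum>i\<in>UNIV. (b (Inl i))\<^sup>2) + real K * (\<Sum>m<r. (b (Inr (j, m)))\<^sup>2)))
          = ennreal (1 / real K) * ennreal (c * (\<Sum>k\<in>unit_index r. (b' j k)\<^sup>2))"
        using c by (subst ennreal_mult[symmetric])
          (auto simp: sum_unit_index b'_def power_mult_distrib sum_distrib_left intro!: mult_nonneg_nonneg add_nonneg_nonneg sum_nonneg)
      also have "\<dots> \<le> ennreal (1 / real K) * unit_energy S r (b' j)"
        by (intro mult_left_mono le) auto
      also have "\<dots> = (\<integral>\<^sup>+ x. ennreal (1 / real K) * (\<integral>\<^sup>+ s. ennreal ((\<Sum>k\<in>unit_index r. b' j k * unit_basis k (x, s))\<^sup>2)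
        * indicator {0..<1} s * indicator S x \<partial>lborel) \<partial>lborel)"
      proof -
        have [measurable]: "unit_basis k \<in> borel_measurable (borel \<Otimes>\<^sub>M borel)" for k :: "'q + nat"
          by (simp add: borel_prod)
        show ?thesis by (rule nn_integral_cmult[symmetric]) measurable
      qed
      also have "\<dots> = (\<integral>\<^sup>+ x. \<integral>\<^sup>+ t. ?g x t * indicator (?bin j) t * indicator S x \<partial>lborel \<partial>lborel)"
        by (simp only: sub)
      finally show ?thesis .
    qed
    have "c * (\<Sum>k\<in>basis_index r K. (b k)\<^sup>2)
        = (\<Sum>j<K. c / real K * ((\<Sum>i\<in>UNIV. (b (Inl i))\<^sup>2) + real K * (\<Sum>m<r. (b (Inr (j, m)))\<^sup>2)))"
      using K by (simp add: sum_basis_index sum.distrib sum_distrib_left[symmetric] distrib_left)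
    also have "ennreal \<dots> = (\<Sum>j<K. ennreal (c / real K * ((\<Sum>i\<in>UNIV. (b (Inl i))\<^sup>2) + real K * (\<Sum>m<r. (b (Inr (j, m)))\<^sup>2))))"
      using c by (intro sum_ennreal[symmetric] mult_nonneg_nonneg add_nonneg_nonneg sum_nonneg) auto
    also have "\<dots> \<le> (\<Sum>j<K. \<integral>\<^sup>+ x. \<integral>\<^sup>+ t. ?g x t * indicator (?bin j) t * indicator S x \<partial>lborel \<partial>lborel)"
      by (intro sum_mono bin) auto
    also have "\<dots> = (\<integral>\<^sup>+ x. \<integral>\<^sup>+ t. (\<Sum>j<K. ?g x t * indicator (?bin j) t * indicator S x) \<partial>lborel \<partial>lborel)"
      by (subst nn_integral_sum[symmetric], measurable, subst nn_integral_sum, measurable)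
    also have "\<dots> \<le> (\<integral>\<^sup>+ x. \<integral>\<^sup>+ t. ?g x t * indicator {0..1} t * indicator S x \<partial>lborel \<partial>lborel)"
    proof (intro nn_integral_mono)
      fix x t
      have "(\<Sum>j<K. indicator (?bin j) t) = (indicator (\<Union>j<K. ?bin j) t :: ennreal)"
      proof (intro indicator_UN_disjoint[symmetric])
        show "disjoint_family_on ?bin {..<K}"
          unfolding disjoint_family_on_def using bins_disjoint[OF K] by blast
      qed simp
      moreover have "(\<Union>j<K. ?bin j) \<subseteq> {0..1}"
      proof
        fix t assume "t \<in> (\<Union>j<K. ?bin j)"
        then obtain j where j: "j < K" "t \<in> ?bin j" by auto
        then have "real (Suc j) / real K \<le> 1" by (simp add: field_simps)
        moreover have "0 \<le> real j / real K" by simp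
        ultimately show "t \<in> {0..1}" using j(2) unfolding atLeastAtMost_iff atLeastLessThan_iff by linarith
      qed
      ultimately have "(\<Sum>j<K. indicator (?bin j) t) \<le> (indicator {0..1} t :: ennreal)"
        by (metis (no_types, lifting) indicator_leI subsetD)
      then have "?g x t * (\<Sum>j<K. indicator (?bin j) t) * indicator S x \<le> ?g x t * indicator {0..1} t * indicator S x"
        by (intro mult_right_mono mult_left_mono) auto
      then show "(\<Sum>j<K. ?g x t * indicator (?bin j) t * indicator S x) \<le> ?g x t * indicator {0..1} t * indicator S x"
        by (simp only: sum_distrib_left sum_distrib_right)
    qed
    finally show ?thesis .
  qed
  then show thesis using that[OF c] by blast
qed

text \<open>At most one bin contains \<open>t\<close>, and its \<open>r\<close> functions are
  bounded by \<open>sqrt K\<close>. This pointwise bound of order \<open>K\<close> governs both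
  second moment estimates, for the Gram matrix and for the projected noise.\<close>

lemma sum_spline_basis_square_le:
  fixes x :: "real ^ 'q::finite"
  assumes K: "0 < K" and x: "norm x \<le> R" and t: "t \<in> {0..1}"
  shows "(\<Sum>k\<in>basis_index r K. (spline_basis K k (x, t))\<^sup>2) \<le> (R\<^sup>2 + real r) * real K"
proof -
  have "(\<Sum>i<K. \<Sum>m<r. (spline_basis K (Inr (i, m)) (x, t))\<^sup>2) \<le> real r * real K"
  proof -
    have "(\<Sum>i<K. \<Sum>m<r. (spline_basis K (Inr (i, m)) (x, t))\<^sup>2)
        = (\<Sum>i<K. (\<Sum>m<r. real K * ((real K * t - real i) ^ m)\<^sup>2) * indicator (bin K i) t)"
      by (intro sum.cong refl) (auto simp: sum_distrib_right power_mult_distrib indicator_def)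
    also have "\<dots> \<le> real r * real K"
    proof (cases "\<exists>j<K. t \<in> bin K j")
      case True
      then obtain j where j: "j < K" "t \<in> bin K j" by blast
      then have s: "\<bar>real K * t - real j\<bar> \<le> 1" using K by (auto simp: field_simps)
      have "(\<Sum>m<r. real K * ((real K * t - real j) ^ m)\<^sup>2) \<le> (\<Sum>m<r. real K * 1)"
      proof (intro sum_mono mult_left_mono)
        fix m
        have "\<bar>(real K * t - real j) ^ m\<bar> \<le> 1" using s by (simp only: power_abs power_le_one abs_ge_zero)
        then show "((real K * t - real j) ^ m)\<^sup>2 \<le> 1" by (simp only: abs_square_le_1)
      qed simp
      then show ?thesis unfolding sum_bins_single[OF K j] by simp
    next
      \<comment> \<open>This happens at \<open>t = 1\<close>, which no half-open bin
        contains.\<close>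
      case False
      then have "(\<Sum>i<K. (\<Sum>m<r. real K * ((real K * t - real i) ^ m)\<^sup>2) * indicator (bin K i) t) = 0"
        by (intro sum.neutral) (auto simp: indicator_def simp del: of_nat_Suc)
      then show ?thesis by simp
    qed
    finally show ?thesis .
  qed
  moreover have "(\<Sum>i\<in>UNIV. (x $ i)\<^sup>2) \<le> R\<^sup>2"
  proof -
    have "(\<Sum>i\<in>UNIV. (x $ i)\<^sup>2) = (norm x)\<^sup>2"
      by (simp add: norm_vec_def L2_set_def sum_nonneg)
    also have "\<dots> \<le> R\<^sup>2" using x by (intro power_mono) auto
    finally show ?thesis .
  qed
  moreover have "R\<^sup>2 * 1 \<le> R\<^sup>2 * real K" using K by (intro mult_left_mono) auto
  ultimately show ?thesis by (simp add: sum_basis_index distrib_right)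
qed

text \<open>Taylor expansion of each piece about the left end of its bin, in the local coordinate
  \<open>K t - j\<close>. The condition \<open>0 < r\<close> turns degree at most
  \<open>r - 1\<close> into degree less than \<open>r\<close>, which truncated subtraction would
  spoil at \<open>r = 0\<close>.\<close>

lemma spline_basis_representation:
  fixes a :: "'q::finite \<Rightarrow> real"
  assumes v: "v \<in> piecewise_poly_space r K" and r: "0 < r" and K: "0 < K"
  obtains b where "\<And>i. b (Inl i) = a i"
    "\<And>x t. (\<Sum>i\<in>UNIV. a i * x $ i) + v t = (\<Sum>k\<in>basis_index r K. b k * spline_basis K k (x, t))"
proof -
  obtain P where P: "\<And>j. j \<in> {1..K} \<Longrightarrow> degree (P j) \<le> r - 1"
    and vP: "v = (\<lambda>t. \<Sum>j=1..K. poly (P j) t * indicator {(real j - 1) / real K ..< real j / real K} t)"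
    using v unfolding piecewise_poly_space_def by blast
  define Q where "Q j = pcompose (P (Suc j)) [:real j / real K, 1 / real K:]" for j
  have Q: "poly (Q j) (real K * t - real j) = poly (P (Suc j)) t" for j t
    using K by (simp add: Q_def poly_pcompose field_simps)
  have degQ: "degree (Q j) < r" if "j < K" for j
  proof -
    have "degree (Q j) \<le> degree (P (Suc j))"
      unfolding Q_def degree_pcompose by auto
    then show ?thesis using P[of "Suc j"] that r by auto
  qed
  define b where "b k = (case k of Inl i \<Rightarrow> a i | Inr (j, m) \<Rightarrow> coeff (Q j) m / sqrt (real K))"
    for k :: "'q + nat \<times> nat"
  have "v t = (\<Sum>j<K. \<Sum>m<r. b (Inr (j, m)) * spline_basis K (Inr (j, m)) (x, t))" for x t
  proof -
    have "v t = (\<Sum>j<K. poly (P (Suc j)) t * indicator (bin K j) t)"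
      unfolding vP by (rule sum.reindex_bij_witness[of _ Suc "\<lambda>j. j - 1"]) auto
    also have "\<dots> = (\<Sum>j<K. \<Sum>m<r. b (Inr (j, m)) * spline_basis K (Inr (j, m)) (x, t))"
    proof (intro sum.cong refl)
      fix j assume "j \<in> {..<K}"
      then have "poly (P (Suc j)) t = (\<Sum>m<r. coeff (Q j) m * (real K * t - real j) ^ m)"
        unfolding Q[symmetric] unfolding poly_altdef using degQ[of j]
        by (intro sum.mono_neutral_left) (auto simp: coeff_eq_0)
      then show "poly (P (Suc j)) t * indicator (bin K j) t
          = (\<Sum>m<r. b (Inr (j, m)) * spline_basis K (Inr (j, m)) (x, t))"
        using K unfolding \<open>poly (P (Suc j)) t = _\<close> sum_distrib_right
        by (intro sum.cong refl) (simp add: b_def del: of_nat_Suc)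
    qed
    finally show ?thesis .
  qed
  then show thesis
    by (intro that[of b]) (auto simp: b_def sum_basis_index)
qed

section \<open>Moments under the regression model\<close>

context regression_model
begin

section \<open>Transfer between observations, and means of i.i.d. samples\<close>

abbreviation Z :: "nat \<Rightarrow> 'w \<Rightarrow> (real ^ 'q) \<times> real" where
  "Z i \<omega> \<equiv> (X i \<omega>, T i \<omega>)"

definition obs :: "nat \<Rightarrow> 'w \<Rightarrow> ((real ^ 'q) \<times> real) \<times> real" where
  "obs i \<omega> = (Z i \<omega>, W i \<omega>)"

text \<open>Measurability of the data is contained in \<open>indep_vars\<close>; the components
  follow by projection.\<close>

lemma obs_measurable [measurable]: "obs i \<in> borel_measurable M"
  using indep_over_sample unfolding indep_vars_def obs_def by auto

lemma design_measurable [measurable]: "(\<lambda>\<omega>. Z i \<omega>) \<in> borel_measurable M"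
  using measurable_compose[OF obs_measurable[of i] borel_measurable_continuous_onI[OF continuous_on_fst[OF continuous_on_id]]]
  by (auto simp: obs_def intro: continuous_intros)

lemma noise_measurable [measurable]: "W i \<in> borel_measurable M"
  using measurable_compose[OF obs_measurable[of i] borel_measurable_continuous_onI[OF continuous_on_snd[OF continuous_on_id]]]
  by (auto simp: obs_def intro: continuous_intros)

lemma T_measurable [measurable]: "T i \<in> borel_measurable M"
  using measurable_compose[OF design_measurable[of i] borel_measurable_continuous_onI[OF continuous_on_snd[OF continuous_on_id]]]
  by (auto intro: continuous_intros)

lemma distr_obs: "distr M borel (obs i) = distr M borel (obs 0)"
  using identically_distributed[of i] by (simp add: obs_def[abs_def])

lemma nn_integral_obs:
  assumes "g \<in> borel_measurable borel"
  shows "(\<integral>\<^sup>+ \<omega>. g (obs i \<omega>) \<partial>M) = (\<integral>\<^sup>+ \<omega>. g (obs 0 \<omega>) \<partial>M)"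
  using nn_integral_distr[of "obs i" M borel g] nn_integral_distr[of "obs 0" M borel g] assms
  by (simp add: distr_obs[of i])

lemma integrable_obs:
  fixes g :: "_ \<Rightarrow> real"
  assumes "g \<in> borel_measurable borel"
  shows "integrable M (\<lambda>\<omega>. g (obs i \<omega>)) \<longleftrightarrow> integrable M (\<lambda>\<omega>. g (obs 0 \<omega>))"
  using integrable_distr_eq[of "obs i" M borel g] integrable_distr_eq[of "obs 0" M borel g] assms
  by (simp add: distr_obs[of i])

lemma expectation_obs:
  fixes g :: "_ \<Rightarrow> real"
  assumes "g \<in> borel_measurable borel"
  shows "expectation (\<lambda>\<omega>. g (obs i \<omega>)) = expectation (\<lambda>\<omega>. g (obs 0 \<omega>))"
  using integral_distr[of "obs i" M borel g] integral_distr[of "obs 0" M borel g] assms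
  by (simp add: distr_obs[of i])

lemma indep_vars_obs: "indep_vars (\<lambda>_. borel) obs UNIV"
  using indep_over_sample by (simp add: obs_def[abs_def])

text \<open>Independence removes the cross terms of the centred sum, which leaves the variance over
  \<open>n\<close>. Bounding it by the second moment allows the sum over the basis to be taken under
  the expectation, where a pointwise bound is at hand.\<close>

lemma iid_mean_square:
  fixes g :: "_ \<Rightarrow> real"
  assumes g [measurable]: "g \<in> borel_measurable borel"
    and sq: "integrable M (\<lambda>\<omega>. (g (obs 0 \<omega>))\<^sup>2)" and n: "0 < n"
  defines "\<mu> \<equiv> expectation (\<lambda>\<omega>. g (obs 0 \<omega>))"
  shows "integrable M (\<lambda>\<omega>. ((1 / real n) * (\<Sum>i<n. g (obs i \<omega>)) - \<mu>)\<^sup>2)" (is ?int)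
    and "expectation (\<lambda>\<omega>. ((1 / real n) * (\<Sum>i<n. g (obs i \<omega>)) - \<mu>)\<^sup>2)
      \<le> expectation (\<lambda>\<omega>. (g (obs 0 \<omega>))\<^sup>2) / real n" (is ?le)
proof -
  define \<xi> where "\<xi> i \<omega> = g (obs i \<omega>) - \<mu>" for i \<omega>
  have [measurable]: "\<xi> i \<in> borel_measurable M" for i unfolding \<xi>_def by measurable
  have ig0: "integrable M (\<lambda>\<omega>. g (obs 0 \<omega>))"
    by (rule square_integrable_imp_integrable[OF _ sq]) measurable
  have ig: "integrable M (\<lambda>\<omega>. g (obs i \<omega>))" for i
    using ig0 integrable_obs[OF g, of i] by simp
  have sqi: "integrable M (\<lambda>\<omega>. (g (obs i \<omega>))\<^sup>2)" for i
    using sq integrable_obs[of "\<lambda>z. (g z)\<^sup>2" i] by simp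
  have i\<xi>: "integrable M (\<xi> i)" for i
    unfolding \<xi>_def using ig by auto
  have E\<xi>: "expectation (\<xi> i) = 0" for i
    unfolding \<xi>_def using ig[of i] expectation_obs[OF g, of i] by (simp add: \<mu>_def prob_space)
  have \<xi>2: "(\<xi> i \<omega>)\<^sup>2 = (g (obs i \<omega>))\<^sup>2 - 2 * \<mu> * g (obs i \<omega>) + \<mu>\<^sup>2" for i \<omega>
    by (simp add: \<xi>_def power2_diff)
  have i\<xi>2: "integrable M (\<lambda>\<omega>. (\<xi> i \<omega>)\<^sup>2)" for i
    unfolding \<xi>2 using ig[of i] sqi[of i] by auto
  have E\<xi>2: "expectation (\<lambda>\<omega>. (\<xi> i \<omega>)\<^sup>2) \<le> expectation (\<lambda>\<omega>. (g (obs 0 \<omega>))\<^sup>2)" for i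
  proof -
    have "expectation (\<lambda>\<omega>. (\<xi> i \<omega>)\<^sup>2) = expectation (\<lambda>\<omega>. (g (obs i \<omega>))\<^sup>2) - 2 * \<mu> * expectation (\<lambda>\<omega>. g (obs i \<omega>)) + \<mu>\<^sup>2"
      unfolding \<xi>2 using ig[of i] sqi[of i] by (simp add: prob_space)
    also have "\<dots> = expectation (\<lambda>\<omega>. (g (obs 0 \<omega>))\<^sup>2) - \<mu>\<^sup>2"
      using expectation_obs[OF g, of i] expectation_obs[of "\<lambda>z. (g z)\<^sup>2" i]
      by (simp add: \<mu>_def power2_eq_square)
    finally show ?thesis by simp
  qed
  have "indep_vars (\<lambda>_. borel) \<xi> UNIV"
    unfolding \<xi>_def by (rule indep_vars_compose2[OF indep_vars_obs]) measurable
  then have ind: "indep_vars (\<lambda>_. borel) \<xi> {i, j}" for i j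
    by (rule indep_vars_subset) auto
  have prod: "integrable M (\<lambda>\<omega>. \<xi> i \<omega> * \<xi> j \<omega>) \<and> (i \<noteq> j \<longrightarrow> expectation (\<lambda>\<omega>. \<xi> i \<omega> * \<xi> j \<omega>) = 0)" for i j
  proof (cases "i = j")
    case True
    then show ?thesis using i\<xi>2[of i] by (simp add: power2_eq_square)
  next
    case False
    have "integrable M (\<lambda>\<omega>. \<Prod>k\<in>{i, j}. \<xi> k \<omega>)"
      by (rule indep_vars_integrable[OF _ ind]) (use i\<xi> in auto)
    moreover have "expectation (\<lambda>\<omega>. \<Prod>k\<in>{i, j}. \<xi> k \<omega>) = (\<Prod>k\<in>{i, j}. expectation (\<xi> k))"
      by (rule indep_vars_lebesgue_integral[OF _ ind]) (use i\<xi> in auto)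
    ultimately show ?thesis using False E\<xi> by simp
  qed
  have eq: "((1 / real n) * (\<Sum>i<n. g (obs i \<omega>)) - \<mu>)\<^sup>2 = (1 / real n)\<^sup>2 * (\<Sum>i<n. \<Sum>j<n. \<xi> i \<omega> * \<xi> j \<omega>)" for \<omega>
  proof -
    have "(1 / real n) * (\<Sum>i<n. g (obs i \<omega>)) - \<mu> = (1 / real n) * (\<Sum>i<n. \<xi> i \<omega>)"
      using n by (simp add: \<xi>_def sum_subtractf field_simps)
    then show ?thesis by (simp add: power_mult_distrib power2_eq_square sum_product)
  qed
  show ?int unfolding eq using prod by (intro integrable_mult_right Bochner_Integration.integrable_sum) auto
  have "expectation (\<lambda>\<omega>. ((1 / real n) * (\<Sum>i<n. g (obs i \<omega>)) - \<mu>)\<^sup>2)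
      = (1 / real n)\<^sup>2 * (\<Sum>i<n. \<Sum>j<n. expectation (\<lambda>\<omega>. \<xi> i \<omega> * \<xi> j \<omega>))"
    unfolding eq using prod
    by (subst integral_mult_right_zero, subst Bochner_Integration.integral_sum)
       (auto intro!: Bochner_Integration.integrable_sum sum.cong Bochner_Integration.integral_sum)
  also have "(\<Sum>i<n. \<Sum>j<n. expectation (\<lambda>\<omega>. \<xi> i \<omega> * \<xi> j \<omega>)) = (\<Sum>i<n. expectation (\<lambda>\<omega>. (\<xi> i \<omega>)\<^sup>2))"
  proof (intro sum.cong refl)
    fix i assume "i \<in> {..<n}"
    then show "(\<Sum>j<n. expectation (\<lambda>\<omega>. \<xi> i \<omega> * \<xi> j \<omega>)) = expectation (\<lambda>\<omega>. (\<xi> i \<omega>)\<^sup>2)"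
      using prod[of i] by (subst sum.remove[of _ i]) (auto simp: power2_eq_square intro!: sum.neutral)
  qed
  also have "(1 / real n)\<^sup>2 * \<dots> \<le> (1 / real n)\<^sup>2 * (\<Sum>i<n. expectation (\<lambda>\<omega>. (g (obs 0 \<omega>))\<^sup>2))"
    by (intro mult_left_mono sum_mono E\<xi>2) auto
  also have "\<dots> = expectation (\<lambda>\<omega>. (g (obs 0 \<omega>))\<^sup>2) / real n"
    using n by (simp add: power2_eq_square)
  finally show ?le .
qed

text \<open>The model states independence of noise and design through preimage families, since their
  types differ. Composing the design with the real function \<open>g\<close> yields a subfamily and
  hence an \<open>indep_var\<close> statement, to which the product rule applies.\<close>

lemma expectation_noise_times:
  assumes g [measurable]: "g \<in> borel_measurable borel"
    and int: "integrable M (\<lambda>\<omega>. g (Z 0 \<omega>))"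
  shows "expectation (\<lambda>\<omega>. W 0 \<omega> * g (Z 0 \<omega>)) = 0"
proof -
  let ?Y = "\<lambda>\<omega>. g (Z 0 \<omega>)"
  have m [measurable]: "?Y \<in> borel_measurable M"
    using measurable_compose[OF design_measurable g] by simp
  have "indep_sets (\<lambda>b. {case_bool ?Y (W 0) b -` A \<inter> space M | A. A \<in> sets (case_bool borel borel b)}) UNIV"
  proof (rule indep_sets_mono_sets)
    show "indep_sets (case_bool {(\<lambda>\<omega>. Z 0 \<omega>) -` A \<inter> space M | A. A \<in> sets borel}
                 {W 0 -` B \<inter> space M | B. B \<in> sets borel}) UNIV"
      using noise_indep_design[of 0] by (simp add: indep_set_def)
  next
    fix b :: bool
    have "?Y -` A \<inter> space M \<in> {(\<lambda>\<omega>. Z 0 \<omega>) -` A \<inter> space M | A. A \<in> sets borel}"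
      if "A \<in> sets borel" for A
      using measurable_sets[OF g that] by (auto intro!: exI[of _ "g -` A"])
    then show "{case_bool ?Y (W 0) b -` A \<inter> space M | A. A \<in> sets (case_bool borel borel b)}
      \<subseteq> case_bool {(\<lambda>\<omega>. Z 0 \<omega>) -` A \<inter> space M | A. A \<in> sets borel}
                 {W 0 -` B \<inter> space M | B. B \<in> sets borel} b"
      by (cases b) auto
  qed
  then have "indep_var borel ?Y borel (W 0)"
    unfolding indep_var_def indep_vars_def2 by (auto split: bool.split)
  from indep_var_lebesgue_integral[OF this int noise_integrable]
  show ?thesis using noise_mean_zero[of 0] by (simp add: mult.commute)
qed

section \<open>Comparison of the design with Lebesgue measure\<close>

lemma design_density_bounds:
  assumes "assumption_A1 M X T \<K>"
  obtains h0 h1 where "0 < h0" "0 < h1" "compact \<K>" "emeasure lborel \<K> \<noteq> 0"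
    "\<And>g. g \<in> borel_measurable borel \<Longrightarrow>
      ennreal h0 * slab_integral \<K> g
        \<le> (\<integral>\<^sup>+ \<omega>. g (Z 0 \<omega>) \<partial>M)"
    "\<And>g. g \<in> borel_measurable borel \<Longrightarrow>
      (\<integral>\<^sup>+ \<omega>. g (Z 0 \<omega>) \<partial>M)
        \<le> ennreal h1 * slab_integral \<K> g"
proof -
  obtain h0 h1 p where \<K>: "compact \<K>" and h0: "0 < h0" and p [measurable]: "p \<in> borel_measurable borel"
    and pb: "\<And>z. z \<in> \<K> \<times> {0..1} \<Longrightarrow> h0 \<le> p z \<and> p z \<le> h1"
    and law: "law_XT M X T = density lborel (\<lambda>z. ennreal (p z) * indicator (\<K> \<times> {0..1}) z)"
    using assms unfolding assumption_A1_def by blast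
  have KE [measurable]: "\<K> \<times> {0..1::real} \<in> sets borel"
    using \<K> by (intro borel_compact compact_Times) auto
  have Kb [measurable]: "\<K> \<in> sets borel" using \<K> by (rule borel_compact)
  \<comment> \<open>The maximum makes the upper bound positive before \<open>\<K>\<close> is known
    to be nonempty.\<close>
  define h where "h = max h1 1"
  have eq: "(\<integral>\<^sup>+ \<omega>. g (Z 0 \<omega>) \<partial>M) = (\<integral>\<^sup>+ z. (ennreal (p z) * indicator (\<K> \<times> {0..1}) z) * g z \<partial>lborel)"
    if [measurable]: "g \<in> borel_measurable borel" for g
  proof -
    have "(\<integral>\<^sup>+ \<omega>. g (Z 0 \<omega>) \<partial>M) = (\<integral>\<^sup>+ z. g z \<partial>law_XT M X T)"
      unfolding law_XT_def by (rule nn_integral_distr[symmetric]) measurable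
    also have "\<dots> = (\<integral>\<^sup>+ z. (ennreal (p z) * indicator (\<K> \<times> {0..1}) z) * g z \<partial>lborel)"
      unfolding law by (rule nn_integral_density) measurable
    finally show ?thesis .
  qed
  have fub: "slab_integral \<K> g
      = (\<integral>\<^sup>+ z. g z * indicator (\<K> \<times> {0..1}) z \<partial>lborel)" if [measurable]: "g \<in> borel_measurable borel" for g
  proof -
    have "(\<lambda>z. g z * indicator (\<K> \<times> {0..1}) z) \<in> borel_measurable borel"
      using KE by (intro borel_measurable_times_ennreal that) (simp add: borel_measurable_indicator_iff)
    then have "(\<lambda>z. g z * indicator (\<K> \<times> {0..1}) z) \<in> borel_measurable (lborel \<Otimes>\<^sub>M lborel)"
      by (simp add: lborel_prod)
    from lborel.nn_integral_fst[OF this]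
    have "(\<integral>\<^sup>+ x. \<integral>\<^sup>+ t. g (x, t) * indicator (\<K> \<times> {0..1}) (x, t) \<partial>lborel \<partial>lborel)
      = (\<integral>\<^sup>+ z. g z * indicator (\<K> \<times> {0..1}) z \<partial>lborel)" by (simp add: lborel_prod)
    then show ?thesis by (simp add: indicator_times mult_ac)
  qed
  have lower: "ennreal h0 * slab_integral \<K> g
        \<le> (\<integral>\<^sup>+ \<omega>. g (Z 0 \<omega>) \<partial>M)" if [measurable]: "g \<in> borel_measurable borel" for g
  proof -
    have "ennreal h0 * (g z * indicator (\<K> \<times> {0..1}) z) \<le> (ennreal (p z) * indicator (\<K> \<times> {0..1}) z) * g z" for z
      using pb[of z] by (cases "z \<in> \<K> \<times> {0..1}") (auto intro!: mult_right_mono ennreal_leI)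
    then show ?thesis
      unfolding eq[OF that] fub[OF that]
      by (subst nn_integral_cmult[symmetric]) (measurable, intro nn_integral_mono)
  qed
  have upper: "(\<integral>\<^sup>+ \<omega>. g (Z 0 \<omega>) \<partial>M)
        \<le> ennreal h * slab_integral \<K> g"
    if [measurable]: "g \<in> borel_measurable borel" for g
  proof -
    have "(ennreal (p z) * indicator (\<K> \<times> {0..1}) z) * g z \<le> ennreal h * (g z * indicator (\<K> \<times> {0..1}) z)" for z
      using pb[of z] by (cases "z \<in> \<K> \<times> {0..1}") (auto intro!: mult_right_mono ennreal_leI simp: h_def)
    then show ?thesis
      unfolding eq[OF that] fub[OF that]
      by (subst nn_integral_cmult[symmetric]) (measurable, intro nn_integral_mono)
  qed
  \<comment> \<open>If \<open>\<K>\<close> were null, the upper bound for the constant function 1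
    would give the space total mass 0.\<close>
  have "emeasure lborel \<K> \<noteq> 0"
  proof
    assume 0: "emeasure lborel \<K> = 0"
    have "(1 :: ennreal) = (\<integral>\<^sup>+ \<omega>. 1 \<partial>M)" by (simp add: emeasure_space_1)
    also have "\<dots> \<le> ennreal h * (\<integral>\<^sup>+ x. \<integral>\<^sup>+ t. 1 * indicator {0..1::real} t * indicator \<K> x \<partial>lborel \<partial>lborel)"
      using upper[of "\<lambda>_. 1"] by simp
    also have "\<dots> = 0" using 0 by (simp add: nn_integral_multc)
    finally show False by simp
  qed
  moreover have "0 < h" by (simp add: h_def)
  ultimately show thesis using that[of h0 h] h0 \<K> lower upper by blast
qed

text \<open>The upper bound applied to the indicator of the complement, whose slab integral is 0;
  identical distribution carries the result from observation 0 to \<open>i\<close>.\<close>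

lemma design_in_support:
  assumes "assumption_A1 M X T \<K>"
  shows "AE \<omega> in M. X i \<omega> \<in> \<K> \<and> T i \<omega> \<in> {0..1}"
proof -
  obtain h0 h1 where \<K>: "compact \<K>" and upper: "\<And>g. g \<in> borel_measurable borel \<Longrightarrow>
      (\<integral>\<^sup>+ \<omega>. g (Z 0 \<omega>) \<partial>M)
        \<le> ennreal h1 * slab_integral \<K> g"
    by (rule design_density_bounds[OF assms], rule that, assumption+)
  have m: "\<K> \<times> {0..1::real} \<in> sets borel"
    using \<K> by (intro borel_compact compact_Times) auto
  have m1 [measurable]: "(\<lambda>z. indicator (- (\<K> \<times> {0..1::real})) z :: ennreal) \<in> borel_measurable borel"
    using borel_comp[OF m] by (simp add: borel_measurable_indicator_iff)
  have m2 [measurable]: "(\<lambda>z. indicator (- (\<K> \<times> {0..1})) (fst z) :: ennreal) \<in> borel_measurable (borel :: (((real ^ 'q) \<times> real) \<times> real) measure)"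
    using measurable_compose[OF borel_measurable_continuous_onI[OF continuous_on_fst[OF continuous_on_id]] m1] by (auto intro: continuous_intros)
  have "(\<integral>\<^sup>+ \<omega>. indicator (- (\<K> \<times> {0..1})) (Z i \<omega>) \<partial>M)
      = (\<integral>\<^sup>+ \<omega>. indicator (- (\<K> \<times> {0..1})) (Z 0 \<omega>) \<partial>M)"
    using nn_integral_obs[OF m2, of i] by (simp add: obs_def)
  also have "\<dots> \<le> ennreal h1 * (\<integral>\<^sup>+ x. \<integral>\<^sup>+ t. indicator (- (\<K> \<times> {0..1})) (x, t) * indicator {0..1::real} t * indicator \<K> x \<partial>lborel \<partial>lborel)"
    by (rule upper[OF m1])
  also have "(\<integral>\<^sup>+ x. \<integral>\<^sup>+ t. indicator (- (\<K> \<times> {0..1})) (x, t) * indicator {0..1::real} t * indicator \<K> x \<partial>lborel \<partial>lborel) = (0 :: ennreal)"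
  proof -
    have "indicator (- (\<K> \<times> {0..1})) (x, t) * indicator {0..1::real} t * indicator \<K> x = (0 :: ennreal)" for x t
      by (cases "x \<in> \<K>"; cases "t \<in> {0..1}") simp_all
    then show ?thesis by (simp only: nn_integral_const mult_zero_left)
  qed
  finally have "(\<integral>\<^sup>+ \<omega>. indicator (- (\<K> \<times> {0..1})) (Z i \<omega>) \<partial>M) = 0" by simp
  then have "AE \<omega> in M. indicator (- (\<K> \<times> {0..1})) (Z i \<omega>) = (0 :: ennreal)"
    using measurable_compose[OF design_measurable m1] by (subst (asm) nn_integral_0_iff_AE) simp_all
  then show ?thesis
  proof eventually_elim
    fix \<omega> assume "indicator (- (\<K> \<times> {0..1})) (Z i \<omega>) = (0 :: ennreal)"
    then have "Z i \<omega> \<in> \<K> \<times> {0..1}" by (simp add: indicator_eq_0_iff)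
    then show "X i \<omega> \<in> \<K> \<and> T i \<omega> \<in> {0..1}" by simp
  qed
qed

text \<open>Integrating out \<open>x\<close> multiplies the two density bounds by the volume of
  \<open>\<K>\<close>, which is positive and finite.\<close>

lemma law_T_bounds:
  assumes "assumption_A1 M X T \<K>"
  obtains c0 c1 where "0 < c0" "0 < c1"
    "\<And>g. g \<in> borel_measurable borel \<Longrightarrow>
      ennreal c0 * (\<integral>\<^sup>+ t. g t * indicator {0..1} t \<partial>lborel) \<le> (\<integral>\<^sup>+ t. g t * indicator {0..1} t \<partial>law_T M T)"
    "\<And>g. g \<in> borel_measurable borel \<Longrightarrow>
      (\<integral>\<^sup>+ \<omega>. g (T 0 \<omega>) \<partial>M) \<le> ennreal c1 * (\<integral>\<^sup>+ t. g t * indicator {0..1} t \<partial>lborel)"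
proof -
  obtain h0 h1 where h: "0 < h0" "0 < h1" and \<K>: "compact \<K>" "emeasure lborel \<K> \<noteq> 0"
    and lower: "\<And>g. g \<in> borel_measurable borel \<Longrightarrow>
      ennreal h0 * slab_integral \<K> g
        \<le> (\<integral>\<^sup>+ \<omega>. g (Z 0 \<omega>) \<partial>M)"
    and upper: "\<And>g. g \<in> borel_measurable borel \<Longrightarrow>
      (\<integral>\<^sup>+ \<omega>. g (Z 0 \<omega>) \<partial>M)
        \<le> ennreal h1 * slab_integral \<K> g"
    by (rule design_density_bounds[OF assms], rule that, assumption+)
  have Kb [measurable]: "\<K> \<in> sets borel" using \<K>(1) by (rule borel_compact)
  define v where "v = measure lborel \<K>"
  have fin: "emeasure lborel \<K> < \<infinity>" using \<K>(1) by (rule emeasure_compact_finite)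
  then have ev: "emeasure lborel \<K> = ennreal v"
    unfolding v_def by (intro emeasure_eq_ennreal_measure) auto
  then have v: "0 < v" using \<K>(2) by (metis ennreal_eq_0_iff not_le)
  have prod: "(\<integral>\<^sup>+ x. \<integral>\<^sup>+ t. g (snd (x, t)) * indicator {0..1} t * indicator \<K> x \<partial>lborel \<partial>lborel)
      = ennreal v * (\<integral>\<^sup>+ t. g t * indicator {0..1} t \<partial>lborel)"
    if [measurable]: "g \<in> borel_measurable borel" for g :: "real \<Rightarrow> ennreal"
    by (simp add: nn_integral_multc nn_integral_cmult ev mult.commute)
  have ms: "(\<lambda>z :: (real ^ 'q) \<times> real. g (snd z)) \<in> borel_measurable borel"
    if "g \<in> borel_measurable borel" for g :: "real \<Rightarrow> ennreal"
    using measurable_compose[OF borel_measurable_continuous_onI[OF continuous_on_snd[OF continuous_on_id]] that] by (auto intro: continuous_intros)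
  have "ennreal (h0 * v) * (\<integral>\<^sup>+ t. g t * indicator {0..1} t \<partial>lborel) \<le> (\<integral>\<^sup>+ t. g t * indicator {0..1} t \<partial>law_T M T)"
    if [measurable]: "g \<in> borel_measurable borel" for g :: "real \<Rightarrow> ennreal"
  proof -
    have m: "(\<lambda>t. g t * indicator {0..1} t) \<in> borel_measurable borel" by measurable
    have "ennreal (h0 * v) * (\<integral>\<^sup>+ t. g t * indicator {0..1} t \<partial>lborel)
        = ennreal h0 * (ennreal v * (\<integral>\<^sup>+ t. (g t * indicator {0..1} t) * indicator {0..1} t \<partial>lborel))"
      using h v by (simp add: ennreal_mult mult.assoc indicator_inter_arith[symmetric])
    also have "\<dots> \<le> (\<integral>\<^sup>+ \<omega>. g (T 0 \<omega>) * indicator {0..1} (T 0 \<omega>) \<partial>M)"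
      using lower[OF ms[OF m]] unfolding prod[OF m] by simp
    also have "\<dots> = (\<integral>\<^sup>+ t. g t * indicator {0..1} t \<partial>law_T M T)"
      unfolding law_T_def by (rule nn_integral_distr[symmetric]) measurable
    finally show ?thesis .
  qed
  moreover have "(\<integral>\<^sup>+ \<omega>. g (T 0 \<omega>) \<partial>M) \<le> ennreal (h1 * v) * (\<integral>\<^sup>+ t. g t * indicator {0..1} t \<partial>lborel)"
    if "g \<in> borel_measurable borel" for g :: "real \<Rightarrow> ennreal"
    using upper[OF ms[OF that]] h v unfolding prod[OF that] by (simp add: ennreal_mult mult.assoc)
  ultimately show thesis using that[of "h0 * v" "h1 * v"] h v by auto
qed

lemma noise_square_integrable:
  assumes "assumption_A2 M W"
  shows "integrable M (\<lambda>\<omega>. (W 0 \<omega>)\<^sup>2)"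
proof -
  obtain d p where p: "0 < d" "4 + d < p" "integrable M (\<lambda>\<omega>. \<bar>W 0 \<omega>\<bar> powr p)"
    using assms by (auto simp: assumption_A2_def)
  show ?thesis
  proof (rule Bochner_Integration.integrable_bound)
    show "integrable M (\<lambda>\<omega>. 1 + \<bar>W 0 \<omega>\<bar> powr p)" using p by auto
    show "AE \<omega> in M. norm ((W 0 \<omega>)\<^sup>2) \<le> norm (1 + \<bar>W 0 \<omega>\<bar> powr p)"
    proof (intro AE_I2)
      fix \<omega>
      show "norm ((W 0 \<omega>)\<^sup>2) \<le> norm (1 + \<bar>W 0 \<omega>\<bar> powr p)"
      proof (cases "\<bar>W 0 \<omega>\<bar> \<le> 1")
        case True
        then have "(W 0 \<omega>)\<^sup>2 \<le> 1" by (simp add: abs_square_le_1)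
        then have "(W 0 \<omega>)\<^sup>2 \<le> 1 + \<bar>W 0 \<omega>\<bar> powr p" by (rule add_increasing2[OF powr_ge_zero])
        then show ?thesis by simp
      next
        case False
        have "(W 0 \<omega>)\<^sup>2 = \<bar>W 0 \<omega>\<bar> powr 2" using False by simp
        also have "\<dots> \<le> \<bar>W 0 \<omega>\<bar> powr p" using False p by (intro powr_mono) auto
        finally show ?thesis by simp
      qed
    qed
  qed measurable
qed

end

section \<open>Lower bound for the empirical contrast\<close>

text \<open>The deterministic core: \<open>e\<close> is the noise, \<open>g\<close> the spline bias,
  and \<open>h\<close>, the combination of the \<open>\<phi> k\<close> with coefficients
  \<open>b\<close>, the deviation of a candidate. Expanding the square leaves the empirical square
  norm of \<open>h\<close>, at least \<open>c / 2 |b|\<^sup>2\<close>, minus two cross terms. Half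
  of that norm absorbs the bias term and \<open>c / 8 |b|\<^sup>2\<close> the noise term; what
  remains is \<open>c / 4 - c / 8 = c / 8\<close>.\<close>

lemma least_squares_lower:
  fixes \<phi> :: "'k \<Rightarrow> nat \<Rightarrow> real" and G :: "'k \<Rightarrow> 'k \<Rightarrow> real" and b :: "'k \<Rightarrow> real" and e g :: "nat \<Rightarrow> real"
  assumes n: "0 < n" and c: "0 < c"
    and coercive: "c * (\<Sum>k\<in>D. (b k)\<^sup>2) \<le> (\<Sum>k\<in>D. \<Sum>l\<in>D. b k * b l * G k l)"
    and gram: "(\<Sum>k\<in>D. \<Sum>l\<in>D. ((1 / real n) * (\<Sum>i<n. \<phi> k i * \<phi> l i) - G k l)\<^sup>2) \<le> (c / 2)\<^sup>2"
  shows "(1 / real n) * (\<Sum>i<n. (e i + g i)\<^sup>2) + c / 8 * (\<Sum>k\<in>D. (b k)\<^sup>2)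
      - 8 / c * (\<Sum>k\<in>D. ((1 / real n) * (\<Sum>i<n. e i * \<phi> k i))\<^sup>2) - 2 * ((1 / real n) * (\<Sum>i<n. (g i)\<^sup>2))
    \<le> (1 / real n) * (\<Sum>i<n. (e i + g i - (\<Sum>k\<in>D. b k * \<phi> k i))\<^sup>2)"
proof -
  define h where "h i = (\<Sum>k\<in>D. b k * \<phi> k i)" for i
  define s where "s = (\<Sum>k\<in>D. (b k)\<^sup>2)"
  define Gn where "Gn k l = (1 / real n) * (\<Sum>i<n. \<phi> k i * \<phi> l i)" for k l
  define en where "en k = (1 / real n) * (\<Sum>i<n. e i * \<phi> k i)" for k
  have s0: "0 \<le> s" unfolding s_def by (intro sum_nonneg) auto
  have h2: "(1 / real n) * (\<Sum>i<n. (h i)\<^sup>2) = (\<Sum>k\<in>D. \<Sum>l\<in>D. b k * b l * Gn k l)"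
  proof -
    have "(\<Sum>i<n. (h i)\<^sup>2) = (\<Sum>i<n. \<Sum>k\<in>D. \<Sum>l\<in>D. b k * b l * (\<phi> k i * \<phi> l i))"
      unfolding h_def power2_eq_square sum_product by (intro sum.cong refl) (simp add: ac_simps)
    also have "\<dots> = (\<Sum>k\<in>D. \<Sum>l\<in>D. \<Sum>i<n. b k * b l * (\<phi> k i * \<phi> l i))"
      by (subst sum.swap) (intro sum.cong refl sum.swap)
    finally show ?thesis
      by (simp add: Gn_def sum_distrib_left ac_simps)
  qed
  have eh: "(1 / real n) * (\<Sum>i<n. e i * h i) = (\<Sum>k\<in>D. b k * en k)"
  proof -
    have "(\<Sum>i<n. e i * h i) = (\<Sum>k\<in>D. \<Sum>i<n. b k * (e i * \<phi> k i))"
      unfolding h_def sum_distrib_left by (subst sum.swap) (simp add: ac_simps)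
    then show ?thesis by (simp add: en_def sum_distrib_left ac_simps)
  qed
  \<comment> \<open>A quadratic form is bounded by the Frobenius norm of its matrix: Cauchy-Schwarz
    over pairs of indices.\<close>
  have "((\<Sum>k\<in>D. \<Sum>l\<in>D. b k * b l * (Gn k l - G k l)))\<^sup>2 \<le> (s * (c / 2))\<^sup>2"
  proof -
    have "((\<Sum>k\<in>D. \<Sum>l\<in>D. b k * b l * (Gn k l - G k l)))\<^sup>2
        = (\<Sum>p\<in>D \<times> D. (b (fst p) * b (snd p)) * (Gn (fst p) (snd p) - G (fst p) (snd p)))\<^sup>2"
      by (simp add: sum.cartesian_product split_beta)
    also have "\<dots> \<le> (\<Sum>p\<in>D \<times> D. (b (fst p) * b (snd p))\<^sup>2) * (\<Sum>p\<in>D \<times> D. (Gn (fst p) (snd p) - G (fst p) (snd p))\<^sup>2)"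
      by (rule Cauchy_Schwarz_ineq_sum)
    also have "(\<Sum>p\<in>D \<times> D. (b (fst p) * b (snd p))\<^sup>2) = s\<^sup>2"
      unfolding s_def power2_eq_square[of "sum _ _"] sum_product
      by (simp add: sum.cartesian_product split_beta power_mult_distrib)
    also have "(\<Sum>p\<in>D \<times> D. (Gn (fst p) (snd p) - G (fst p) (snd p))\<^sup>2)
        = (\<Sum>k\<in>D. \<Sum>l\<in>D. (Gn k l - G k l)\<^sup>2)"
      by (simp add: sum.cartesian_product split_beta)
    also have "s\<^sup>2 * \<dots> \<le> s\<^sup>2 * (c / 2)\<^sup>2"
      using gram by (intro mult_left_mono) (simp_all add: Gn_def)
    finally show ?thesis by (simp only: power_mult_distrib)
  qed
  then have "\<bar>\<Sum>k\<in>D. \<Sum>l\<in>D. b k * b l * (Gn k l - G k l)\<bar> \<le> s * (c / 2)"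
    using s0 c by (simp add: abs_le_square_iff[symmetric])
  moreover have "(\<Sum>k\<in>D. \<Sum>l\<in>D. b k * b l * Gn k l) = (\<Sum>k\<in>D. \<Sum>l\<in>D. b k * b l * G k l)
      + (\<Sum>k\<in>D. \<Sum>l\<in>D. b k * b l * (Gn k l - G k l))"
    by (simp add: sum.distrib[symmetric] algebra_simps)
  ultimately have N: "c / 2 * s \<le> (1 / real n) * (\<Sum>i<n. (h i)\<^sup>2)"
    using coercive unfolding h2 s_def[symmetric] by (simp add: algebra_simps)
  \<comment> \<open>The weights are chosen so that exactly \<open>c / 8\<close> of
    \<open>|b|\<^sup>2\<close> is spent.\<close>
  have amgm: "2 * (x * y) \<le> c / 8 * x\<^sup>2 + 8 / c * y\<^sup>2" for x y
  proof -
    have "0 \<le> (c * x - 8 * y)\<^sup>2 / (8 * c)" using c by simp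
    also have "\<dots> = c / 8 * x\<^sup>2 + 8 / c * y\<^sup>2 - 2 * (x * y)"
      using c by (simp add: power2_eq_square field_simps)
    finally show ?thesis by simp
  qed
  have "(\<Sum>k\<in>D. 2 * (b k * en k)) \<le> (\<Sum>k\<in>D. c / 8 * (b k)\<^sup>2 + 8 / c * (en k)\<^sup>2)"
    by (intro sum_mono amgm)
  then have E: "2 * ((1 / real n) * (\<Sum>i<n. e i * h i)) \<le> c / 8 * s + 8 / c * (\<Sum>k\<in>D. (en k)\<^sup>2)"
    unfolding eh s_def by (simp add: sum_distrib_left sum.distrib)
  have "(\<Sum>i<n. 2 * (g i * h i)) \<le> (\<Sum>i<n. (1 / 2) * (h i)\<^sup>2 + 2 * (g i)\<^sup>2)"
  proof (intro sum_mono)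
    fix i
    have "0 \<le> (h i - 2 * g i)\<^sup>2 / 2" by simp
    then show "2 * (g i * h i) \<le> (1 / 2) * (h i)\<^sup>2 + 2 * (g i)\<^sup>2"
      by (simp add: power2_eq_square algebra_simps)
  qed
  then have "(1 / real n) * (\<Sum>i<n. 2 * (g i * h i)) \<le> (1 / real n) * (\<Sum>i<n. (1 / 2) * (h i)\<^sup>2 + 2 * (g i)\<^sup>2)"
    by (intro mult_left_mono) auto
  moreover have "(\<Sum>i<n. 2 * (g i * h i)) = 2 * (\<Sum>i<n. g i * h i)"
    "(\<Sum>i<n. (1 / 2) * (h i)\<^sup>2 + 2 * (g i)\<^sup>2) = (1 / 2) * (\<Sum>i<n. (h i)\<^sup>2) + 2 * (\<Sum>i<n. (g i)\<^sup>2)"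
    by (simp_all only: sum_distrib_left sum.distrib)
  ultimately have F: "2 * ((1 / real n) * (\<Sum>i<n. g i * h i))
      \<le> 1 / 2 * ((1 / real n) * (\<Sum>i<n. (h i)\<^sup>2)) + 2 * ((1 / real n) * (\<Sum>i<n. (g i)\<^sup>2))"
    by (simp only: distrib_left mult.assoc mult.left_commute)
  have "(\<Sum>i<n. (e i + g i - h i)\<^sup>2)
      = (\<Sum>i<n. (e i + g i)\<^sup>2) + (\<Sum>i<n. (h i)\<^sup>2) - 2 * (\<Sum>i<n. e i * h i) - 2 * (\<Sum>i<n. g i * h i)"
    by (simp add: sum_distrib_left sum.distrib[symmetric] sum_subtractf[symmetric] power2_eq_square algebra_simps)
  then have "(1 / real n) * (\<Sum>i<n. (e i + g i - h i)\<^sup>2)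
      = (1 / real n) * (\<Sum>i<n. (e i + g i)\<^sup>2) + (1 / real n) * (\<Sum>i<n. (h i)\<^sup>2)
        - 2 * ((1 / real n) * (\<Sum>i<n. e i * h i)) - 2 * ((1 / real n) * (\<Sum>i<n. g i * h i))"
    by (simp only: distrib_left right_diff_distrib mult.left_commute)
  then have "(1 / real n) * (\<Sum>i<n. (e i + g i)\<^sup>2) + c / 8 * s
      - 8 / c * (\<Sum>k\<in>D. (en k)\<^sup>2) - 2 * ((1 / real n) * (\<Sum>i<n. (g i)\<^sup>2))
    \<le> (1 / real n) * (\<Sum>i<n. (e i + g i - h i)\<^sup>2)"
    using N E F by linarith
  then show ?thesis by (simp only: s_def en_def h_def)
qed

context regression_model
begin

section \<open>Empirical Gram matrix and projected noise\<close>

lemma spline_basis_design_measurable [measurable]: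
  "(\<lambda>\<omega>. spline_basis K k (Z i \<omega>)) \<in> borel_measurable M"
  by (rule measurable_compose[OF design_measurable spline_basis_measurable])

definition gram :: "nat \<Rightarrow> 'q + nat \<times> nat \<Rightarrow> 'q + nat \<times> nat \<Rightarrow> real" where
  "gram K k l = expectation (\<lambda>\<omega>. spline_basis K k (Z 0 \<omega>) * spline_basis K l (Z 0 \<omega>))"

abbreviation gram_form :: "nat \<Rightarrow> nat \<Rightarrow> ('q + nat \<times> nat \<Rightarrow> real) \<Rightarrow> real" where
  "gram_form r K b \<equiv> \<Sum>k\<in>basis_index r K. \<Sum>l\<in>basis_index r K. b k * b l * gram K k l"

text \<open>The squared Frobenius norm dominates the squared operator norm, yet its expectation is a
  sum of variances, one for each entry.\<close>

definition gram_error :: "nat \<Rightarrow> nat \<Rightarrow> nat \<Rightarrow> 'w \<Rightarrow> real" where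
  "gram_error r K n \<omega> = (\<Sum>k\<in>basis_index r K. \<Sum>l\<in>basis_index r K.
     ((1 / real n) * (\<Sum>i<n. spline_basis K k (Z i \<omega>) * spline_basis K l (Z i \<omega>)) - gram K k l)\<^sup>2)"

definition noise_error :: "nat \<Rightarrow> nat \<Rightarrow> nat \<Rightarrow> 'w \<Rightarrow> real" where
  "noise_error r K n \<omega> = (\<Sum>k\<in>basis_index r K.
     ((1 / real n) * (\<Sum>i<n. W i \<omega> * spline_basis K k (Z i \<omega>)))\<^sup>2)"

lemma basis_square_bound:
  assumes "assumption_A1 M X T \<K>"
  obtains C where "0 \<le> C" "\<And>K i. 0 < K \<Longrightarrow>
    AE \<omega> in M. (\<Sum>k\<in>basis_index r K. (spline_basis K k (Z i \<omega>))\<^sup>2) \<le> C * real K"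
proof -
  have "compact \<K>" using assms by (simp add: assumption_A1_def)
  then obtain R where R: "\<And>x. x \<in> \<K> \<Longrightarrow> norm x \<le> R"
    by (meson bounded_iff compact_imp_bounded)
  have "AE \<omega> in M. (\<Sum>k\<in>basis_index r K. (spline_basis K k (Z i \<omega>))\<^sup>2) \<le> (R\<^sup>2 + real r) * real K"
    if "0 < K" for K i
    using design_in_support[OF assms, of i]
  proof eventually_elim
    fix \<omega> assume "X i \<omega> \<in> \<K> \<and> T i \<omega> \<in> {0..1}"
    then show "(\<Sum>k\<in>basis_index r K. (spline_basis K k (Z i \<omega>))\<^sup>2) \<le> (R\<^sup>2 + real r) * real K"
      using that R by (intro sum_spline_basis_square_le) auto
  qed
  then show thesis by (intro that[of "R\<^sup>2 + real r"]) auto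
qed

text \<open>The entries are summed before they are estimated: the squares of all products
  \<open>\<phi>\<^sub>k \<phi>\<^sub>l\<close> add up to the square of the sum of the
  \<open>\<phi>\<^sub>k\<^sup>2\<close>, which is at most \<open>c\<^sup>2\<close> almost surely.
  With \<open>c\<close> of order \<open>K\<close> this gives \<open>K\<^sup>2 / n\<close>; bounding
  every entry by \<open>c\<^sup>2\<close> separately would lose a further
  \<open>K\<^sup>2\<close>.\<close>

lemma
  assumes bound: "AE \<omega> in M. (\<Sum>k\<in>basis_index r K. (spline_basis K k (Z 0 \<omega>))\<^sup>2) \<le> c"
    and n: "0 < n"
  shows gram_error_integrable: "integrable M (gram_error r K n)"
    and gram_error_expectation: "expectation (gram_error r K n) \<le> c\<^sup>2 / real n"
    and gram_quadratic_form: "gram_form r K b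
      = expectation (\<lambda>\<omega>. (\<Sum>k\<in>basis_index r K. b k * spline_basis K k (Z 0 \<omega>))\<^sup>2)"
    and basis_combination_integrable:
      "integrable M (\<lambda>\<omega>. (\<Sum>k\<in>basis_index r K. b k * spline_basis K k (Z 0 \<omega>))\<^sup>2)"
proof -
  let ?D = "basis_index r K :: ('q + nat \<times> nat) set"
  let ?\<phi> = "\<lambda>k \<omega>. spline_basis K k (Z 0 \<omega>)"
  define g where "g k l z = spline_basis K k (fst z) * spline_basis K l (fst z)"
    for k l and z :: "((real ^ 'q) \<times> real) \<times> real"
  have gm: "g k l \<in> borel_measurable borel" for k l
    unfolding g_def[abs_def] by (intro borel_measurable_times spline_basis_fst_measurable)
  have sqi: "integrable M (\<lambda>\<omega>. (?\<phi> k \<omega> * ?\<phi> l \<omega>)\<^sup>2)" if "k \<in> ?D" "l \<in> ?D" for k l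
  proof (rule integrable_const_bound[of _ "c * c"])
    show "AE \<omega> in M. norm ((?\<phi> k \<omega> * ?\<phi> l \<omega>)\<^sup>2) \<le> c * c"
      using bound
    proof eventually_elim
      fix \<omega> assume le: "(\<Sum>k\<in>?D. (?\<phi> k \<omega>)\<^sup>2) \<le> c"
      have "(?\<phi> k \<omega>)\<^sup>2 \<le> c" if "k \<in> ?D" for k
        using that by (intro order_trans[OF member_le_sum[where f = "\<lambda>k. (?\<phi> k \<omega>)\<^sup>2"] le]) auto
      then have "(?\<phi> k \<omega>)\<^sup>2 * (?\<phi> l \<omega>)\<^sup>2 \<le> c * c"
        using that by (intro mult_mono) (auto intro: order_trans[OF zero_le_power2])
      then show "norm ((?\<phi> k \<omega> * ?\<phi> l \<omega>)\<^sup>2) \<le> c * c" by (simp add: power_mult_distrib)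
    qed
  qed measurable
  have int: "integrable M (\<lambda>\<omega>. ?\<phi> k \<omega> * ?\<phi> l \<omega>)" if "k \<in> ?D" "l \<in> ?D" for k l
    by (rule square_integrable_imp_integrable[OF _ sqi[OF that]]) measurable
  have iid: "integrable M (\<lambda>\<omega>. ((1 / real n) * (\<Sum>i<n. spline_basis K k (Z i \<omega>) * spline_basis K l (Z i \<omega>)) - gram K k l)\<^sup>2)"
    "expectation (\<lambda>\<omega>. ((1 / real n) * (\<Sum>i<n. spline_basis K k (Z i \<omega>) * spline_basis K l (Z i \<omega>)) - gram K k l)\<^sup>2)
      \<le> expectation (\<lambda>\<omega>. (?\<phi> k \<omega> * ?\<phi> l \<omega>)\<^sup>2) / real n" if "k \<in> ?D" "l \<in> ?D" for k l
    using iid_mean_square[OF gm[of k l] _ n] sqi[OF that] by (simp_all add: g_def obs_def gram_def)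
  show "integrable M (gram_error r K n)"
    unfolding gram_error_def[abs_def] using iid(1) by (intro Bochner_Integration.integrable_sum)
  have "expectation (gram_error r K n)
      = (\<Sum>k\<in>?D. \<Sum>l\<in>?D. expectation (\<lambda>\<omega>. ((1 / real n) * (\<Sum>i<n. spline_basis K k (Z i \<omega>) * spline_basis K l (Z i \<omega>)) - gram K k l)\<^sup>2))"
    unfolding gram_error_def[abs_def] using iid(1)
    by (subst Bochner_Integration.integral_sum, intro Bochner_Integration.integrable_sum, assumption,
        intro sum.cong refl Bochner_Integration.integral_sum)
  also have "\<dots> \<le> (\<Sum>k\<in>?D. \<Sum>l\<in>?D. expectation (\<lambda>\<omega>. (?\<phi> k \<omega> * ?\<phi> l \<omega>)\<^sup>2) / real n)"
    by (intro sum_mono iid(2))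
  also have "\<dots> = expectation (\<lambda>\<omega>. \<Sum>k\<in>?D. \<Sum>l\<in>?D. (?\<phi> k \<omega> * ?\<phi> l \<omega>)\<^sup>2) / real n"
  proof -
    have "expectation (\<lambda>\<omega>. \<Sum>k\<in>?D. \<Sum>l\<in>?D. (?\<phi> k \<omega> * ?\<phi> l \<omega>)\<^sup>2)
        = (\<Sum>k\<in>?D. \<Sum>l\<in>?D. expectation (\<lambda>\<omega>. (?\<phi> k \<omega> * ?\<phi> l \<omega>)\<^sup>2))"
      using sqi
      by (subst Bochner_Integration.integral_sum, intro Bochner_Integration.integrable_sum, assumption,
        intro sum.cong refl Bochner_Integration.integral_sum)
    then show ?thesis by (simp add: sum_divide_distrib)
  qed
  also have "\<dots> \<le> c\<^sup>2 / real n"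
  proof (intro divide_right_mono)
    have "expectation (\<lambda>\<omega>. \<Sum>k\<in>?D. \<Sum>l\<in>?D. (?\<phi> k \<omega> * ?\<phi> l \<omega>)\<^sup>2) \<le> expectation (\<lambda>_. c\<^sup>2)"
    proof (rule integral_mono_AE)
      show "AE \<omega> in M. (\<Sum>k\<in>?D. \<Sum>l\<in>?D. (?\<phi> k \<omega> * ?\<phi> l \<omega>)\<^sup>2) \<le> c\<^sup>2"
        using bound
      proof eventually_elim
        fix \<omega> assume le: "(\<Sum>k\<in>?D. (?\<phi> k \<omega>)\<^sup>2) \<le> c"
        have "(\<Sum>k\<in>?D. \<Sum>l\<in>?D. (?\<phi> k \<omega> * ?\<phi> l \<omega>)\<^sup>2) = (\<Sum>k\<in>?D. (?\<phi> k \<omega>)\<^sup>2)\<^sup>2"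
          by (simp add: power2_eq_square[of "sum _ _"] sum_product power_mult_distrib)
        also have "\<dots> \<le> c\<^sup>2" using le by (intro power_mono sum_nonneg) auto
        finally show "(\<Sum>k\<in>?D. \<Sum>l\<in>?D. (?\<phi> k \<omega> * ?\<phi> l \<omega>)\<^sup>2) \<le> c\<^sup>2" .
      qed
    qed (use sqi in \<open>auto intro!: Bochner_Integration.integrable_sum\<close>)
    then show "expectation (\<lambda>\<omega>. \<Sum>k\<in>?D. \<Sum>l\<in>?D. (?\<phi> k \<omega> * ?\<phi> l \<omega>)\<^sup>2) \<le> c\<^sup>2"
      by (simp add: prob_space)
  qed simp
  finally show "expectation (gram_error r K n) \<le> c\<^sup>2 / real n" .
  have expand: "(\<Sum>k\<in>?D. b k * ?\<phi> k \<omega>)\<^sup>2 = (\<Sum>k\<in>?D. \<Sum>l\<in>?D. b k * b l * (?\<phi> k \<omega> * ?\<phi> l \<omega>))" for \<omega>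
    unfolding power2_eq_square sum_product by (intro sum.cong refl) (simp add: ac_simps)
  have int2: "integrable M (\<lambda>\<omega>. b k * b l * (?\<phi> k \<omega> * ?\<phi> l \<omega>))" if "k \<in> ?D" "l \<in> ?D" for k l
    by (rule integrable_mult_right[OF int[OF that]])
  show "integrable M (\<lambda>\<omega>. (\<Sum>k\<in>?D. b k * ?\<phi> k \<omega>)\<^sup>2)"
    unfolding expand using int2 by (intro Bochner_Integration.integrable_sum)
  have "expectation (\<lambda>\<omega>. (\<Sum>k\<in>?D. b k * ?\<phi> k \<omega>)\<^sup>2)
      = (\<Sum>k\<in>?D. \<Sum>l\<in>?D. expectation (\<lambda>\<omega>. b k * b l * (?\<phi> k \<omega> * ?\<phi> l \<omega>)))"
    unfolding expand using int2
    by (subst Bochner_Integration.integral_sum, intro Bochner_Integration.integrable_sum, assumption,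
        intro sum.cong refl Bochner_Integration.integral_sum)
  then show "(\<Sum>k\<in>?D. \<Sum>l\<in>?D. b k * b l * gram K k l) = expectation (\<lambda>\<omega>. (\<Sum>k\<in>?D. b k * ?\<phi> k \<omega>)\<^sup>2)"
    by (simp add: gram_def)
qed

text \<open>Independence of noise and design makes the means vanish, so second moments of
  \<open>W \<phi>\<^sub>k\<close> suffice; summed under the expectation they are at most
  \<open>c E W\<^sup>2\<close>. With \<open>c\<close> of order \<open>K\<close> this is the rate
  \<open>K / n\<close>.\<close>

lemma
  assumes bound: "AE \<omega> in M. (\<Sum>k\<in>basis_index r K. (spline_basis K k (Z 0 \<omega>))\<^sup>2) \<le> c"
    and W2: "integrable M (\<lambda>\<omega>. (W 0 \<omega>)\<^sup>2)" and n: "0 < n"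
  shows noise_error_integrable: "integrable M (noise_error r K n)"
    and noise_error_expectation: "expectation (noise_error r K n) \<le> c * expectation (\<lambda>\<omega>. (W 0 \<omega>)\<^sup>2) / real n"
proof -
  let ?D = "basis_index r K :: ('q + nat \<times> nat) set"
  let ?\<phi> = "\<lambda>k \<omega>. spline_basis K k (Z 0 \<omega>)"
  define g where "g k z = snd z * spline_basis K k (fst z)"
    for k and z :: "((real ^ 'q) \<times> real) \<times> real"
  have gm: "g k \<in> borel_measurable borel" for k
    unfolding g_def[abs_def]
    by (intro borel_measurable_times spline_basis_fst_measurable borel_measurable_continuous_onI continuous_intros)
  have sq_le: "AE \<omega> in M. (?\<phi> k \<omega>)\<^sup>2 \<le> c" if "k \<in> ?D" for k
    using bound
  proof eventually_elim
    fix \<omega> assume le: "(\<Sum>k\<in>?D. (?\<phi> k \<omega>)\<^sup>2) \<le> c"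
    show "(?\<phi> k \<omega>)\<^sup>2 \<le> c"
      using that by (intro order_trans[OF member_le_sum[where f = "\<lambda>k. (?\<phi> k \<omega>)\<^sup>2"] le]) auto
  qed
  have sqi: "integrable M (\<lambda>\<omega>. (W 0 \<omega> * ?\<phi> k \<omega>)\<^sup>2)" if "k \<in> ?D" for k
  proof (rule Bochner_Integration.integrable_bound)
    show "integrable M (\<lambda>\<omega>. c * (W 0 \<omega>)\<^sup>2)" using W2 by auto
    show "AE \<omega> in M. norm ((W 0 \<omega> * ?\<phi> k \<omega>)\<^sup>2) \<le> norm (c * (W 0 \<omega>)\<^sup>2)"
      using sq_le[OF that]
    proof eventually_elim
      fix \<omega> assume "(?\<phi> k \<omega>)\<^sup>2 \<le> c"
      then have "(W 0 \<omega>)\<^sup>2 * (?\<phi> k \<omega>)\<^sup>2 \<le> (W 0 \<omega>)\<^sup>2 * c" by (intro mult_left_mono) auto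
      then show "norm ((W 0 \<omega> * ?\<phi> k \<omega>)\<^sup>2) \<le> norm (c * (W 0 \<omega>)\<^sup>2)"
        by (simp add: power_mult_distrib mult.commute order_trans[OF _ abs_ge_self])
    qed
  qed measurable
  have i\<phi>: "integrable M (?\<phi> k)" if "k \<in> ?D" for k
  proof (rule square_integrable_imp_integrable)
    show "integrable M (\<lambda>\<omega>. (?\<phi> k \<omega>)\<^sup>2)"
      by (rule integrable_const_bound[of _ c]) (use sq_le[OF that] in auto)
  qed measurable
  have mean: "expectation (\<lambda>\<omega>. W 0 \<omega> * ?\<phi> k \<omega>) = 0" if "k \<in> ?D" for k
    by (rule expectation_noise_times[OF spline_basis_measurable i\<phi>[OF that]])
  have iid: "integrable M (\<lambda>\<omega>. ((1 / real n) * (\<Sum>i<n. W i \<omega> * spline_basis K k (Z i \<omega>)))\<^sup>2)"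
    "expectation (\<lambda>\<omega>. ((1 / real n) * (\<Sum>i<n. W i \<omega> * spline_basis K k (Z i \<omega>)))\<^sup>2)
      \<le> expectation (\<lambda>\<omega>. (W 0 \<omega> * ?\<phi> k \<omega>)\<^sup>2) / real n" if "k \<in> ?D" for k
    using iid_mean_square[OF gm[of k] _ n] sqi[OF that] mean[OF that] by (simp_all add: g_def obs_def)
  show "integrable M (noise_error r K n)"
    unfolding noise_error_def[abs_def] using iid(1) by (intro Bochner_Integration.integrable_sum)
  have "expectation (noise_error r K n)
      = (\<Sum>k\<in>?D. expectation (\<lambda>\<omega>. ((1 / real n) * (\<Sum>i<n. W i \<omega> * spline_basis K k (Z i \<omega>)))\<^sup>2))"
    unfolding noise_error_def[abs_def] using iid(1) by (intro Bochner_Integration.integral_sum)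
  also have "\<dots> \<le> (\<Sum>k\<in>?D. expectation (\<lambda>\<omega>. (W 0 \<omega> * ?\<phi> k \<omega>)\<^sup>2) / real n)"
    by (intro sum_mono iid(2))
  also have "\<dots> = expectation (\<lambda>\<omega>. \<Sum>k\<in>?D. (W 0 \<omega> * ?\<phi> k \<omega>)\<^sup>2) / real n"
    using sqi by (subst Bochner_Integration.integral_sum) (auto simp: sum_divide_distrib)
  also have "\<dots> \<le> c * expectation (\<lambda>\<omega>. (W 0 \<omega>)\<^sup>2) / real n"
  proof (intro divide_right_mono)
    have "expectation (\<lambda>\<omega>. \<Sum>k\<in>?D. (W 0 \<omega> * ?\<phi> k \<omega>)\<^sup>2) \<le> expectation (\<lambda>\<omega>. c * (W 0 \<omega>)\<^sup>2)"
    proof (rule integral_mono_AE)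
      show "AE \<omega> in M. (\<Sum>k\<in>?D. (W 0 \<omega> * ?\<phi> k \<omega>)\<^sup>2) \<le> c * (W 0 \<omega>)\<^sup>2"
        using bound
      proof eventually_elim
        fix \<omega> assume "(\<Sum>k\<in>?D. (?\<phi> k \<omega>)\<^sup>2) \<le> c"
        from mult_left_mono[OF this zero_le_power2[of "W 0 \<omega>"]]
        show "(\<Sum>k\<in>?D. (W 0 \<omega> * ?\<phi> k \<omega>)\<^sup>2) \<le> c * (W 0 \<omega>)\<^sup>2"
          by (simp add: power_mult_distrib sum_distrib_left mult.commute)
      qed
    qed (use sqi W2 in \<open>auto intro!: Bochner_Integration.integrable_sum\<close>)
    then show "expectation (\<lambda>\<omega>. \<Sum>k\<in>?D. (W 0 \<omega> * ?\<phi> k \<omega>)\<^sup>2) \<le> c * expectation (\<lambda>\<omega>. (W 0 \<omega>)\<^sup>2)"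
      by simp
  qed simp
  finally show "expectation (noise_error r K n) \<le> c * expectation (\<lambda>\<omega>. (W 0 \<omega>)\<^sup>2) / real n" .
qed

text \<open>The lower density bound carries coercivity from Lebesgue measure on
  \<open>\<K> \<times> {0..1}\<close> to the law of the design, so the constant remains independent
  of \<open>K\<close>.\<close>

lemma gram_coercive:
  assumes A1: "assumption_A1 M X T \<K>"
  obtains c where "0 < c" "\<And>K b. 0 < K \<Longrightarrow>
    c * (\<Sum>k\<in>basis_index r K. (b k)\<^sup>2) \<le> gram_form r K b"
proof -
  obtain h0 where h0: "0 < h0" and \<K>: "compact \<K>" "emeasure lborel \<K> \<noteq> 0"
    and lower: "\<And>g. g \<in> borel_measurable borel \<Longrightarrow>
      ennreal h0 * slab_integral \<K> g
        \<le> (\<integral>\<^sup>+ \<omega>. g (Z 0 \<omega>) \<partial>M)"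
    by (rule design_density_bounds[OF A1], rule that, assumption+)
  obtain c where c: "0 < c" and le: "\<And>K b. 0 < K \<Longrightarrow> ennreal (c * (\<Sum>k\<in>basis_index r K. (b k)\<^sup>2))
    \<le> (\<integral>\<^sup>+ x. \<integral>\<^sup>+ t. ennreal ((\<Sum>k\<in>basis_index r K. b k * spline_basis K k (x, t))\<^sup>2)
        * indicator {0..1} t * indicator \<K> x \<partial>lborel \<partial>lborel)"
    by (rule spline_basis_coercive[OF \<K>], rule that, assumption+)
  obtain C where C: "\<And>K i. 0 < K \<Longrightarrow>
    AE \<omega> in M. (\<Sum>k\<in>basis_index r K. (spline_basis K k (Z i \<omega>))\<^sup>2) \<le> C * real K"
    by (rule basis_square_bound[OF A1], rule that, assumption+)
  have "h0 * c * (\<Sum>k\<in>basis_index r K. (b k)\<^sup>2)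
      \<le> gram_form r K b" if K: "0 < K" for K b
  proof -
    let ?D = "basis_index r K :: ('q + nat \<times> nat) set"
    let ?u = "\<lambda>z. \<Sum>k\<in>?D. b k * spline_basis K k z"
    have m: "(\<lambda>z. ennreal ((?u z)\<^sup>2)) \<in> borel_measurable borel" by measurable
    note int = basis_combination_integrable[OF C[OF K, of 0], of 1 b]
    have s: "0 \<le> (\<Sum>k\<in>?D. (b k)\<^sup>2)" by (intro sum_nonneg) auto
    have "ennreal (h0 * c * (\<Sum>k\<in>?D. (b k)\<^sup>2)) = ennreal h0 * ennreal (c * (\<Sum>k\<in>?D. (b k)\<^sup>2))"
      using h0 c s by (subst ennreal_mult[symmetric]) (auto simp: mult.assoc)
    also have "\<dots> \<le> ennreal h0 * (\<integral>\<^sup>+ x. \<integral>\<^sup>+ t. ennreal ((?u (x, t))\<^sup>2) * indicator {0..1} t * indicator \<K> x \<partial>lborel \<partial>lborel)"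
      by (intro mult_left_mono le K) auto
    also have "\<dots> \<le> (\<integral>\<^sup>+ \<omega>. ennreal ((?u (Z 0 \<omega>))\<^sup>2) \<partial>M)" by (rule lower[OF m])
    also have "\<dots> = ennreal (expectation (\<lambda>\<omega>. (?u (Z 0 \<omega>))\<^sup>2))"
      by (rule nn_integral_eq_integral) (use int in auto)
    finally have "h0 * c * (\<Sum>k\<in>?D. (b k)\<^sup>2) \<le> expectation (\<lambda>\<omega>. (?u (Z 0 \<omega>))\<^sup>2)"
      by (subst (asm) ennreal_le_iff) (auto intro!: Bochner_Integration.integral_nonneg)
    then show ?thesis using gram_quadratic_form[OF C[OF K, of 0], of 1 b] by simp
  qed
  then show thesis using that[of "h0 * c"] h0 c by auto
qed

end

lemma piecewise_poly_diff:
  assumes "v \<in> piecewise_poly_space r K" "w \<in> piecewise_poly_space r K"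
  shows "(\<lambda>t. v t - w t) \<in> piecewise_poly_space r K"
proof -
  obtain P Q where "\<And>j. j \<in> {1..K} \<Longrightarrow> degree (P j) \<le> r - 1" "\<And>j. j \<in> {1..K} \<Longrightarrow> degree (Q j) \<le> r - 1"
    and "v = (\<lambda>t. \<Sum>j=1..K. poly (P j) t * indicator {(real j - 1) / real K ..< real j / real K} t)"
    "w = (\<lambda>t. \<Sum>j=1..K. poly (Q j) t * indicator {(real j - 1) / real K ..< real j / real K} t)"
    using assms unfolding piecewise_poly_space_def by blast
  then show ?thesis
    unfolding piecewise_poly_space_def
    by (intro CollectI exI[of _ "\<lambda>j. P j - Q j"] conjI ballI ext)
       (simp_all only: degree_diff_le poly_diff left_diff_distrib sum_subtractf)
qed

context regression_model
begin

section \<open>Spline bias along the sample, and bounds for the criterion\<close>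

abbreviation approx_error :: "(real \<Rightarrow> real) \<Rightarrow> nat \<Rightarrow> 'w \<Rightarrow> real" where
  "approx_error g n \<omega> \<equiv> (1 / real n) * (\<Sum>i<n. (g (T i \<omega>))\<^sup>2)"

text \<open>\<open>g\<close> is a stand-in for \<open>f - v\<close> that agrees with it where the
  design lives: outside \<open>{0..1}\<close> nothing is known about \<open>f\<close>, not even
  measurability.\<close>

definition spline_approximable :: "nat \<Rightarrow> nat \<Rightarrow> nat \<Rightarrow> (real \<Rightarrow> real) \<Rightarrow> real \<Rightarrow> bool" where
  "spline_approximable r K n f e \<longleftrightarrow> (\<exists>v\<in>piecewise_poly_space r K. \<exists>g. (\<forall>t\<in>{0..1}. g t = f t - v t) \<and>
     integrable M (\<lambda>\<omega>. approx_error g n \<omega>) \<and> expectation (\<lambda>\<omega>. approx_error g n \<omega>) \<le> e)"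

text \<open>The mean of the sample average is that of a single observation, which the upper density
  bound compares with the Lebesgue norm of the bias. \<open>C\<close> thus stays independent of
  \<open>\<alpha>\<close>, \<open>f\<close>, \<open>K\<close> and \<open>n\<close>.\<close>

lemma approx_error_moment:
  assumes A1: "assumption_A1 M X T \<K>"
  obtains C :: real where "0 \<le> C"
    "\<And>\<alpha> f K n. \<kappa> \<le> \<alpha> \<Longrightarrow> 0 < \<alpha> \<Longrightarrow> \<alpha> < real r \<Longrightarrow> f \<in> smoothness_ball (law_T M T) \<alpha> L \<Longrightarrow> 0 < K \<Longrightarrow> 0 < n \<Longrightarrow>
      spline_approximable r K n f (C * real K powr (- 2 * \<kappa>))"
proof -
  obtain c0 c1 where c: "0 < c0" "0 < c1"
    and lower: "\<And>g. g \<in> borel_measurable borel \<Longrightarrow>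
      ennreal c0 * (\<integral>\<^sup>+ t. g t * indicator {0..1} t \<partial>lborel) \<le> (\<integral>\<^sup>+ t. g t * indicator {0..1} t \<partial>law_T M T)"
    and upper: "\<And>g. g \<in> borel_measurable borel \<Longrightarrow>
      (\<integral>\<^sup>+ \<omega>. g (T 0 \<omega>) \<partial>M) \<le> ennreal c1 * (\<integral>\<^sup>+ t. g t * indicator {0..1} t \<partial>lborel)"
    by (rule law_T_bounds[OF A1], rule that, assumption+)
  have sets: "sets (law_T M T) = sets borel" by (simp add: law_T_def)
  obtain C where C: "0 \<le> C" and approx:
    "\<And>\<alpha> f K. \<kappa> \<le> \<alpha> \<Longrightarrow> 0 < \<alpha> \<Longrightarrow> \<alpha> < real r \<Longrightarrow> f \<in> smoothness_ball (law_T M T) \<alpha> L \<Longrightarrow> 0 < K \<Longrightarrow>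
      \<exists>v\<in>piecewise_poly_space r K.
        sq_on {0..1} (\<lambda>t. indicator {0..1} t * f t - v t) \<le> ennreal (C * real K powr (- 2 * \<kappa>))"
    by (rule smoothness_ball_approx[OF sets c(1), where \<kappa> = \<kappa> and r = r and L = L],
        rule lower, assumption, rule that, assumption+)
  have *: "spline_approximable r K n f (c1 * C * real K powr (- 2 * \<kappa>))"
    if \<alpha>: "\<kappa> \<le> \<alpha>" "0 < \<alpha>" "\<alpha> < real r" and f: "f \<in> smoothness_ball (law_T M T) \<alpha> L"
      and K: "0 < K" and n: "0 < n" for \<alpha> f K n
  proof -
    obtain v where v: "v \<in> piecewise_poly_space r K"
      and le: "sq_on {0..1} (\<lambda>t. indicator {0..1} t * f t - v t) \<le> ennreal (C * real K powr (- 2 * \<kappa>))"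
      using approx[OF \<alpha> f K] by blast
    define g where "g = (\<lambda>t. indicator {0..1} t * f t - v t)"
    have "set_borel_measurable (law_T M T) {0..1} f"
      using f by (simp add: smoothness_ball_def Lip_star_def square_integrable_on_def)
    then have "(\<lambda>t. indicator {0..1} t * f t) \<in> borel_measurable borel"
      unfolding set_borel_measurable_def by (simp add: measurable_cong_sets[OF sets refl])
    then have gm [measurable]: "g \<in> borel_measurable borel"
      unfolding g_def using piecewise_poly_measurable[OF v] by (rule borel_measurable_diff)
    have "(\<integral>\<^sup>+ \<omega>. ennreal ((g (T 0 \<omega>))\<^sup>2) \<partial>M) \<le> ennreal c1 * sq_on {0..1} g"
      unfolding sq_on_def by (rule upper) measurable
    also have "\<dots> \<le> ennreal c1 * ennreal (C * real K powr (- 2 * \<kappa>))"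
      using le unfolding g_def by (rule mult_left_mono) simp
    also have "\<dots> = ennreal (c1 * C * real K powr (- 2 * \<kappa>))"
      using c C by (subst ennreal_mult[symmetric]) (auto simp: mult.assoc)
    finally have nn: "(\<integral>\<^sup>+ \<omega>. ennreal ((g (T 0 \<omega>))\<^sup>2) \<partial>M) \<le> ennreal (c1 * C * real K powr (- 2 * \<kappa>))" .
    have int0: "integrable M (\<lambda>\<omega>. (g (T 0 \<omega>))\<^sup>2)"
      using le_less_trans[OF nn ennreal_less_top] by (intro integrableI_bounded) simp_all
    have "ennreal (expectation (\<lambda>\<omega>. (g (T 0 \<omega>))\<^sup>2)) \<le> ennreal (c1 * C * real K powr (- 2 * \<kappa>))"
      using nn by (simp add: nn_integral_eq_integral[OF int0])
    then have E0: "expectation (\<lambda>\<omega>. (g (T 0 \<omega>))\<^sup>2) \<le> c1 * C * real K powr (- 2 * \<kappa>)"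
      using c C by (subst (asm) ennreal_le_iff) auto
    have m: "(\<lambda>z. (g (snd (fst z)))\<^sup>2) \<in> borel_measurable (borel :: (((real ^ 'q) \<times> real) \<times> real) measure)"
    proof -
      have "(\<lambda>z :: ((real ^ 'q) \<times> real) \<times> real. snd (fst z)) \<in> borel_measurable borel"
        by (intro borel_measurable_continuous_onI continuous_intros)
      from measurable_compose[OF this gm] show ?thesis by measurable
    qed
    have int: "integrable M (\<lambda>\<omega>. (g (T i \<omega>))\<^sup>2)" for i
      using integrable_obs[OF m, of i] int0 by (simp add: obs_def)
    have E: "expectation (\<lambda>\<omega>. (g (T i \<omega>))\<^sup>2) = expectation (\<lambda>\<omega>. (g (T 0 \<omega>))\<^sup>2)" for i
      using expectation_obs[OF m, of i] by (simp add: obs_def)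
    have "expectation (\<lambda>\<omega>. approx_error g n \<omega>)
        = (1 / real n) * (\<Sum>i<n. expectation (\<lambda>\<omega>. (g (T i \<omega>))\<^sup>2))"
      by (simp only: integral_mult_right_zero Bochner_Integration.integral_sum[OF int])
    also have "(\<Sum>i<n. expectation (\<lambda>\<omega>. (g (T i \<omega>))\<^sup>2)) = (\<Sum>i<n. expectation (\<lambda>\<omega>. (g (T 0 \<omega>))\<^sup>2))"
      by (rule sum.cong[OF refl E])
    also have "(1 / real n) * \<dots> = expectation (\<lambda>\<omega>. (g (T 0 \<omega>))\<^sup>2)"
      using n by simp
    finally have "expectation (\<lambda>\<omega>. approx_error g n \<omega>) \<le> c1 * C * real K powr (- 2 * \<kappa>)"
      using E0 by (rule ord_eq_le_trans)
    moreover have "integrable M (\<lambda>\<omega>. approx_error g n \<omega>)"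
      using int by (intro integrable_mult_right Bochner_Integration.integrable_sum)
    moreover have "\<forall>t\<in>{0..1}. g t = f t - v t" by (simp add: g_def)
    ultimately show ?thesis unfolding spline_approximable_def by (intro bexI[OF _ v] exI[of _ g] conjI)
  qed
  have "0 \<le> c1 * C" using c C by simp
  then show thesis by (rule that[OF _ *])
qed

text \<open>Both bounds are relative to \<open>\<gamma>\<^sub>0\<close>, the contrast of the
  candidate with the true \<open>\<beta>\<close> and the spline \<open>v\<close>, whose residuals
  are \<open>W + g\<close>. This candidate lies in the space of the active set. A candidate over
  \<open>I\<close> deviates from it by the coefficient \<open>- \<beta> $ i\<close> at each omitted
  \<open>i\<close>, which produces the sum over \<open>- I\<close>.\<close>

lemma
  assumes v: "v \<in> piecewise_poly_space r K" and g: "\<And>t. t \<in> {0..1} \<Longrightarrow> g t = f t - v t"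
    and T01: "\<And>i. i < n \<Longrightarrow> T i \<omega> \<in> {0..1}"
    and pos: "0 < r" "0 < K" "0 < n" "0 < c"
    and coercive: "\<And>b. c * (\<Sum>k\<in>basis_index r K. (b k)\<^sup>2)
      \<le> gram_form r K b"
    and gram: "gram_error r K n \<omega> \<le> (c / 2)\<^sup>2"
  defines "\<gamma>\<^sub>0 \<equiv> (1 / real n) * (\<Sum>i<n. (W i \<omega> + g (T i \<omega>))\<^sup>2)"
  shows criterion_lower: "\<gamma>\<^sub>0 + c / 8 * (\<Sum>i\<in>- I. (\<beta> $ i)\<^sup>2) - 8 / c * noise_error r K n \<omega>
      - 2 * approx_error g n \<omega> + pen r n I K
      \<le> penalized_criterion X T (response X T W \<beta> f) r K n \<omega> I"
    and criterion_active_upper: "penalized_criterion X T (response X T W \<beta> f) r K n \<omega> (active_set \<beta>)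
      \<le> \<gamma>\<^sub>0 + pen r n (active_set \<beta>) K"
proof -
  let ?Y = "response X T W \<beta> f"
  \<comment> \<open>Coefficients over \<open>J\<close> are extended by zero, so that the deviation
    from the truth becomes a combination of all coordinates.\<close>
  have resid: "?Y i \<omega> - ((\<Sum>j\<in>J. a j * X i \<omega> $ j) + w (T i \<omega>))
      = W i \<omega> + g (T i \<omega>) - ((\<Sum>j\<in>UNIV. ((if j \<in> J then a j else 0) - \<beta> $ j) * X i \<omega> $ j) + (w (T i \<omega>) - v (T i \<omega>)))"
    if "i < n" for i J a w
  proof -
    have "(\<Sum>j\<in>UNIV. ((if j \<in> J then a j else 0) - \<beta> $ j) * X i \<omega> $ j)
        = (\<Sum>j\<in>J. a j * X i \<omega> $ j) - \<beta> \<bullet> X i \<omega>"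
      by (simp add: left_diff_distrib sum_subtractf inner_vec_def if_distrib[of "\<lambda>z. z * _"] sum.If_cases)
    then show ?thesis
      using g[OF T01[OF that]] by (simp add: response_def regression_fun_def)
  qed
  have "\<gamma>\<^sub>0 + c / 8 * (\<Sum>i\<in>- I. (\<beta> $ i)\<^sup>2) - 8 / c * noise_error r K n \<omega>
      - 2 * approx_error g n \<omega> \<le> (INF u\<in>approx_space r I K. ls_contrast X T ?Y n \<omega> u)"
  proof (rule cINF_greatest)
    show "approx_space r I K \<noteq> {}" using v by (auto simp: approx_space_def)
    fix u assume "u \<in> approx_space r I K"
    then obtain a w where w: "w \<in> piecewise_poly_space r K"
      and u: "u = (\<lambda>(x, t). (\<Sum>i\<in>I. a i * x $ i) + w t)"
      unfolding approx_space_def by blast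
    obtain b where b: "\<And>i. b (Inl i) = (if i \<in> I then a i else 0) - \<beta> $ i"
      and rep: "\<And>x t. (\<Sum>i\<in>UNIV. ((if i \<in> I then a i else 0) - \<beta> $ i) * x $ i) + (w t - v t)
        = (\<Sum>k\<in>basis_index r K. b k * spline_basis K k (x, t))"
      by (rule spline_basis_representation[OF piecewise_poly_diff[OF w v] pos(1,2)], rule that, assumption+)
    have "(\<Sum>i\<in>- I. (\<beta> $ i)\<^sup>2) = (\<Sum>i\<in>- I. (b (Inl i))\<^sup>2)"
      by (intro sum.cong refl) (simp add: b)
    also have "\<dots> \<le> (\<Sum>i\<in>UNIV. (b (Inl i))\<^sup>2)" by (intro sum_mono2) auto
    also have "\<dots> \<le> (\<Sum>k\<in>basis_index r K. (b k)\<^sup>2)"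
      unfolding sum_basis_index by (intro le_add_same_cancel1[THEN iffD2] sum_nonneg) auto
    finally have \<beta>: "c / 8 * (\<Sum>i\<in>- I. (\<beta> $ i)\<^sup>2) \<le> c / 8 * (\<Sum>k\<in>basis_index r K. (b k)\<^sup>2)"
      using pos by (intro mult_left_mono) auto
    have "ls_contrast X T ?Y n \<omega> u
        = (1 / real n) * (\<Sum>i<n. (W i \<omega> + g (T i \<omega>) - (\<Sum>k\<in>basis_index r K. b k * spline_basis K k (Z i \<omega>)))\<^sup>2)"
      unfolding ls_contrast_def u by (simp add: resid rep)
    moreover have "\<gamma>\<^sub>0 + c / 8 * (\<Sum>k\<in>basis_index r K. (b k)\<^sup>2) - 8 / c * noise_error r K n \<omega>
      - 2 * approx_error g n \<omega>
      \<le> (1 / real n) * (\<Sum>i<n. (W i \<omega> + g (T i \<omega>) - (\<Sum>k\<in>basis_index r K. b k * spline_basis K k (Z i \<omega>)))\<^sup>2)"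
      unfolding \<gamma>\<^sub>0_def noise_error_def
      by (rule least_squares_lower[OF pos(3,4) coercive gram[unfolded gram_error_def]])
    ultimately show "\<gamma>\<^sub>0 + c / 8 * (\<Sum>i\<in>- I. (\<beta> $ i)\<^sup>2) - 8 / c * noise_error r K n \<omega>
      - 2 * approx_error g n \<omega> \<le> ls_contrast X T ?Y n \<omega> u"
      using \<beta> by linarith
  qed
  then show "\<gamma>\<^sub>0 + c / 8 * (\<Sum>i\<in>- I. (\<beta> $ i)\<^sup>2) - 8 / c * noise_error r K n \<omega>
      - 2 * approx_error g n \<omega> + pen r n I K
      \<le> penalized_criterion X T ?Y r K n \<omega> I"
    unfolding penalized_criterion_def by simp
  let ?u = "\<lambda>(x, t). (\<Sum>i\<in>active_set \<beta>. \<beta> $ i * x $ i) + v t"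
  have "?u \<in> approx_space r (active_set \<beta>) K" using v unfolding approx_space_def by blast
  moreover have "bdd_below (ls_contrast X T ?Y n \<omega> ` approx_space r (active_set \<beta>) K)"
    by (rule bdd_belowI2[of _ 0]) (auto simp: ls_contrast_def intro!: divide_nonneg_nonneg sum_nonneg)
  ultimately have "(INF u\<in>approx_space r (active_set \<beta>) K. ls_contrast X T ?Y n \<omega> u) \<le> ls_contrast X T ?Y n \<omega> ?u"
    by (intro cINF_lower)
  also have "\<dots> = \<gamma>\<^sub>0"
  proof -
    have "(\<Sum>j\<in>UNIV. ((if j \<in> active_set \<beta> then \<beta> $ j else 0) - \<beta> $ j) * x $ j) = 0" for x :: "real ^ 'q"
      by (intro sum.neutral) (auto simp: active_set_def)
    then show ?thesis
      unfolding ls_contrast_def \<gamma>\<^sub>0_def by (simp add: resid)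
  qed
  finally show "penalized_criterion X T ?Y r K n \<omega> (active_set \<beta>) \<le> \<gamma>\<^sub>0 + pen r n (active_set \<beta>) K"
    unfolding penalized_criterion_def by simp
qed

end

section \<open>Consistency of the selection\<close>

text \<open>The last bound is the balance behind the choice of \<open>K\<close>: the squared bias
  \<open>K powr (- 2 \<kappa>)\<close> is at most a constant times \<open>K / n\<close>, because
  \<open>n\<close> is at most \<open>(2 K) powr (2 \<kappa> + 1)\<close>.\<close>

lemma dyadic_asymp_bounds:
  assumes \<kappa>: "1/2 < \<kappa>" and n: "1 \<le> n"
    and K: "dyadic_asymp (real K) (real n powr (1 / (2 * \<kappa> + 1)))"
  shows "0 < K" "real K \<le> 2 * real n powr (1 / (2 * \<kappa> + 1))"
    "real K powr (- 2 * \<kappa>) * real n \<le> 2 powr (2 * \<kappa> + 1) * real K"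
proof -
  let ?v = "real n powr (1 / (2 * \<kappa> + 1))"
  show "0 < K" and le: "real K \<le> 2 * ?v"
    using K n by (auto simp: dyadic_asymp_def intro: gr0I)
  have ge: "?v \<le> 2 * real K" using K by (simp add: dyadic_asymp_def)
  have "real n = ?v powr (2 * \<kappa> + 1)" using n \<kappa> by (simp add: powr_powr)
  also have "\<dots> \<le> (2 * real K) powr (2 * \<kappa> + 1)" using ge \<kappa> by (intro powr_mono2) auto
  also have "\<dots> = 2 powr (2 * \<kappa> + 1) * real K powr (2 * \<kappa> + 1)"
    by (simp add: powr_mult)
  finally have "real K powr (- 2 * \<kappa>) * real n \<le> real K powr (- 2 * \<kappa>) * (2 powr (2 * \<kappa> + 1) * real K powr (2 * \<kappa> + 1))"
    by (intro mult_left_mono) auto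
  also have "\<dots> = 2 powr (2 * \<kappa> + 1) * (real K powr (- 2 * \<kappa>) * real K powr (2 * \<kappa> + 1))" by (simp only: mult_ac)
  also have "real K powr (- 2 * \<kappa>) * real K powr (2 * \<kappa> + 1) = real K"
    using \<open>0 < K\<close> by (simp add: powr_add[symmetric])
  finally show "real K powr (- 2 * \<kappa>) * real n \<le> 2 powr (2 * \<kappa> + 1) * real K" .
qed

text \<open>The exponent of \<open>n\<close> in \<open>K\<close> is below 1/2 because
  \<open>\<kappa> > 1/2\<close>. The first limit makes the Gram error vanish, the second the
  penalties.\<close>

lemma dyadic_asymp_limits:
  assumes \<kappa>: "1/2 < \<kappa>"
    and K: "\<And>n. 1 \<le> n \<Longrightarrow> dyadic_asymp (real (K n)) (real n powr (1 / (2 * \<kappa> + 1)))"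
  shows "(\<lambda>n. (real (K n))\<^sup>2 / real n) \<longlonglongrightarrow> 0" "(\<lambda>n. real (K n) * (ln (real n) / real n)) \<longlonglongrightarrow> 0"
proof -
  define \<theta> where "\<theta> = 1 / (2 * \<kappa> + 1)"
  have \<theta>: "0 < \<theta>" "\<theta> < 1/2" using \<kappa> by (auto simp: \<theta>_def field_simps)
  have le: "real (K n) \<le> 2 * real n powr \<theta>" if "1 \<le> n" for n
    using dyadic_asymp_bounds(2)[OF \<kappa> that K[OF that]] by (simp add: \<theta>_def)
  show "(\<lambda>n. (real (K n))\<^sup>2 / real n) \<longlonglongrightarrow> 0"
  proof (rule tendsto_sandwich[OF _ _ tendsto_const])
    show "\<forall>\<^sub>F n in sequentially. (real (K n))\<^sup>2 / real n \<le> 4 * real n powr (2 * \<theta> - 1)"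
      using eventually_ge_at_top[of 1]
    proof eventually_elim
      fix n :: nat assume n: "1 \<le> n"
      have "(real (K n))\<^sup>2 / real n \<le> (2 * real n powr \<theta>)\<^sup>2 / real n"
        using le[OF n] by (intro divide_right_mono power_mono) auto
      also have "\<dots> = 4 * (real n powr (2 * \<theta>) / real n powr 1)"
        using n by (simp add: power_mult_distrib powr_power mult.commute)
      also have "\<dots> = 4 * real n powr (2 * \<theta> - 1)" by (simp only: powr_diff)
      finally show "(real (K n))\<^sup>2 / real n \<le> 4 * real n powr (2 * \<theta> - 1)" .
    qed
    have "(\<lambda>n. real n powr (2 * \<theta> - 1)) \<longlonglongrightarrow> 0"
      using \<theta> by (intro tendsto_neg_powr filterlim_real_sequentially) auto
    from tendsto_mult_left[OF this, of 4]
    show "(\<lambda>n. 4 * real n powr (2 * \<theta> - 1)) \<longlonglongrightarrow> 0" by simp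
  qed (auto intro!: always_eventually)
  show "(\<lambda>n. real (K n) * (ln (real n) / real n)) \<longlonglongrightarrow> 0"
  proof (rule tendsto_sandwich[OF _ _ tendsto_const])
    \<comment> \<open>The cruder exponent 1/2 still suffices here and leaves a bound free of
      \<open>\<theta>\<close>.\<close>
    show "\<forall>\<^sub>F n in sequentially. real (K n) * (ln (real n) / real n) \<le> 2 * real n powr (1/2) * (ln (real n) / real n)"
      using eventually_ge_at_top[of 1]
    proof eventually_elim
      fix n :: nat assume n: "1 \<le> n"
      have "real n powr \<theta> \<le> real n powr (1/2)" using \<theta> n by (intro powr_mono) auto
      then have "real (K n) \<le> 2 * real n powr (1/2)" using le[OF n] by linarith
      then show "real (K n) * (ln (real n) / real n) \<le> 2 * real n powr (1/2) * (ln (real n) / real n)"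
        using n by (intro mult_right_mono) auto
    qed
    show "(\<lambda>n. 2 * real n powr (1/2) * (ln (real n) / real n)) \<longlonglongrightarrow> 0" by real_asymp
    show "\<forall>\<^sub>F n in sequentially. 0 \<le> real (K n) * (ln (real n) / real n)"
      using eventually_ge_at_top[of 1] by eventually_elim auto
  qed
qed

context regression_model
begin

text \<open>A deterministic comparison at one \<open>\<omega>\<close>. A proper superset of the
  active set pays at least \<open>2 r \<rho>\<close> more in penalty, which exceeds the error. A set
  that misses an active covariate pays at least \<open>c m / 8\<close> in the contrast, which
  exceeds the penalty of the active set plus the error.\<close>

lemma criterion_active_less:
  fixes \<beta> :: "real ^ 'q"
  assumes v: "v \<in> piecewise_poly_space r K" and g: "\<And>t. t \<in> {0..1} \<Longrightarrow> g t = f t - v t"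
    and T01: "\<And>i. i < n \<Longrightarrow> T i \<omega> \<in> {0..1}"
    and pos: "0 < r" "0 < K" "0 < n" "0 < c"
    and coercive: "\<And>b. c * (\<Sum>k\<in>basis_index r K. (b k)\<^sup>2)
      \<le> gram_form r K b"
    and gram: "gram_error r K n \<omega> \<le> (c / 2)\<^sup>2"
    and \<rho>: "0 < \<rho>" and \<rho>_def: "\<rho> = real K * (ln (real n) / real n)"
    and small: "8 / c * noise_error r K n \<omega> + 2 * approx_error g n \<omega> < 2 * real r * \<rho>"
    and m: "\<And>j. j \<in> active_set \<beta> \<Longrightarrow> m \<le> (\<beta> $ j)\<^sup>2"
    and gap: "2 * (real CARD('q) + 2) * real r * \<rho> \<le> c / 8 * m"
    and I: "I \<noteq> active_set \<beta>"
  shows "penalized_criterion X T (response X T W \<beta> f) r K n \<omega> (active_set \<beta>)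
    < penalized_criterion X T (response X T W \<beta> f) r K n \<omega> I"
proof -
  let ?Y = "response X T W \<beta> f"
  let ?err = "8 / c * noise_error r K n \<omega> + 2 * approx_error g n \<omega>"
  have pen: "pen r n J K = 2 * (real (card J) + 1) * (real r * \<rho>)" for J :: "'q set"
    by (simp add: pen_def \<rho>_def)
  have r\<rho>: "0 < real r * \<rho>" using pos \<rho> by simp
  have lower: "penalized_criterion X T ?Y r K n \<omega> (active_set \<beta>) + c / 8 * (\<Sum>i\<in>- I. (\<beta> $ i)\<^sup>2)
      + (pen r n I K - pen r n (active_set \<beta>) K) - ?err \<le> penalized_criterion X T ?Y r K n \<omega> I"
    using criterion_lower[OF v g T01 pos coercive gram, where I = I and \<beta> = \<beta>]
      criterion_active_upper[OF v g T01 pos coercive gram, where \<beta> = \<beta>] by linarith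
  have "?err < c / 8 * (\<Sum>i\<in>- I. (\<beta> $ i)\<^sup>2) + (pen r n I K - pen r n (active_set \<beta>) K)"
  proof (cases "active_set \<beta> \<subseteq> I")
    case True
    then have "card (active_set \<beta>) < card I" using I by (intro psubset_card_mono) auto
    then have "real (card (active_set \<beta>)) + 1 \<le> real (card I)" by linarith
    from mult_right_mono[OF this, of "2 * (real r * \<rho>)"]
    have "2 * (real r * \<rho>) \<le> pen r n I K - pen r n (active_set \<beta>) K"
      using r\<rho> unfolding pen by (simp add: algebra_simps)
    moreover have "0 \<le> c / 8 * (\<Sum>i\<in>- I. (\<beta> $ i)\<^sup>2)"
      using pos by (intro mult_nonneg_nonneg sum_nonneg) auto
    ultimately show ?thesis using small by (simp add: mult.assoc)
  next
    case False
    then obtain j where j: "j \<in> active_set \<beta>" "j \<notin> I" by blast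
    have "m \<le> (\<beta> $ j)\<^sup>2" by (rule m[OF j(1)])
    also have "\<dots> \<le> (\<Sum>i\<in>- I. (\<beta> $ i)\<^sup>2)" using j by (intro member_le_sum) auto
    finally have "c / 8 * m \<le> c / 8 * (\<Sum>i\<in>- I. (\<beta> $ i)\<^sup>2)" using pos by (intro mult_left_mono) auto
    moreover have "real (card (active_set \<beta>)) \<le> real CARD('q)"
      by (intro of_nat_mono card_mono) auto
    from mult_right_mono[OF this, of "2 * (real r * \<rho>)"]
    have "pen r n (active_set \<beta>) K \<le> 2 * (real CARD('q) + 1) * (real r * \<rho>)"
      using r\<rho> unfolding pen by (simp add: algebra_simps)
    moreover have "0 \<le> pen r n I K" unfolding pen using \<rho> by (intro mult_nonneg_nonneg) auto
    \<comment> \<open>Splits the gap condition: \<open>CARD('q) + 1\<close> bounds the penalty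
      factor of the active set, the remaining unit covers the error.\<close>
    moreover have "2 * (real CARD('q) + 2) * real r * \<rho>
        = 2 * (real CARD('q) + 1) * (real r * \<rho>) + 2 * real r * \<rho>"
      by (simp add: algebra_simps)
    ultimately show ?thesis using small gap by linarith
  qed
  then show ?thesis using lower by linarith
qed

text \<open>\<open>N\<close> may depend only on what is fixed before \<open>\<alpha>\<close>,
  \<open>f\<close> and the selector: \<open>\<epsilon>\<close>, the sequence \<open>K\<close>, the
  noise variance, the smallest active coefficient, and the constants for coercivity, basis and
  approximation.\<close>

lemma selection_consistent:
  fixes \<beta> :: "real ^ 'q" and K :: "nat \<Rightarrow> nat"
  assumes A1: "assumption_A1 M X T \<K>" and A2: "assumption_A2 M W"
    and r: "0 < r" and \<kappa>: "1/2 < \<kappa>"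
    and K: "\<And>n. 1 \<le> n \<Longrightarrow> dyadic_asymp (real (K n)) (real n powr (1 / (2 * \<kappa> + 1)))"
    and \<epsilon>: "0 < \<epsilon>"
  shows "\<exists>N\<ge>1. \<forall>n\<ge>N. \<forall>\<alpha>\<in>{\<kappa> ..< real r}. \<forall>f. f \<in> smoothness_ball (law_T M T) \<alpha> L \<longrightarrow>
    (\<forall>Ihat. selected_index_set M X T (response X T W \<beta> f) r (K n) n Ihat \<longrightarrow>
      measure M {\<omega> \<in> space M. Ihat \<omega> \<noteq> active_set \<beta>} < \<epsilon>)"
proof -
  obtain c where c: "0 < c" and coercive: "\<And>K b. 0 < K \<Longrightarrow>
    c * (\<Sum>k\<in>basis_index r K. (b k)\<^sup>2) \<le> gram_form r K b"
    by (rule gram_coercive[OF A1, where r = r], rule that, assumption+)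
  obtain Cb where Cb: "0 \<le> Cb" and basis: "\<And>K i. 0 < K \<Longrightarrow>
    AE \<omega> in M. (\<Sum>k\<in>basis_index r K. (spline_basis K k (Z i \<omega>))\<^sup>2) \<le> Cb * real K"
    by (rule basis_square_bound[OF A1, where r = r], rule that, assumption+)
  obtain Ca where Ca: "0 \<le> Ca" and approx:
    "\<And>\<alpha> f K n. \<kappa> \<le> \<alpha> \<Longrightarrow> 0 < \<alpha> \<Longrightarrow> \<alpha> < real r \<Longrightarrow> f \<in> smoothness_ball (law_T M T) \<alpha> L \<Longrightarrow> 0 < K \<Longrightarrow> 0 < n \<Longrightarrow>
      spline_approximable r K n f (Ca * real K powr (- 2 * \<kappa>))"
    by (rule approx_error_moment[OF A1, where \<kappa> = \<kappa> and r = r and L = L], rule that, assumption+)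
  note W2 = noise_square_integrable[OF A2]
  define \<sigma> where "\<sigma> = expectation (\<lambda>\<omega>. (W 0 \<omega>)\<^sup>2)"
  define \<eta> where "\<eta> = real r / (8 / c + 2)"
  have c82: "0 < 8 / c + 2" using c by (intro add_pos_pos) auto
  have \<eta>: "0 < \<eta>" using r c82 by (simp add: \<eta>_def)
  have \<eta>r: "8 / c * \<eta> + 2 * \<eta> = real r"
  proof -
    have "8 / c * \<eta> + 2 * \<eta> = (8 / c + 2) * \<eta>" by (rule distrib_right[symmetric])
    also have "\<dots> = real r" using c82 by (simp only: \<eta>_def nonzero_mult_div_cancel_left times_divide_eq_right less_imp_neq[symmetric] not_False_eq_True)
    finally show ?thesis .
  qed
  obtain m where m0: "0 < m" and m: "\<And>j. j \<in> active_set \<beta> \<Longrightarrow> m \<le> (\<beta> $ j)\<^sup>2"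
  proof -
    \<comment> \<open>The inserted 1 covers an empty active set, where \<open>Min\<close> would be
      unspecified.\<close>
    let ?S = "insert 1 ((\<lambda>j. (\<beta> $ j)\<^sup>2) ` active_set \<beta>)"
    have "0 < Min ?S" by (subst Min_gr_iff) (auto simp: active_set_def)
    moreover have "Min ?S \<le> (\<beta> $ j)\<^sup>2" if "j \<in> active_set \<beta>" for j
      using that by (intro Min_le) auto
    ultimately show thesis by (rule that)
  qed
  define \<rho> where "\<rho> n = real (K n) * (ln (real n) / real n)" for n
  \<comment> \<open>The three Markov bounds, for Gram error, noise and bias. In the last two the
    order \<open>K / n\<close> cancels against the threshold \<open>\<eta> \<rho> n\<close>, which
    leaves a multiple of \<open>1 / ln n\<close>.\<close>
  define p where "p n = (Cb * real (K n))\<^sup>2 / real n / (c / 2)\<^sup>2 + Cb * \<sigma> / (\<eta> * ln (real n))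
      + Ca * 2 powr (2 * \<kappa> + 1) / (\<eta> * ln (real n))" for n
  have "(\<lambda>n. Cb\<^sup>2 / (c / 2)\<^sup>2 * ((real (K n))\<^sup>2 / real n) + Cb * \<sigma> / \<eta> * (1 / ln (real n))
      + Ca * 2 powr (2 * \<kappa> + 1) / \<eta> * (1 / ln (real n))) \<longlonglongrightarrow> Cb\<^sup>2 / (c / 2)\<^sup>2 * 0 + Cb * \<sigma> / \<eta> * 0 + Ca * 2 powr (2 * \<kappa> + 1) / \<eta> * 0"
    using dyadic_asymp_limits(1)[OF \<kappa> K]
    by (intro tendsto_intros) (assumption, real_asymp+)
  then have "p \<longlonglongrightarrow> 0"
    unfolding p_def[abs_def] by (simp add: power_mult_distrib mult_ac)
  then have "\<forall>\<^sub>F n in sequentially. p n < \<epsilon>" using \<epsilon> by (rule order_tendstoD)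
  moreover have "(\<lambda>n. 2 * (real CARD('q) + 2) * real r * \<rho> n) \<longlonglongrightarrow> 2 * (real CARD('q) + 2) * real r * 0"
    unfolding \<rho>_def using dyadic_asymp_limits(2)[OF \<kappa> K] by (rule tendsto_mult_left)
  then have "\<forall>\<^sub>F n in sequentially. 2 * (real CARD('q) + 2) * real r * \<rho> n < c / 8 * m"
    using c m0 by (intro order_tendstoD(2)) auto
  \<comment> \<open>From \<open>n = 2\<close> on the logarithm, and with it the threshold, is
    positive.\<close>
  moreover have "\<forall>\<^sub>F n in sequentially. 2 \<le> (n :: nat)" by (rule eventually_ge_at_top)
  ultimately have "\<forall>\<^sub>F n in sequentially. p n < \<epsilon> \<and> 2 * (real CARD('q) + 2) * real r * \<rho> n < c / 8 * m \<and> 2 \<le> n"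
    by eventually_elim blast
  then obtain N where N: "\<And>n. N \<le> n \<Longrightarrow> p n < \<epsilon> \<and> 2 * (real CARD('q) + 2) * real r * \<rho> n < c / 8 * m \<and> 2 \<le> n"
    unfolding eventually_sequentially by blast
  have "measure M {\<omega> \<in> space M. Ihat \<omega> \<noteq> active_set \<beta>} < \<epsilon>"
    if nN: "max N 1 \<le> n" and \<alpha>: "\<alpha> \<in> {\<kappa> ..< real r}" and f: "f \<in> smoothness_ball (law_T M T) \<alpha> L"
      and sel: "selected_index_set M X T (response X T W \<beta> f) r (K n) n Ihat" for n \<alpha> f Ihat
  proof -
    have n: "1 \<le> n" "2 \<le> n" and pn: "p n < \<epsilon>" and gap: "2 * (real CARD('q) + 2) * real r * \<rho> n \<le> c / 8 * m"
      using nN N[of n] by auto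
    have n0: "0 < n" using n by simp
    have ln0: "0 < ln (real n)" using n by simp
    have Kn: "0 < K n" "real (K n) powr (- 2 * \<kappa>) * real n \<le> 2 powr (2 * \<kappa> + 1) * real (K n)"
      using dyadic_asymp_bounds[OF \<kappa> n(1) K[OF n(1)]] by auto
    have \<rho>0: "0 < \<rho> n" using Kn ln0 n0 by (simp add: \<rho>_def)
    have a0: "0 < \<alpha>" using \<alpha> \<kappa> by auto
    have \<alpha>': "\<kappa> \<le> \<alpha>" "\<alpha> < real r" using \<alpha> by auto
    from approx[OF \<alpha>'(1) a0 \<alpha>'(2) f Kn(1) n0]
    obtain v g where v: "v \<in> piecewise_poly_space r (K n)" and g': "\<forall>t\<in>{0..1}. g t = f t - v t"
      and gint: "integrable M (\<lambda>\<omega>. approx_error g n \<omega>)"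
      and gE: "expectation (\<lambda>\<omega>. approx_error g n \<omega>) \<le> Ca * real (K n) powr (- 2 * \<kappa>)"
      unfolding spline_approximable_def by blast
    note g = bspec[OF g']
    let ?A = "{\<omega> \<in> space M. (c / 2)\<^sup>2 \<le> gram_error r (K n) n \<omega>}"
    let ?B = "{\<omega> \<in> space M. \<eta> * \<rho> n \<le> noise_error r (K n) n \<omega>}"
    let ?C = "{\<omega> \<in> space M. \<eta> * \<rho> n \<le> approx_error g n \<omega>}"
    note gram = gram_error_integrable[OF basis[OF Kn(1), of 0] n0] gram_error_expectation[OF basis[OF Kn(1), of 0] n0]
    note noise = noise_error_integrable[OF basis[OF Kn(1), of 0] W2 n0]
      noise_error_expectation[OF basis[OF Kn(1), of 0] W2 n0, folded \<sigma>_def]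
    have markov: "{\<omega> \<in> space M. a \<le> u \<omega>} \<in> events \<and> measure M {\<omega> \<in> space M. a \<le> u \<omega>} \<le> e / a"
      if "integrable M u" "expectation u \<le> e" "\<And>\<omega>. 0 \<le> u \<omega>" "0 < a" for u :: "'w \<Rightarrow> real" and a e
    proof
      have [measurable]: "u \<in> borel_measurable M" using that(1) by simp
      show "{\<omega> \<in> space M. a \<le> u \<omega>} \<in> events" by measurable
      have "measure M {\<omega> \<in> space M. a \<le> u \<omega>} \<le> expectation u / a"
        by (rule integral_Markov_inequality_measure[where A = "{}"]) (use that in auto)
      also have "\<dots> \<le> e / a" using that by (intro divide_right_mono) auto
      finally show "measure M {\<omega> \<in> space M. a \<le> u \<omega>} \<le> e / a" .
    qed
    have A: "?A \<in> events" "measure M ?A \<le> (Cb * real (K n))\<^sup>2 / real n / (c / 2)\<^sup>2"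
    proof -
      have "0 \<le> gram_error r (K n) n \<omega>" for \<omega>
        unfolding gram_error_def by (intro sum_nonneg zero_le_power2)
      moreover have "0 < (c / 2)\<^sup>2" using c by simp
      ultimately show "?A \<in> events" "measure M ?A \<le> (Cb * real (K n))\<^sup>2 / real n / (c / 2)\<^sup>2"
        using markov[OF gram, of "(c / 2)\<^sup>2"] by blast+
    qed
    have B: "?B \<in> events" "measure M ?B \<le> Cb * \<sigma> / (\<eta> * ln (real n))"
    proof -
      have *: "?B \<in> events \<and> measure M ?B \<le> Cb * real (K n) * \<sigma> / real n / (\<eta> * \<rho> n)"
        using \<eta> \<rho>0 by (intro markov[OF noise]) (auto simp: noise_error_def intro!: sum_nonneg)
      also have "Cb * real (K n) * \<sigma> / real n / (\<eta> * \<rho> n) = Cb * \<sigma> / (\<eta> * ln (real n))"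
        using n0 Kn(1) by (simp add: \<rho>_def)
      finally show "?B \<in> events" "measure M ?B \<le> Cb * \<sigma> / (\<eta> * ln (real n))" by auto
    qed
    have C: "?C \<in> events" "measure M ?C \<le> Ca * 2 powr (2 * \<kappa> + 1) / (\<eta> * ln (real n))"
    proof -
      have *: "?C \<in> events \<and> measure M ?C \<le> Ca * real (K n) powr (- 2 * \<kappa>) / (\<eta> * \<rho> n)"
        using \<eta> \<rho>0 by (intro markov[OF gint gE]) (auto intro!: sum_nonneg divide_nonneg_nonneg)
      have "Ca * real (K n) powr (- 2 * \<kappa>) / (\<eta> * \<rho> n)
          = Ca / (\<eta> * ln (real n)) * (real (K n) powr (- 2 * \<kappa>) * real n / real (K n))"
        by (simp add: \<rho>_def mult_ac)
      also have "\<dots> \<le> Ca / (\<eta> * ln (real n)) * 2 powr (2 * \<kappa> + 1)"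
        using Kn Ca \<eta> ln0 by (intro mult_left_mono) (auto simp: divide_le_eq)
      finally show "?C \<in> events" "measure M ?C \<le> Ca * 2 powr (2 * \<kappa> + 1) / (\<eta> * ln (real n))"
        using * by auto
    qed
    have "AE \<omega> in M. \<forall>i. T i \<omega> \<in> {0..1}"
      unfolding AE_all_countable using design_in_support[OF A1] by (auto elim: eventually_mono)
    moreover have "AE \<omega> in M. is_arg_min (penalized_criterion X T (response X T W \<beta> f) r (K n) n \<omega>) (\<lambda>I. I \<in> UNIV) (Ihat \<omega>)"
      using sel by (simp add: selected_index_set_def)
    ultimately have "AE \<omega> in M. \<omega> \<in> {\<omega> \<in> space M. Ihat \<omega> \<noteq> active_set \<beta>} \<longrightarrow> \<omega> \<in> ?A \<union> ?B \<union> ?C"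
    proof eventually_elim
      fix \<omega>
      assume T01: "\<forall>i. T i \<omega> \<in> {0..1}"
        and arg: "is_arg_min (penalized_criterion X T (response X T W \<beta> f) r (K n) n \<omega>) (\<lambda>I. I \<in> UNIV) (Ihat \<omega>)"
      show "\<omega> \<in> {\<omega> \<in> space M. Ihat \<omega> \<noteq> active_set \<beta>} \<longrightarrow> \<omega> \<in> ?A \<union> ?B \<union> ?C"
      proof (rule impI, rule ccontr)
        assume "\<omega> \<in> {\<omega> \<in> space M. Ihat \<omega> \<noteq> active_set \<beta>}" and "\<omega> \<notin> ?A \<union> ?B \<union> ?C"
        then have ne: "Ihat \<omega> \<noteq> active_set \<beta>" and A': "gram_error r (K n) n \<omega> \<le> (c / 2)\<^sup>2"
          and B': "noise_error r (K n) n \<omega> \<le> \<eta> * \<rho> n"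
          and C': "approx_error g n \<omega> \<le> \<eta> * \<rho> n"
          by auto
        have "8 / c * noise_error r (K n) n \<omega> \<le> 8 / c * (\<eta> * \<rho> n)"
          using B' c by (intro mult_left_mono) auto
        moreover have "8 / c * (\<eta> * \<rho> n) + 2 * (\<eta> * \<rho> n) = real r * \<rho> n"
          by (simp only: \<eta>r[symmetric] distrib_right mult.assoc)
        moreover have "real r * \<rho> n < 2 * real r * \<rho> n" using r \<rho>0 by simp
        ultimately have small: "8 / c * noise_error r (K n) n \<omega> + 2 * approx_error g n \<omega> < 2 * real r * \<rho> n"
          using C' by linarith
        have T01': "\<And>i. i < n \<Longrightarrow> T i \<omega> \<in> {0..1}" using T01 by blast
        from criterion_active_less[OF v g T01' r Kn(1) n0 c coercive[OF Kn(1)] A' \<rho>0 \<rho>_def small m gap ne]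
        show False using arg by (auto simp: is_arg_min_def)
      qed
    qed
    then have "measure M {\<omega> \<in> space M. Ihat \<omega> \<noteq> active_set \<beta>} \<le> measure M (?A \<union> ?B \<union> ?C)"
      using A(1) B(1) C(1) by (intro finite_measure_mono_AE) auto
    also have "\<dots> \<le> measure M ?A + measure M ?B + measure M ?C"
      using A(1) B(1) C(1)
      by (intro order_trans[OF measure_Un_le] add_mono measure_Un_le) auto
    also have "\<dots> \<le> p n" unfolding p_def using A(2) B(2) C(2) by (intro add_mono)
    also have "\<dots> < \<epsilon>" by (rule pn)
    finally show ?thesis .
  qed
  then show ?thesis by (intro exI[of _ "max N 1"]) auto
qed

end

theorem theorem3p1:
  fixes M :: "'w measure"
    and X :: "nat \<Rightarrow> 'w \<Rightarrow> real ^ 'q"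
    and T W :: "nat \<Rightarrow> 'w \<Rightarrow> real"
    and \<beta> :: "real ^ 'q"
    and \<K> :: "(real ^ 'q) set"
    and b L :: real
    and r :: nat
  assumes model: "regression_model M X T W"
    and b: "b \<ge> 3"
    and r: "r = nat \<lfloor>(b - 1) / 2\<rfloor>"
    and L: "L > 0"
    and A1: "assumption_A1 M X T \<K>"
    and A2: "assumption_A2 M W"
    and A3: "assumption_A3 M X T"
    and A5: "assumption_A5 M X T b"
  shows
    "(\<forall>\<alpha> f (K :: nat \<Rightarrow> nat) Ihat.
        1/2 < \<alpha> \<and> \<alpha> < real r \<and>
        f \<in> smoothness_ball (law_T M T) \<alpha> L \<and> assumption_A4 \<K> \<beta> f \<and>
        (\<forall>n\<ge>1. dyadic_asymp (real (K n)) (real n powr (1 / (2 * \<alpha> + 1)))) \<and>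
        (\<forall>n\<ge>1. selected_index_set M X T (response X T W \<beta> f) r (K n) n (Ihat n))
        \<longrightarrow> (\<lambda>n. measure M {\<omega> \<in> space M. Ihat n \<omega> \<noteq> active_set \<beta>}) \<longlonglongrightarrow> 0)
     \<and>
     (\<forall>a (K :: nat \<Rightarrow> nat).
        0 < a \<and>
        (\<forall>n\<ge>1. dyadic_asymp (real (K n)) (real n powr (1 / (2 * a + 2))))
        \<longrightarrow> (\<forall>\<epsilon>>0. \<exists>N\<ge>1. \<forall>n\<ge>N. \<forall>\<alpha>\<in>{1/2 + a ..< real r}.
              \<forall>f. f \<in> smoothness_ball (law_T M T) \<alpha> L \<and> assumption_A4 \<K> \<beta> f \<longrightarrow>
                (\<forall>Ihat. selected_index_set M X T (response X T W \<beta> f) r (K n) n Ihat \<longrightarrow>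
                   measure M {\<omega> \<in> space M. Ihat \<omega> \<noteq> active_set \<beta>} < \<epsilon>)))"
proof -
  interpret regression_model M X T W by (rule model)
  \<comment> \<open>So the splines are at least piecewise constant.\<close>
  have "1 \<le> \<lfloor>(b - 1) / 2\<rfloor>" using b by (simp add: le_floor_iff)
  then have r0: "0 < r" using r by simp
  show ?thesis
  proof (intro conjI allI impI, goal_cases)
    case (1 \<alpha> f K Ihat)
    \<comment> \<open>Used with \<open>\<kappa> = \<alpha>\<close>: the uniform statement is needed
      only at the left end of its range.\<close>
    then have \<alpha>: "1/2 < \<alpha>" "\<alpha> \<in> {\<alpha>..<real r}" and f: "f \<in> smoothness_ball (law_T M T) \<alpha> L"
      and K: "\<And>n. 1 \<le> n \<Longrightarrow> dyadic_asymp (real (K n)) (real n powr (1 / (2 * \<alpha> + 1)))"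
      and sel: "\<And>n. 1 \<le> n \<Longrightarrow> selected_index_set M X T (response X T W \<beta> f) r (K n) n (Ihat n)"
      by auto
    show ?case
    proof (rule LIMSEQ_I)
      fix \<epsilon> :: real assume "0 < \<epsilon>"
      from selection_consistent[OF A1 A2 r0 \<alpha>(1) K this, where L = L and \<beta> = \<beta>]
      obtain N where "1 \<le> N" and N: "\<And>n Ihat. N \<le> n \<Longrightarrow>
          selected_index_set M X T (response X T W \<beta> f) r (K n) n Ihat \<Longrightarrow>
          measure M {\<omega> \<in> space M. Ihat \<omega> \<noteq> active_set \<beta>} < \<epsilon>"
        using \<alpha>(2) f by blast
      then show "\<exists>N. \<forall>n\<ge>N. norm (measure M {\<omega> \<in> space M. Ihat n \<omega> \<noteq> active_set \<beta>} - 0) < \<epsilon>"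
        using sel by (intro exI[of _ N]) simp
    qed
  next
    case (2 a K \<epsilon>)
    \<comment> \<open>With \<open>\<kappa> = 1/2 + a\<close> the exponent
      \<open>1 / (2 \<kappa> + 1)\<close> is the prescribed \<open>1 / (2 a + 2)\<close>.\<close>
    have eq: "2 * (1/2 + a) + 1 = 2 * a + 2" by simp
    have K: "dyadic_asymp (real (K n)) (real n powr (1 / (2 * (1/2 + a) + 1)))" if "1 \<le> n" for n
      unfolding eq using 2(1) that by blast
    have "1/2 < 1/2 + a" using 2(1) by simp
    from selection_consistent[OF A1 A2 r0 this K 2(2), where L = L and \<beta> = \<beta>]
    show ?case by blast
  qed
qed

end
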